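(* For all $3\le m<\infty$, define $$\mathfrak L_m=|z|^{1-m}\partial_z^2\left(|z|^{m-1}(\,\cdot\,)\right)=\partial_z^2+\frac{m-1}{z}\partial_z+\frac{(m-1)(m-3)}{4z^2}.$$ Fix $0<a<b<\infty$ and let $\Omega=B_b\setminus\overline B_a(0)\subset\mathbb R^2\simeq\mathbb C$. Then, for all $u\in W^{2,2}_0(\Omega)$, for all $-\infty<\beta<\frac{m-1}{4}$ such that $\beta\ne\frac12$, and for all $-\infty<\gamma<\frac{m-1}{2}$ such that $\gamma\neq1$, we have $$\int_\Omega\frac{u^2}{|x|^4}|x|^{4\beta}dx\le\frac{8}{(m-1)(m-1-4\beta)(1-2\beta)^2}\int_\Omega|\mathfrak L_mu|^2|x|^{4\beta}dx,$$ $$\int_\Omega\frac{|\nabla u|^2}{|x|^2}|x|^{2\gamma}dx\le\frac{8}{(m-1)(m-1-2\gamma)}\int_\Omega|\mathfrak L_mu|^2|x|^{2\gamma}dx.$$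
   Context: $B_r$ is the open disc of radius $r$ centred at $0$; $z=x_1+ix_2$ and $\partial_z=\frac12(\partial_{x_1}-i\partial_{x_2})$; functions $u$ are real-valued ($\mathfrak L_mu$ is complex-valued); $W^{2,2}_0(\Omega)$ is the closure of $C_c^\infty(\Omega)$ in $W^{2,2}(\Omega)$; $m$ is a real number. *)

theory Defs
  imports "HOL-Analysis.Analysis"
begin

(* Iterated classical partial derivatives; a list of basis vectors plays the role of a
   multi-index. *)

definition partial_deriv ::
    "'a::euclidean_space \<Rightarrow> ('a \<Rightarrow> 'b::euclidean_space) \<Rightarrow> 'a \<Rightarrow> 'b" where
  "partial_deriv e f x = frechet_derivative f (at x) e"

definition iter_partial ::
    "'a::euclidean_space list \<Rightarrow> ('a \<Rightarrow> 'b::euclidean_space) \<Rightarrow> 'a \<Rightarrow> 'b" where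
  "iter_partial ds f = foldr partial_deriv ds f"

(* All iterated partials are (totally) differentiable, hence continuous: this is C^infinity. *)
definition smooth :: "('a::euclidean_space \<Rightarrow> 'b::euclidean_space) \<Rightarrow> bool" where
  "smooth f \<longleftrightarrow> (\<forall>ds. set ds \<subseteq> Basis \<longrightarrow> iter_partial ds f differentiable_on UNIV)"

definition test_functions :: "'a::euclidean_space set \<Rightarrow> ('a \<Rightarrow> real) set" where
  "test_functions S =
     {\<phi>. smooth \<phi> \<and> compact (closure {x. \<phi> x \<noteq> 0}) \<and> closure {x. \<phi> x \<noteq> 0} \<subseteq> S}"

definition locally_integrable_on ::
    "('a::euclidean_space \<Rightarrow> 'b::euclidean_space) \<Rightarrow> 'a set \<Rightarrow> bool"
    (infixr "locally'_integrable'_on" 46) where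
  "f locally_integrable_on S \<longleftrightarrow>
     (\<forall>K. compact K \<and> K \<subseteq> S \<longrightarrow> f absolutely_integrable_on K)"

definition has_weak_deriv ::
    "'a::euclidean_space set \<Rightarrow> 'a list \<Rightarrow> ('a \<Rightarrow> 'b::euclidean_space) \<Rightarrow> ('a \<Rightarrow> 'b) \<Rightarrow> bool" where
  "has_weak_deriv S ds u v \<longleftrightarrow>
     u locally_integrable_on S \<and> v locally_integrable_on S \<and>
     (\<forall>\<phi>\<in>test_functions S.
        (LINT x:S|lebesgue. iter_partial ds \<phi> x *\<^sub>R u x) =
        (-1) ^ length ds *\<^sub>R (LINT x:S|lebesgue. \<phi> x *\<^sub>R v x))"

(* A representative: weak derivatives on an open S are unique only up to null sets, and values
   outside S are meaningless. *)
definition weak_deriv ::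
    "'a::euclidean_space set \<Rightarrow> 'a list \<Rightarrow> ('a \<Rightarrow> 'b::euclidean_space) \<Rightarrow> 'a \<Rightarrow> 'b" where
  "weak_deriv S ds u = (SOME v. has_weak_deriv S ds u v)"

definition square_integrable_on ::
    "('a::euclidean_space \<Rightarrow> 'b::euclidean_space) \<Rightarrow> 'a set \<Rightarrow> bool"
    (infixr "square'_integrable'_on" 46) where
  "f square_integrable_on S \<longleftrightarrow>
     set_borel_measurable lebesgue S f \<and> set_integrable lebesgue S (\<lambda>x. (norm (f x))\<^sup>2)"

definition multi_indices :: "nat \<Rightarrow> 'a::euclidean_space list set" where
  "multi_indices k = {ds. set ds \<subseteq> Basis \<and> length ds \<le> k}"

(* W^{k,2}(S), for real-valued functions. *)
definition sobolev :: "nat \<Rightarrow> 'a::euclidean_space set \<Rightarrow> ('a \<Rightarrow> real) set" where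
  "sobolev k S =
     {u. u square_integrable_on S \<and>
         (\<forall>ds\<in>multi_indices k. \<exists>v. has_weak_deriv S ds u v \<and> v square_integrable_on S)}"

(* Mixed derivatives are counted once for each order of differentiation; this gives a norm
   equivalent to the one summing over unordered multi-indices. *)
definition sobolev_norm :: "nat \<Rightarrow> 'a::euclidean_space set \<Rightarrow> ('a \<Rightarrow> real) \<Rightarrow> real" where
  "sobolev_norm k S u =
     sqrt (\<Sum>ds\<in>multi_indices k. LINT x:S|lebesgue. (weak_deriv S ds u x)\<^sup>2)"

(* W^{k,2}_0(S): the closure of the test functions in W^{k,2}(S). *)
definition sobolev_0 :: "nat \<Rightarrow> 'a::euclidean_space set \<Rightarrow> ('a \<Rightarrow> real) set" where
  "sobolev_0 k S =
     {u \<in> sobolev k S. \<forall>\<epsilon>>0. \<exists>\<phi>\<in>test_functions S. sobolev_norm k S (\<lambda>x. u x - \<phi> x) < \<epsilon>}"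

definition weak_grad :: "'a::euclidean_space set \<Rightarrow> ('a \<Rightarrow> real) \<Rightarrow> 'a \<Rightarrow> 'a" where
  "weak_grad S u x = (\<Sum>e\<in>Basis. weak_deriv S [e] u x *\<^sub>R e)"

(* The Wirtinger derivative, in the weak sense, with R^2 identified with the type complex. *)
definition weak_dz :: "complex set \<Rightarrow> (complex \<Rightarrow> complex) \<Rightarrow> complex \<Rightarrow> complex" where
  "weak_dz S f z = (weak_deriv S [1] f z - \<i> * weak_deriv S [\<i>] f z) / 2"

definition L_op :: "real \<Rightarrow> complex set \<Rightarrow> (complex \<Rightarrow> real) \<Rightarrow> complex \<Rightarrow> complex" where
  "L_op m S u z =
     of_real (cmod z powr (1 - m)) *
     weak_dz S (weak_dz S (\<lambda>w. of_real (cmod w powr (m - 1) * u w))) z"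

end

theory Submission imports Defs
begin

text \<open>
  Put \<open>k = m - 1\<close>, \<open>s = \<gamma> - 1\<close>, \<open>d = k - \<gamma>\<close> and use logarithmic polar coordinates \<open>z = exp (t + \<i> \<theta>)\<close>, in
  which \<open>2 z \<partial>\<^sub>z = \<partial>\<^sub>t - \<i> \<partial>\<^sub>\<theta>\<close>. For a test function \<open>\<phi>\<close> and \<open>v = |z| powr s * \<phi>\<close>, integration by parts shows
  that the integrals \<open>dx\<close> of \<open>16 |L \<phi>|\<^sup>2 |z| powr (2 \<gamma>)\<close> and \<open>|\<nabla> \<phi>|\<^sup>2 |z| powr (2 \<gamma> - 2)\<close> equal the integrals \<open>dt d\<theta>\<close> of
  \<open>(v\<^sub>t\<^sub>t + v\<^sub>\<theta>\<^sub>\<theta>)\<^sup>2 + (2 d\<^sup>2 + 2) v\<^sub>t\<^sup>2 + (6 d\<^sup>2 - 2) v\<^sub>\<theta>\<^sup>2 + (d\<^sup>2 - 1)\<^sup>2 v\<^sup>2\<close> and \<open>v\<^sub>t\<^sup>2 + v\<^sub>\<theta>\<^sup>2 + s\<^sup>2 v\<^sup>2\<close>.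
  The first form dominates \<open>2 k (k - 2 \<gamma>)\<close> times the second one coefficient by coefficient, which is the
  gradient inequality; dropping the derivatives of \<open>v\<close> in the second form gives the inequality for
  \<open>u\<close>, with \<open>\<gamma> = 2 \<beta>\<close>. As the weights are bounded on the annulus, both inequalities and the product
  rule behind the expansion of the operator pass to limits of test functions in the Sobolev norm.
\<close>

text \<open>With \<open>P = 2 z \<partial>\<^sub>z\<close> one has
  \<open>4 z\<^sup>2 L = (P + k) (P + k - 2)\<close>, and passing from \<open>\<phi>\<close> to
  \<open>v\<close> turns this into \<open>(P + d + 1) (P + d - 1)\<close>. On the mode
  \<open>exp (\<i> \<tau> t + \<i> n \<theta>)\<close> the operator \<open>P\<close> is
  multiplication by \<open>n + \<i> \<tau>\<close>, so the squared modulus has the symbol \<open>((n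
  + d + 1)\<^sup>2 + \<tau>\<^sup>2) ((n + d - 1)\<^sup>2 + \<tau>\<^sup>2)\<close>, which
  degenerates at \<open>\<tau> = 0\<close>, \<open>n = - d \<plusminus> 1\<close>. Real values of
  \<open>u\<close> rescue the estimate: a real \<open>v\<close> has equal energy at \<open>n\<close>
  and \<open>- n\<close>, and averaging the symbol over both signs removes the terms odd in
  \<open>n\<close> and leaves exactly the coefficients \<open>2 d\<^sup>2 + 2\<close>,
  \<open>6 d\<^sup>2 - 2\<close>, \<open>(d\<^sup>2 - 1)\<^sup>2\<close>. Integration by parts does
  this averaging without Fourier series, the odd terms turning into divergences. The constant 8 is
  16 / 2, with 16 from \<open>|4 z\<^sup>2 L|\<^sup>2\<close> and 2 from the comparison of the
  forms. A second obstacle is that weak derivatives are arbitrary choices, known only almost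
  everywhere, and that the operator nests two of them. Uniqueness must therefore be available before
  the operator can be expanded.\<close>

section \<open>Integration by parts against test functions\<close>

text \<open>Difference quotients of \<open>g\<close> along \<open>e\<close> integrate to 0 by
  translation invariance, and dominated convergence carries this over to their limit
  \<open>G\<close>. Measurability of \<open>G\<close> comes with the pointwise limit.\<close>

lemma integral_directional_derivative_eq_0:
  fixes g G :: "'a::euclidean_space \<Rightarrow> 'b::euclidean_space"
  assumes cont: "continuous_on UNIV g"
    and deriv: "\<And>x. ((\<lambda>t. g (x + t *\<^sub>R e)) has_vector_derivative G x) (at 0)"
    and K: "compact K" and supp: "\<And>x. x \<notin> K \<Longrightarrow> g x = 0"
    and bound: "\<And>x. norm (G x) \<le> B"
  shows "integrable lebesgue G" "integral\<^sup>L lebesgue G = 0"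
proof -
  define t :: "nat \<Rightarrow> real" where "t n = 1 / real (Suc n)" for n
  have t: "t n > 0" "t n \<le> 1" for n by (auto simp: t_def)
  have t0: "t \<longlonglongrightarrow> 0" unfolding t_def by (rule LIMSEQ_Suc[OF lim_1_over_n])
  define q where "q n x = (1 / t n) *\<^sub>R (g (x + t n *\<^sub>R e) - g x)" for n x
  obtain R where R: "K \<subseteq> ball 0 R" using compact_imp_bounded[OF K] bounded_subset_ballD by blast
  \<comment> \<open>The steps \<open>t n\<close> are at most 1, so a point outside this enlarged
    ball is outside \<open>K\<close> both before and after the shift by
    \<open>t n *\<^sub>R e\<close>. One indicator thus dominates all quotients.\<close>
  define K' where "K' = cball (0::'a) (R + norm e)"
  have [measurable]: "g \<in> borel_measurable borel"
    using cont by (rule borel_measurable_continuous_onI)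
  have B0: "B \<ge> 0" using bound[of 0] norm_ge_zero order_trans by blast
  have sh: "((\<lambda>t. g (x + t *\<^sub>R e)) has_vector_derivative G (x + s *\<^sub>R e)) (at s)" for x s
  proof -
    have 1: "((\<lambda>r. r - s) has_vector_derivative 1) (at s)"
      by (auto intro!: derivative_eq_intros)
    have "((\<lambda>t. g (x + s *\<^sub>R e + t *\<^sub>R e)) has_vector_derivative G (x + s *\<^sub>R e)) (at (s - s))"
      using deriv by simp
    from vector_diff_chain_at[OF 1 this]
    have "((\<lambda>t. g (x + s *\<^sub>R e + (t - s) *\<^sub>R e)) has_vector_derivative G (x + s *\<^sub>R e)) (at s)"
      by (simp add: o_def)
    moreover have "x + s *\<^sub>R e + (t - s) *\<^sub>R e = x + t *\<^sub>R e" for t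
      by (simp add: algebra_simps)
    ultimately show ?thesis by simp
  qed
  have lip: "norm (g (x + r *\<^sub>R e) - g x) \<le> B * r" if "r \<ge> 0" for x r
  proof -
    have "norm (g (x + r *\<^sub>R e) - g (x + 0 *\<^sub>R e)) \<le> B * norm (r - 0)"
    proof (rule differentiable_bound[where S = UNIV])
      show "((\<lambda>t. g (x + t *\<^sub>R e)) has_derivative (\<lambda>h. h *\<^sub>R G (x + s *\<^sub>R e))) (at s)" for s
        using sh by (simp add: has_vector_derivative_def)
      show "onorm (\<lambda>h. h *\<^sub>R G (x + s *\<^sub>R e)) \<le> B" for s
      proof (rule onorm_le)
        fix h :: real
        show "norm (h *\<^sub>R G (x + s *\<^sub>R e)) \<le> B * norm h"
          using mult_right_mono[OF bound[of "x + s *\<^sub>R e"] abs_ge_zero[of h]] by (simp add: mult.commute)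
      qed
    qed auto
    then show ?thesis using that by simp
  qed
  have qb: "norm (q n x) \<le> indicator K' x * B" for n x
  proof (cases "x \<in> K'")
    case True
    have "norm (q n x) = norm (g (x + t n *\<^sub>R e) - g x) / t n"
      using t[of n] by (simp add: q_def)
    also have "\<dots> \<le> B * t n / t n" using lip[of "t n" x] t[of n] by (intro divide_right_mono) auto
    finally show ?thesis using True t[of n] by simp
  next
    case False
    then have x: "norm x > R + norm e" by (auto simp: K'_def)
    have "norm (x + t n *\<^sub>R e) \<ge> norm x - norm e"
    proof -
      have "norm (t n *\<^sub>R e) \<le> norm e" using t[of n] by (simp add: mult_left_le_one_le)
      then show ?thesis using norm_diff_ineq[of x "t n *\<^sub>R e"] by linarith
    qed
    then have "x \<notin> K" "x + t n *\<^sub>R e \<notin> K" using R x by (auto simp: subset_iff) (smt (verit) norm_ge_zero)+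
    then have "q n x = 0" using supp by (simp add: q_def)
    then show ?thesis using False by simp
  qed
  have lim: "(\<lambda>n. q n x) \<longlonglongrightarrow> G x" for x
  proof -
    have "((\<lambda>h. norm (g (x + h *\<^sub>R e) - g x - h *\<^sub>R G x) / norm h) \<longlongrightarrow> 0) (at 0)"
      using deriv[of x] unfolding has_vector_derivative_def has_derivative_at by simp
    moreover have "filterlim t (at 0) sequentially"
      using t0 t by (auto simp: filterlim_at eventually_sequentially less_le)
    ultimately have "(\<lambda>n. norm (g (x + t n *\<^sub>R e) - g x - t n *\<^sub>R G x) / norm (t n)) \<longlonglongrightarrow> 0"
      by (rule filterlim_compose)
    moreover have "norm (g (x + t n *\<^sub>R e) - g x - t n *\<^sub>R G x) / norm (t n) = norm (q n x - G x)" for n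
    proof -
      have "q n x - G x = (1 / t n) *\<^sub>R (g (x + t n *\<^sub>R e) - g x - t n *\<^sub>R G x)"
        using t[of n] by (simp add: q_def algebra_simps)
      then show ?thesis using t[of n] by simp
    qed
    ultimately show ?thesis by (simp add: LIM_zero_iff tendsto_norm_zero_iff)
  qed
  have q[measurable]: "q n \<in> borel_measurable borel" for n unfolding q_def by measurable
  have G[measurable]: "G \<in> borel_measurable borel"
    by (rule borel_measurable_LIMSEQ_metric[OF q lim])
  have K'i: "integrable lborel (\<lambda>x. indicator K' x * B)"
    unfolding K'_def by (intro integrable_mult_left) (simp add: integrable_indicator_iff emeasure_lborel_cball_finite[unfolded infinity_ennreal_def])
  have gi: "integrable lborel g"
  proof -
    obtain C where C: "\<And>x. x \<in> K \<Longrightarrow> norm (g x) \<le> C"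
      using compact_imp_bounded[OF compact_continuous_image[OF continuous_on_subset[OF cont] K]]
      by (auto simp: bounded_iff)
    have "integrable lborel (\<lambda>x. indicator K x *\<^sub>R g x)"
      by (rule borel_integrable_compact[OF K]) (use cont continuous_on_subset in blast)
    moreover have "indicator K x *\<^sub>R g x = g x" for x using supp by (auto simp: indicator_def)
    ultimately show ?thesis by simp
  qed
  have tr: "integrable lborel (\<lambda>x. g (c + x))" "(\<integral>x. g (c + x) \<partial>lborel) = integral\<^sup>L lborel g" for c
  proof -
    have "integrable (distr lborel borel ((+) c)) g" using gi by (simp add: lborel_distr_plus)
    then show "integrable lborel (\<lambda>x. g (c + x))" by (subst (asm) integrable_distr_eq) auto
    have "integral\<^sup>L (distr lborel borel ((+) c)) g = (\<integral>x. g (c + x) \<partial>lborel)"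
      by (rule integral_distr) auto
    then show "(\<integral>x. g (c + x) \<partial>lborel) = integral\<^sup>L lborel g" by (simp add: lborel_distr_plus)
  qed
  have q0: "integral\<^sup>L lborel (q n) = 0" for n
    unfolding q_def using gi tr[of "t n *\<^sub>R e"] by (simp add: add.commute)
  have Gi: "integrable lborel G"
    using integrable_dominated_convergence[OF _ _ K'i, of G q] lim qb by auto
  have "(\<lambda>n. integral\<^sup>L lborel (q n)) \<longlonglongrightarrow> integral\<^sup>L lborel G"
    using integral_dominated_convergence[OF _ _ K'i, of G q] lim qb by auto
  then have "integral\<^sup>L lborel G = 0"
    unfolding q0 by (simp add: LIMSEQ_const_iff)
  with Gi show "integrable lebesgue G" "integral\<^sup>L lebesgue G = 0"
    by (simp_all add: integrable_completion integral_completion)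
qed

lemma smooth_iter_partial_differentiable:
  "smooth f \<Longrightarrow> set ds \<subseteq> Basis \<Longrightarrow> iter_partial ds f differentiable (at x)"
  by (auto simp: smooth_def differentiable_on_def)

lemma iter_partial_Nil [simp]: "iter_partial [] f = f"
  and iter_partial_Cons: "iter_partial (e # ds) f = partial_deriv e (iter_partial ds f)"
  by (simp_all add: iter_partial_def)

lemma smooth_iter_partial_continuous:
  "smooth f \<Longrightarrow> set ds \<subseteq> Basis \<Longrightarrow> continuous_on A (iter_partial ds f)"
  by (meson continuous_at_imp_continuous_on differentiable_imp_continuous_within
      smooth_iter_partial_differentiable)

lemma smooth_partial_deriv: "smooth f \<Longrightarrow> e \<in> Basis \<Longrightarrow> smooth (partial_deriv e f)"
proof -
  assume f: "smooth f" "e \<in> Basis"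
  have "iter_partial ds (partial_deriv e f) = iter_partial (ds @ [e]) f" for ds
    by (simp add: iter_partial_def)
  then show ?thesis using f by (auto simp: smooth_def)
qed

lemma partial_deriv_eqI:
  "(f has_derivative f') (at x) \<Longrightarrow> partial_deriv e f x = f' e"
  by (metis frechet_derivative_at partial_deriv_def)

text \<open>The complement of the closed support is open, so vanishing there survives every
  differentiation.\<close>

lemma iter_partial_eq_0_outside:
  assumes "x \<notin> closure {x. f x \<noteq> 0}"
  shows "iter_partial ds f x = 0"
proof -
  let ?U = "- closure {x. f x \<noteq> 0}"
  have "\<forall>x\<in>?U. iter_partial ds f x = 0"
  proof (induction ds)
    case Nil
    then show ?case using closure_subset[of "{x. f x \<noteq> 0}"] by auto
  next
    case (Cons e ds)
    show ?case
    proof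
      fix x assume x: "x \<in> ?U"
      have "(iter_partial ds f has_derivative (\<lambda>h. 0)) (at x)"
        by (rule has_derivative_transform_within_open[of "\<lambda>_. 0" _ _ _ ?U])
          (use x Cons in \<open>auto simp: open_Compl\<close>)
      from partial_deriv_eqI[OF this]
      show "iter_partial (e # ds) f x = 0" by (simp add: iter_partial_Cons)
    qed
  qed
  then show ?thesis using assms by auto
qed

lemma integrable_compact_support:
  fixes f :: "'a::euclidean_space \<Rightarrow> 'b::euclidean_space"
  assumes "compact K" "continuous_on K f" "\<And>x. x \<notin> K \<Longrightarrow> f x = 0"
  shows "integrable lebesgue f"
proof -
  have "integrable lborel (\<lambda>x. indicator K x *\<^sub>R f x)"
    by (rule borel_integrable_compact) fact+
  moreover have "(\<lambda>x. indicator K x *\<^sub>R f x) = f" using assms(3) by (auto simp: indicator_def)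
  ultimately show ?thesis by (simp add: integrable_completion)
qed

lemma continuous_on_imp_locally_integrable_on:
  fixes f :: "'a::euclidean_space \<Rightarrow> 'b::euclidean_space"
  assumes "continuous_on S f"
  shows "f locally_integrable_on S"
  unfolding locally_integrable_on_def
proof (intro allI impI)
  fix K assume K: "compact K \<and> K \<subseteq> S"
  have "integrable lborel (\<lambda>x. indicator K x *\<^sub>R f x)"
    by (rule borel_integrable_compact) (use K assms continuous_on_subset in auto)
  then show "f absolutely_integrable_on K"
    by (simp add: set_integrable_def integrable_completion)
qed

lemma test_functionsD:
  assumes "\<phi> \<in> test_functions S"
  shows "smooth \<phi>" "compact (closure {x. \<phi> x \<noteq> 0})" "closure {x. \<phi> x \<noteq> 0} \<subseteq> S"
  using assms by (auto simp: test_functions_def)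

text \<open>Integration by parts for a function that is differentiable only on \<open>S\<close>: the
  product with a test function vanishes near the boundary, so its zero extension is differentiable
  everywhere and its derivative integrates to 0.\<close>

lemma has_weak_deriv_classical:
  fixes F :: "'a::euclidean_space \<Rightarrow> 'b::euclidean_space"
  assumes S: "open S" and e: "e \<in> Basis"
    and F: "\<And>x. x \<in> S \<Longrightarrow> (F has_derivative F' x) (at x)"
    and F': "continuous_on S (\<lambda>x. F' x e)"
  shows "has_weak_deriv S [e] F (\<lambda>x. F' x e)"
proof -
  have Fc: "continuous_on S F"
    by (meson F continuous_at_imp_continuous_on has_derivative_continuous)
  have "(LINT x:S|lebesgue. iter_partial [e] \<phi> x *\<^sub>R F x) =
        - (LINT x:S|lebesgue. \<phi> x *\<^sub>R F' x e)" if \<phi>: "\<phi> \<in> test_functions S" for \<phi>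
  proof -
    define K where "K = closure {x. \<phi> x \<noteq> 0}"
    note t = test_functionsD[OF \<phi>, folded K_def]
    have z: "iter_partial ds \<phi> x = 0" if "x \<notin> K" for ds x
      using iter_partial_eq_0_outside that by (auto simp: K_def)
    note z0 = z[of _ "[]", simplified]
    define h1 where "h1 x = indicator S x *\<^sub>R (iter_partial [e] \<phi> x *\<^sub>R F x)" for x
    define h2 where "h2 x = indicator S x *\<^sub>R (\<phi> x *\<^sub>R F' x e)" for x
    have KS: "K \<subseteq> S" using t by simp
    have c: "continuous_on A \<phi>" "continuous_on A (iter_partial [e] \<phi>)" for A
      using smooth_iter_partial_continuous[OF t(1), of "[]"]
        smooth_iter_partial_continuous[OF t(1), of "[e]"] e by auto
    have cK: "continuous_on K h1" "continuous_on K h2"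
    proof -
      have "continuous_on K (\<lambda>x. iter_partial [e] \<phi> x *\<^sub>R F x)" "continuous_on K (\<lambda>x. \<phi> x *\<^sub>R F' x e)"
        using c KS Fc F' by (auto intro!: continuous_intros intro: continuous_on_subset)
      moreover have "h1 x = iter_partial [e] \<phi> x *\<^sub>R F x" "h2 x = \<phi> x *\<^sub>R F' x e" if "x \<in> K" for x
        using that KS by (auto simp: h1_def h2_def)
      ultimately show "continuous_on K h1" "continuous_on K h2"
        by (simp_all cong: continuous_on_cong)
    qed
    have hz: "h1 x = 0" "h2 x = 0" if "x \<notin> K" for x using z[OF that] z0[OF that] by (auto simp: h1_def h2_def)
    have i: "integrable lebesgue h1" "integrable lebesgue h2"
      by (rule integrable_compact_support[OF t(2)]; use cK hz in blast)+
    \<comment> \<open>The zero extension of \<open>\<phi> F\<close>. It is differentiable off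
      \<open>S\<close> as well, because the open set \<open>- K\<close> contains the complement of
      \<open>S\<close> and \<open>g\<close> vanishes there.\<close>
    define g where "g x = indicator S x *\<^sub>R (\<phi> x *\<^sub>R F x)" for x
    define g' where "g' x h = indicator S x *\<^sub>R (\<phi> x *\<^sub>R F' x h + frechet_derivative \<phi> (at x) h *\<^sub>R F x)" for x h
    have gd: "(g has_derivative g' x) (at x)" for x
    proof (cases "x \<in> S")
      case True
      have "(\<phi> has_derivative frechet_derivative \<phi> (at x)) (at x)"
        using smooth_iter_partial_differentiable[OF t(1), of "[]"] by (simp add: frechet_derivative_works)
      note d = has_derivative_scaleR[OF this F[OF True]]
      have g'x: "g' x = (\<lambda>h. \<phi> x *\<^sub>R F' x h + frechet_derivative \<phi> (at x) h *\<^sub>R F x)"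
        using True by (simp add: g'_def fun_eq_iff)
      from d
      have "((\<lambda>x. \<phi> x *\<^sub>R F x) has_derivative g' x) (at x)"
        unfolding g'x .
      then show ?thesis
        by (rule has_derivative_transform_within_open[of _ _ _ _ S]) (use True S in \<open>auto simp: g_def\<close>)
    next
      case False
      then have "x \<in> - K" using KS by auto
      then have "(g has_derivative (\<lambda>h. 0)) (at x)"
      proof (rule has_derivative_transform_within_open[of "\<lambda>_. 0" _ _ _ "- K", rotated 2])
        show "open (- K)" using t(2) by (simp add: open_Compl compact_imp_closed)
        show "0 = g y" if "y \<in> - K" for y using that z0 by (simp add: g_def)
      qed auto
      then show ?thesis using False by (simp add: g'_def[abs_def])
    qed
    have ge: "g' x e = h1 x + h2 x" for x
      by (simp add: g'_def h1_def h2_def iter_partial_def partial_deriv_def scaleR_add_right add.commute)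
    obtain B1 B2 where B: "\<And>x. x \<in> K \<Longrightarrow> norm (h1 x) \<le> B1" "\<And>x. x \<in> K \<Longrightarrow> norm (h2 x) \<le> B2"
      using compact_imp_bounded[OF compact_continuous_image[OF cK(1) t(2)]]
        compact_imp_bounded[OF compact_continuous_image[OF cK(2) t(2)]]
      by (auto simp: bounded_iff)
    have "integral\<^sup>L lebesgue (\<lambda>x. g' x e) = 0"
    proof (rule integral_directional_derivative_eq_0(2))
      show "continuous_on UNIV g"
        using gd by (meson continuous_at_imp_continuous_on has_derivative_continuous)
      show "compact K" by fact
      show "x \<notin> K \<Longrightarrow> g x = 0" for x using z0 by (simp add: g_def)
      show "norm (g' x e) \<le> \<bar>B1\<bar> + \<bar>B2\<bar>" for x
        using B[of x] hz[of x] norm_triangle_ineq[of "h1 x" "h2 x"] unfolding ge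
        by (cases "x \<in> K") auto
      show "((\<lambda>t. g (x + t *\<^sub>R e)) has_vector_derivative g' x e) (at 0)" for x
      proof -
        have "((\<lambda>t. x + t *\<^sub>R e) has_derivative (\<lambda>t. t *\<^sub>R e)) (at 0)"
          by (auto intro!: derivative_eq_intros)
        from diff_chain_at[OF this, of g "g' x"] gd[of x]
        have "((\<lambda>t. g (x + t *\<^sub>R e)) has_derivative (\<lambda>t. g' x (t *\<^sub>R e))) (at 0)"
          by (simp add: o_def)
        moreover have "g' x (t *\<^sub>R e) = t *\<^sub>R g' x e" for t
          using gd[of x] by (simp add: has_derivative_def bounded_linear.linear linear_scale)
        ultimately show ?thesis by (simp add: has_vector_derivative_def)
      qed
    qed
    then have "integral\<^sup>L lebesgue h1 + integral\<^sup>L lebesgue h2 = 0"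
      using i by (simp add: ge)
    then show ?thesis
      unfolding set_lebesgue_integral_def h1_def[symmetric] h2_def[symmetric]
      by (simp add: eq_neg_iff_add_eq_0)
  qed
  then show ?thesis
    unfolding has_weak_deriv_def using Fc F' continuous_on_imp_locally_integrable_on by auto
qed

section \<open>Uniqueness of weak derivatives\<close>

text \<open>Finite-order differentiability is put as a recursion with an existential derivative, so
  that closure under products and affine substitution is a single induction on the order.\<close>

primrec times_differentiable :: "nat \<Rightarrow> (real \<Rightarrow> real) \<Rightarrow> bool" where
  "times_differentiable 0 p \<longleftrightarrow> True"
| "times_differentiable (Suc n) p \<longleftrightarrow>
     (\<exists>p'. (\<forall>x. (p has_real_derivative p' x) (at x)) \<and> times_differentiable n p')"

lemma times_differentiable_SucD: "times_differentiable (Suc n) p \<Longrightarrow> times_differentiable n p"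
  by (induction n arbitrary: p) auto

lemma times_differentiable_const: "times_differentiable n (\<lambda>x. c)"
proof (induction n arbitrary: c)
  case (Suc n)
  have "\<forall>x. ((\<lambda>x. c) has_real_derivative 0) (at x)" by simp
  then show ?case using Suc[of 0] by (auto intro!: exI[of _ "\<lambda>_. 0"])
qed simp

lemma times_differentiable_add:
  "times_differentiable n p \<Longrightarrow> times_differentiable n q \<Longrightarrow> times_differentiable n (\<lambda>x. p x + q x)"
proof (induction n arbitrary: p q)
  case (Suc n)
  then obtain p' q' where "\<forall>x. (p has_real_derivative p' x) (at x)" "times_differentiable n p'"
    "\<forall>x. (q has_real_derivative q' x) (at x)" "times_differentiable n q'" by auto
  then show ?case using Suc.IH[of p' q']
    by (auto intro!: exI[of _ "\<lambda>x. p' x + q' x"] derivative_intros)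
qed simp

lemma times_differentiable_mult:
  "times_differentiable n p \<Longrightarrow> times_differentiable n q \<Longrightarrow> times_differentiable n (\<lambda>x. p x * q x)"
proof (induction n arbitrary: p q)
  case (Suc n)
  note pq = times_differentiable_SucD[OF Suc.prems(1)] times_differentiable_SucD[OF Suc.prems(2)]
  from Suc.prems obtain p' q' where *: "\<forall>x. (p has_real_derivative p' x) (at x)" "times_differentiable n p'"
    "\<forall>x. (q has_real_derivative q' x) (at x)" "times_differentiable n q'" by auto
  have "times_differentiable n (\<lambda>x. p' x * q x + p x * q' x)"
    using Suc.IH pq * by (intro times_differentiable_add) auto
  moreover have "((\<lambda>x. p x * q x) has_real_derivative p' x * q x + p x * q' x) (at x)" for x
    using * by (auto intro!: derivative_eq_intros)
  ultimately show ?case by (auto intro!: exI[of _ "\<lambda>x. p' x * q x + p x * q' x"])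
qed simp

lemma times_differentiable_affine:
  "times_differentiable n p \<Longrightarrow> times_differentiable n (\<lambda>x. p (a * x + b))"
proof (induction n arbitrary: p)
  case (Suc n)
  then obtain p' where *: "\<forall>x. (p has_real_derivative p' x) (at x)" "times_differentiable n p'" by auto
  have "times_differentiable n (\<lambda>x. a * p' (a * x + b))"
    using * Suc.IH by (intro times_differentiable_mult times_differentiable_const) auto
  moreover have "((\<lambda>x. p (a * x + b)) has_real_derivative a * p' (a * x + b)) (at x)" for x
  proof -
    have "((\<lambda>x. a * x + b) has_real_derivative a) (at x)" by (auto intro!: derivative_eq_intros)
    with * have "((\<lambda>x. p (a * x + b)) has_real_derivative p' (a * x + b) * a) (at x)"
      by (intro DERIV_chain2[of p]) auto
    then show ?thesis by (simp only: mult.commute[of _ a])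
  qed
  ultimately show ?case by (auto intro!: exI[of _ "\<lambda>x. a * p' (a * x + b)"])
qed simp

text \<open>The family below is closed under differentiation, which gives the smoothness of
  \<open>\<lambda>x. exp (- 1 / x)\<close>, extended by 0, at the origin.\<close>

definition flat_exp :: "nat \<Rightarrow> real \<Rightarrow> real" where
  "flat_exp j x = (if x > 0 then (1 / x) ^ j * exp (- (1 / x)) else 0)"

lemma flat_exp_tendsto_0: "(flat_exp j \<longlongrightarrow> 0) (at_right 0)"
proof -
  have "((\<lambda>x. (inverse x) ^ j / exp (inverse x :: real)) \<longlongrightarrow> 0) (at_right 0)"
    by (rule filterlim_compose[OF tendsto_power_div_exp_0 filterlim_inverse_at_top_right])
  then show ?thesis
    by (rule tendsto_cong[THEN iffD1, rotated])
      (auto simp: flat_exp_def eventually_at_right_field exp_minus divide_inverse intro: exI[of _ 1])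
qed

lemma has_real_derivative_flat_exp:
  "(flat_exp j has_real_derivative flat_exp (j + 2) x - real j * flat_exp (Suc j) x) (at x)"
proof -
  consider "x > 0" | "x < 0" | "x = 0" by linarith
  then show ?thesis
  proof cases
    case 1
    have "((\<lambda>x. (1 / x) ^ j * exp (- (1 / x))) has_real_derivative
        flat_exp (j + 2) x - real j * flat_exp (Suc j) x) (at x)"
    proof -
      have d: "((\<lambda>x. 1 / x) has_real_derivative - ((1 / x) ^ 2)) (at x)"
        using 1 by (auto intro!: derivative_eq_intros simp: power2_eq_square)
      have "((\<lambda>x. (1 / x) ^ j * exp (- (1 / x))) has_real_derivative
          real j * (- ((1 / x) ^ 2) * (1 / x) ^ (j - Suc 0)) * exp (- (1 / x)) +
          exp (- (1 / x)) * - (- ((1 / x) ^ 2)) * (1 / x) ^ j) (at x)"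
        by (intro DERIV_mult DERIV_power d DERIV_chain2[OF DERIV_exp] DERIV_minus)
      moreover have "real j * (- ((1 / x) ^ 2) * (1 / x) ^ (j - Suc 0)) * exp (- (1 / x)) +
          exp (- (1 / x)) * - (- ((1 / x) ^ 2)) * (1 / x) ^ j =
          flat_exp (j + 2) x - real j * flat_exp (Suc j) x"
        using 1 by (cases j) (simp_all add: flat_exp_def power_add power2_eq_square mult_ac)
      ultimately show ?thesis by simp
    qed
    then show ?thesis
      by (rule has_field_derivative_transform_within_open[of _ _ _ "{0<..}"])
        (use 1 in \<open>auto simp: flat_exp_def\<close>)
  next
    case 2
    have "((\<lambda>x. 0) has_real_derivative flat_exp (j + 2) x - real j * flat_exp (Suc j) x) (at x)"
      using 2 by (simp add: flat_exp_def)
    then show ?thesis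
      by (rule has_field_derivative_transform_within_open[of _ _ _ "{..<0}"])
        (use 2 in \<open>auto simp: flat_exp_def\<close>)
  next
    case 3
    \<comment> \<open>To the right of 0 the quotient is \<open>flat_exp (Suc j) h\<close>: raising
      the index absorbs the division.\<close>
    have "((\<lambda>h. flat_exp j h / h) \<longlongrightarrow> 0) (at_right 0)"
      by (rule tendsto_cong[THEN iffD1, OF _ flat_exp_tendsto_0[of "Suc j"]])
        (auto simp: flat_exp_def eventually_at_right_field intro: exI[of _ 1])
    moreover have l: "((\<lambda>h. flat_exp j h / h) \<longlongrightarrow> 0) (at_left 0)"
      by (rule tendsto_cong[THEN iffD1, OF _ tendsto_const[of 0]])
        (auto simp: flat_exp_def eventually_at_left_field intro: exI[of _ "-1"])
    ultimately have "((\<lambda>h. flat_exp j h / h) \<longlongrightarrow> 0) (at 0)"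
      using l by (intro filterlim_split_at) auto
    then show ?thesis using 3 by (simp add: has_field_derivative_iff flat_exp_def)
  qed
qed

lemma times_differentiable_flat_exp: "times_differentiable n (flat_exp j)"
proof (induction n arbitrary: j)
  case (Suc n)
  have "times_differentiable n (\<lambda>x. flat_exp (j + 2) x + - real j * flat_exp (Suc j) x)"
    using Suc by (intro times_differentiable_add times_differentiable_mult times_differentiable_const)
  then show ?case
    using has_real_derivative_flat_exp[of j]
    by (auto intro!: exI[of _ "\<lambda>x. flat_exp (j + 2) x - real j * flat_exp (Suc j) x"])
qed simp

lemma has_derivative_tensor:
  fixes p :: "'a::euclidean_space \<Rightarrow> real \<Rightarrow> real"
  assumes "\<And>i y. i \<in> Basis \<Longrightarrow> (p i has_real_derivative p' i y) (at y)"
  shows "((\<lambda>x. \<Prod>i\<in>Basis. p i (x \<bullet> i)) has_derivative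
    (\<lambda>h. \<Sum>i\<in>Basis. (p' i (x \<bullet> i) * (h \<bullet> i)) * (\<Prod>j\<in>Basis - {i}. p j (x \<bullet> j)))) (at x)"
proof (rule has_derivative_prod)
  fix i :: 'a assume i: "i \<in> Basis"
  have "((\<lambda>x. x \<bullet> i) has_derivative (\<lambda>h. h \<bullet> i)) (at x)"
    by (auto intro!: derivative_eq_intros)
  from has_derivative_compose[OF this, of "p i" "\<lambda>t. p' i (x \<bullet> i) * t"] assms[OF i]
  show "((\<lambda>x. p i (x \<bullet> i)) has_derivative (\<lambda>h. p' i (x \<bullet> i) * (h \<bullet> i))) (at x)"
    by (simp add: has_field_derivative_def)
qed

text \<open>Tensor products are closed under partial derivatives, since differentiating along
  \<open>e\<close> only replaces the factor belonging to \<open>e\<close> by its derivative.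
  Smoothness in several variables thus reduces to the one-variable notion.\<close>

lemma smooth_tensor:
  fixes p :: "'a::euclidean_space \<Rightarrow> real \<Rightarrow> real"
  assumes "\<And>i n. i \<in> Basis \<Longrightarrow> times_differentiable n (p i)"
  shows "smooth (\<lambda>x. \<Prod>i\<in>Basis. p i (x \<bullet> i))"
proof -
  have 1: "(\<lambda>x. \<Prod>i\<in>Basis. q i (x \<bullet> i)) differentiable (at x)"
    if "\<forall>i\<in>Basis. \<forall>n. times_differentiable n (q i)" for q :: "'a \<Rightarrow> real \<Rightarrow> real" and x
  proof -
    have "\<forall>i\<in>Basis. \<exists>q'. \<forall>x. (q i has_real_derivative q' x) (at x)"
      using that times_differentiable.simps(2)[of 0] by blast
    then obtain q' where "\<And>i y. i \<in> Basis \<Longrightarrow> (q i has_real_derivative q' i y) (at y)" by metis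
    from has_derivative_tensor[of q q', OF this] show ?thesis unfolding differentiable_def by blast
  qed
  have 2: "\<exists>q. (\<forall>i\<in>Basis. \<forall>n. times_differentiable n (q i)) \<and>
      iter_partial ds (\<lambda>x. \<Prod>i\<in>Basis. p i (x \<bullet> i)) = (\<lambda>x. \<Prod>i\<in>Basis. q i (x \<bullet> i))"
    if "set ds \<subseteq> Basis" for ds
    using that
  proof (induction ds)
    case Nil
    then show ?case using assms by auto
  next
    case (Cons e ds)
    then obtain q where q: "\<forall>i\<in>Basis. \<forall>n. times_differentiable n (q i)"
      "iter_partial ds (\<lambda>x. \<Prod>i\<in>Basis. p i (x \<bullet> i)) = (\<lambda>x. \<Prod>i\<in>Basis. q i (x \<bullet> i))" by auto
    have e: "e \<in> Basis" using Cons by simp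
    define q' where "q' i = deriv (q i)" for i
    have q': "(q i has_real_derivative q' i y) (at y)" and q'n: "times_differentiable n (q' i)" if "i \<in> Basis" for i y n
    proof -
      have "times_differentiable (Suc n) (q i)" using q that by blast
      then obtain r where r: "\<forall>x. (q i has_real_derivative r x) (at x)" "times_differentiable n r" by auto
      have "r = q' i"
      proof (rule ext)
        fix y
        show "r y = q' i y" unfolding q'_def using r(1) by (intro DERIV_imp_deriv[symmetric]) simp
      qed
      then show "(q i has_real_derivative q' i y) (at y)" "times_differentiable n (q' i)" using r by auto
    qed
    have "partial_deriv e (\<lambda>x. \<Prod>i\<in>Basis. q i (x \<bullet> i)) x = (\<Prod>i\<in>Basis. (q(e := q' e)) i (x \<bullet> i))" for x
    proof -
      have "partial_deriv e (\<lambda>x. \<Prod>i\<in>Basis. q i (x \<bullet> i)) x =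
        (\<Sum>i\<in>Basis. (q' i (x \<bullet> i) * (e \<bullet> i)) * (\<Prod>j\<in>Basis - {i}. q j (x \<bullet> j)))"
        by (rule partial_deriv_eqI[OF has_derivative_tensor]) (rule q')
      also have "\<dots> = (\<Sum>i\<in>Basis. if i = e then q' e (x \<bullet> e) * (\<Prod>j\<in>Basis - {e}. q j (x \<bullet> j)) else 0)"
        using e by (intro sum.cong) (auto simp: inner_Basis)
      also have "\<dots> = q' e (x \<bullet> e) * (\<Prod>j\<in>Basis - {e}. q j (x \<bullet> j))"
        using e by simp
      also have "(\<Prod>j\<in>Basis - {e}. q j (x \<bullet> j)) = (\<Prod>j\<in>Basis - {e}. (q(e := q' e)) j (x \<bullet> j))"
        by (rule prod.cong) auto
      also have "q' e (x \<bullet> e) * (\<Prod>j\<in>Basis - {e}. (q(e := q' e)) j (x \<bullet> j)) = (\<Prod>i\<in>Basis. (q(e := q' e)) i (x \<bullet> i))"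
        using prod.remove[OF finite_Basis e, of "\<lambda>i. (q(e := q' e)) i (x \<bullet> i)"]
        by (simp only: fun_upd_same)
      finally show ?thesis .
    qed
    then show ?case using q q'n e
      by (intro exI[of _ "q(e := q' e)"]) (auto simp: iter_partial_Cons)
  qed
  show ?thesis
    unfolding smooth_def differentiable_on_def using 1 2 by fastforce
qed

text \<open>With \<open>N = Suc n\<close> each coordinate carries the factor
  \<open>exp (- 1 / (N (t - a))) * exp (- 1 / (N (b - t)))\<close>, which vanishes off the open
  interval, stays below 1 and tends to 1 inside it as \<open>N\<close> grows. The closed box
  contains all the supports.\<close>

lemma test_functions_approx_box:
  fixes a b :: "'a::euclidean_space"
  assumes "cbox a b \<subseteq> S"
  obtains \<psi> :: "nat \<Rightarrow> 'a \<Rightarrow> real" where "\<And>n. \<psi> n \<in> test_functions S"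
    "\<And>n x. \<bar>\<psi> n x\<bar> \<le> indicator (box a b) x" "\<And>x. (\<lambda>n. \<psi> n x) \<longlonglongrightarrow> indicator (box a b) x"
proof -
  \<comment> \<open>The arguments are multiplied out to the shape \<open>a * x + b\<close> expected
    by \<open>times_differentiable_affine\<close>; \<open>arg\<close> below restores the factored
    form.\<close>
  define p where "p n i t = flat_exp 0 (real (Suc n) * t + - real (Suc n) * (a \<bullet> i)) *
      flat_exp 0 (- real (Suc n) * t + real (Suc n) * (b \<bullet> i))" for n i t
  define \<psi> where "\<psi> n x = (\<Prod>i\<in>Basis. p n i (x \<bullet> i))" for n x
  have f01: "0 \<le> flat_exp 0 t" "flat_exp 0 t \<le> 1" for t by (auto simp: flat_exp_def)
  have fpos: "flat_exp 0 t > 0 \<longleftrightarrow> t > 0" for t by (auto simp: flat_exp_def)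
  have p01: "0 \<le> p n i t" "p n i t \<le> 1" for n i t
    unfolding p_def using f01 by (auto intro!: mult_le_one mult_nonneg_nonneg)
  have arg: "real (Suc n) * t + - real (Suc n) * c = real (Suc n) * (t - c)"
    "- real (Suc n) * t + real (Suc n) * c = real (Suc n) * (c - t)" for n t c
    by (simp_all add: algebra_simps)
  have p0: "p n i t = 0" if "\<not> (a \<bullet> i < t \<and> t < b \<bullet> i)" for n i t
    unfolding p_def arg using that by (auto simp: flat_exp_def zero_less_mult_iff)
  have z: "\<psi> n x = 0" if x: "x \<notin> box a b" for n x
  proof -
    obtain i where "i \<in> Basis" "\<not> (a \<bullet> i < x \<bullet> i \<and> x \<bullet> i < b \<bullet> i)" using x unfolding mem_box by blast
    then show ?thesis unfolding \<psi>_def using p0 by (intro prod_zero) auto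
  qed
  have fl: "(\<lambda>n. flat_exp 0 (real (Suc n) * c)) \<longlonglongrightarrow> 1" if "c > 0" for c
  proof -
    have "(\<lambda>n. exp (- (1 / real (Suc n)) * (1 / c))) \<longlonglongrightarrow> exp (- 0 * (1 / c))"
      by (intro tendsto_intros LIMSEQ_Suc[OF lim_1_over_n])
    moreover have "flat_exp 0 (real (Suc n) * c) = exp (- (1 / real (Suc n)) * (1 / c))" for n
      using that by (simp add: flat_exp_def)
    ultimately show ?thesis by simp
  qed
  show thesis
  proof
    show "\<psi> n \<in> test_functions S" for n
    proof -
      have "smooth (\<psi> n)" unfolding \<psi>_def p_def
        by (intro smooth_tensor times_differentiable_mult times_differentiable_affine times_differentiable_flat_exp)
      moreover have sub: "closure {x. \<psi> n x \<noteq> 0} \<subseteq> cbox a b"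
        by (rule closure_minimal) (use z box_subset_cbox in blast)+
      moreover have "compact (closure {x. \<psi> n x \<noteq> 0})"
        using sub bounded_cbox bounded_subset[of "cbox a b"] by (auto simp: compact_eq_bounded_closed)
      ultimately show ?thesis using assms by (auto simp: test_functions_def)
    qed
    show "\<bar>\<psi> n x\<bar> \<le> indicator (box a b) x" for n x
    proof (cases "x \<in> box a b")
      case True
      then show ?thesis using p01 by (auto simp: \<psi>_def abs_prod intro!: prod_le_1)
    qed (simp add: z)
    show "(\<lambda>n. \<psi> n x) \<longlonglongrightarrow> indicator (box a b) x" for x
    proof (cases "x \<in> box a b")
      case True
      have "(\<lambda>n. p n i (x \<bullet> i)) \<longlonglongrightarrow> 1" if "i \<in> Basis" for i
      proof -
        have "a \<bullet> i < x \<bullet> i" "x \<bullet> i < b \<bullet> i" using True that by (auto simp: mem_box)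
        then have "(\<lambda>n. flat_exp 0 (real (Suc n) * (x \<bullet> i - a \<bullet> i)) * flat_exp 0 (real (Suc n) * (b \<bullet> i - x \<bullet> i))) \<longlonglongrightarrow> 1 * 1"
          by (intro tendsto_mult fl) auto
        then show ?thesis unfolding p_def arg by simp
      qed
      then have "(\<lambda>n. \<psi> n x) \<longlonglongrightarrow> (\<Prod>i\<in>(Basis::'a set). 1)"
        unfolding \<psi>_def by (intro tendsto_prod)
      then show ?thesis using True by simp
    next
      case False
      then show ?thesis using z by simp
    qed
  qed
qed

section \<open>The fundamental lemma of the calculus of variations\<close>

text \<open>Open boxes are an intersection-stable generator of the Borel sets, so Dynkin's argument
  spreads the vanishing to all Borel sets. Lebesgue sets differ from these by null sets, and a
  function whose integral over every measurable set is 0 vanishes almost everywhere.\<close>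

lemma AE_eq_0_if_box_integrals_eq_0:
  fixes f :: "'a::euclidean_space \<Rightarrow> 'b::euclidean_space"
  assumes f: "integrable lebesgue f"
    and box: "\<And>a b. (LINT x:box a b|lebesgue. f x) = 0"
  shows "AE x in lebesgue. f x = 0"
proof -
  interpret L: sigma_finite_measure "lebesgue :: 'a measure"
  proof
    obtain A :: "'a set set" where "countable A" "A \<subseteq> sets lborel" "\<Union>A = space lborel" "\<forall>a\<in>A. emeasure lborel a \<noteq> \<infinity>"
      using sigma_finite_measure.sigma_finite_countable[OF sigma_finite_lborel] by metis
    then show "\<exists>A::'a set set. countable A \<and> A \<subseteq> sets lebesgue \<and> \<Union>A = space lebesgue \<and> (\<forall>a\<in>A. emeasure lebesgue a \<noteq> \<infinity>)"
      by (intro exI[of _ A]) auto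
  qed
  have fs: "set_integrable lebesgue A f" if "A \<in> sets lebesgue" for A
    using f that by (simp add: set_integrable_def integrable_mult_indicator)
  let ?G = "range (\<lambda>(a, b). box a b :: 'a set)"
  have sG: "sigma_sets UNIV ?G = sets borel" by (subst borel_eq_box) auto
  \<comment> \<open>The complement step of the induction compares with the whole space, reached here
    as a limit of growing boxes.\<close>
  have U: "(LINT x:UNIV|lebesgue. f x) = 0"
  proof -
    let ?B = "\<lambda>n::nat. box (- (real n *\<^sub>R One)) (real n *\<^sub>R One) :: 'a set"
    have "?B m \<subseteq> ?B n" if "m \<le> n" for m n
      by (rule subset_box_imp) (use that in simp)
    then have "incseq ?B" by (simp add: incseq_def)
    then have "(\<lambda>n. LINT x:?B n|lebesgue. f x) \<longlonglongrightarrow> (LINT x:(\<Union>n. ?B n)|lebesgue. f x)"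
      by (intro set_integral_cont_up fs) auto
    then show ?thesis unfolding box UN_box_eq_UNIV by (simp add: LIMSEQ_const_iff)
  qed
  have borel: "(LINT x:A|lebesgue. f x) = 0" if "A \<in> sets borel" for A
  proof -
    have "Int_stable ?G" by (auto simp: Int_stable_def box_Int_box)
    moreover have "?G \<subseteq> Pow UNIV" by simp
    moreover have "A \<in> sigma_sets UNIV ?G" using that sG by simp
    ultimately show ?thesis
    proof (induction rule: sigma_sets_induct_disjoint)
      case (basic A)
      then show ?case using box by auto
    next
      case empty
      show ?case by (simp add: set_lebesgue_integral_def)
    next
      case (compl A)
      then have A: "A \<in> sets lebesgue" using sG by auto
      have "(LINT x:A \<union> (UNIV - A)|lebesgue. f x) = (LINT x:A|lebesgue. f x) + (LINT x:(UNIV - A)|lebesgue. f x)"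
        using A by (intro set_integral_Un fs) auto
      then show ?case using compl U by simp
    next
      case (union A)
      then have A: "A i \<in> sets lebesgue" for i using sG by auto
      have "(LINT x:(\<Union>i. A i)|lebesgue. f x) = (\<Sum>i. (LINT x:(A i)|lebesgue. f x))"
        using A union by (intro lebesgue_integral_countable_add fs) (auto simp: disjoint_family_on_def)
      then show ?case using union by simp
    qed
  qed
  show ?thesis
  proof (rule L.density_zero[OF f])
    fix A :: "'a set" assume A: "A \<in> sets lebesgue"
    then obtain B N N' where B: "A = B \<union> N" "N \<subseteq> N'" "N' \<in> null_sets lborel" "B \<in> sets lborel"
      by (rule sets_completionE)
    have "N' \<in> null_sets lebesgue" using B null_sets_completionI by blast
    then have "AE x in lebesgue. x \<notin> N'" by (rule AE_not_in)
    then have "AE x in lebesgue. indicator A x *\<^sub>R f x = indicator B x *\<^sub>R f x"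
      by eventually_elim (use B in \<open>auto simp: indicator_def\<close>)
    moreover have "(\<lambda>x. indicator A x *\<^sub>R f x) \<in> borel_measurable lebesgue" "(\<lambda>x. indicator B x *\<^sub>R f x) \<in> borel_measurable lebesgue"
      using fs[OF A] fs[of B] B by (auto simp: set_integrable_def)
    ultimately have "(LINT x:A|lebesgue. f x) = (LINT x:B|lebesgue. f x)"
      unfolding set_lebesgue_integral_def by (intro integral_cong_AE) auto
    then show "(LINT x:A|lebesgue. f x) = 0" using borel B by simp
  qed
qed

lemma continuous_imp_borel_measurable_lebesgue:
  "continuous_on UNIV f \<Longrightarrow> f \<in> borel_measurable lebesgue"
  by (intro measurable_completion) (simp add: borel_measurable_continuous_onI)

text \<open>Box indicators are bounded pointwise limits of test functions, so \<open>w\<close>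
  integrates to 0 over every box whose closure lies in \<open>S\<close>. A countable cover of
  \<open>S\<close> by closed boxes then reduces the claim to the criterion for box
  integrals.\<close>

lemma AE_eq_0_if_test_integrals_eq_0:
  fixes w :: "'a::euclidean_space \<Rightarrow> 'b::euclidean_space"
  assumes S: "open S" and w: "w locally_integrable_on S"
    and zero: "\<And>\<psi>. \<psi> \<in> test_functions S \<Longrightarrow> (LINT x:S|lebesgue. \<psi> x *\<^sub>R w x) = 0"
  shows "AE x in lebesgue. x \<in> S \<longrightarrow> w x = 0"
proof -
  have box0: "(LINT x:box a b|lebesgue. w x) = 0" if ab: "cbox a b \<subseteq> S" for a b
  proof -
    obtain \<psi> :: "nat \<Rightarrow> 'a \<Rightarrow> real" where \<psi>: "\<And>n. \<psi> n \<in> test_functions S"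
      "\<And>n x. \<bar>\<psi> n x\<bar> \<le> indicator (box a b) x" "\<And>x. (\<lambda>n. \<psi> n x) \<longlonglongrightarrow> indicator (box a b) x"
      using test_functions_approx_box[OF ab] by metis
    have wi: "set_integrable lebesgue (cbox a b) w"
      using w ab by (auto simp: locally_integrable_on_def)
    then have wb: "set_integrable lebesgue (box a b) w"
      by (rule set_integrable_subset) (auto simp: box_subset_cbox)
    have eq: "indicator S x *\<^sub>R \<psi> n x *\<^sub>R w x = \<psi> n x *\<^sub>R (indicator (box a b) x *\<^sub>R w x)" for n x
      using \<psi>(2)[of n x] ab box_subset_cbox[of a b] by (auto simp: indicator_def split: if_splits)
    have c: "\<psi> n \<in> borel_measurable lebesgue" for n
      using smooth_iter_partial_continuous[OF test_functionsD(1)[OF \<psi>(1)], of "[]"]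
      by (intro continuous_imp_borel_measurable_lebesgue) simp
    have "(\<lambda>n. LINT x|lebesgue. \<psi> n x *\<^sub>R (indicator (box a b) x *\<^sub>R w x)) \<longlonglongrightarrow> (LINT x|lebesgue. indicator (box a b) x *\<^sub>R w x)"
    proof (rule integral_dominated_convergence)
      show "integrable lebesgue (\<lambda>x. norm (indicator (box a b) x *\<^sub>R w x))"
        using wb by (simp only: set_integrable_def integrable_norm)
      show "AE x in lebesgue. (\<lambda>n. \<psi> n x *\<^sub>R indicat_real (box a b) x *\<^sub>R w x) \<longlonglongrightarrow> indicat_real (box a b) x *\<^sub>R w x"
      proof (rule AE_I2)
        fix x
        have "(\<lambda>n. \<psi> n x *\<^sub>R indicat_real (box a b) x *\<^sub>R w x) \<longlonglongrightarrow> indicator (box a b) x *\<^sub>R indicat_real (box a b) x *\<^sub>R w x"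
          by (intro tendsto_intros \<psi>)
        then show "(\<lambda>n. \<psi> n x *\<^sub>R indicat_real (box a b) x *\<^sub>R w x) \<longlonglongrightarrow> indicat_real (box a b) x *\<^sub>R w x"
          by (auto simp: indicator_def split: if_splits)
      qed
      show "AE x in lebesgue. norm (\<psi> n x *\<^sub>R indicat_real (box a b) x *\<^sub>R w x) \<le> norm (indicat_real (box a b) x *\<^sub>R w x)" for n
      proof (rule AE_I2)
        fix x
        have "\<bar>\<psi> n x\<bar> \<le> 1" using \<psi>(2)[of n x] by (smt (verit) indicator_le_1)
        then show "norm (\<psi> n x *\<^sub>R indicat_real (box a b) x *\<^sub>R w x) \<le> norm (indicat_real (box a b) x *\<^sub>R w x)"
          by (cases "x \<in> box a b") (auto simp: mult_left_le_one_le)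
      qed
      show "(\<lambda>x. indicat_real (box a b) x *\<^sub>R w x) \<in> borel_measurable lebesgue"
        using wb by (auto simp: set_integrable_def)
      then show "(\<lambda>x. \<psi> n x *\<^sub>R indicat_real (box a b) x *\<^sub>R w x) \<in> borel_measurable lebesgue" for n
        using c by (rule borel_measurable_scaleR[rotated])
    qed
    moreover have "(LINT x|lebesgue. \<psi> n x *\<^sub>R (indicator (box a b) x *\<^sub>R w x)) = 0" for n
      using zero[OF \<psi>(1)] by (simp only: set_lebesgue_integral_def eq)
    ultimately show ?thesis
      unfolding set_lebesgue_integral_def by (simp only: LIMSEQ_const_iff)
  qed
  obtain \<D> where D: "countable \<D>" "\<D> \<subseteq> Pow S" "\<And>X. X \<in> \<D> \<Longrightarrow> \<exists>a b. X = cbox a b" "\<Union>\<D> = S"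
    using open_countable_Union_open_cbox[OF S] by metis
  have "AE x in lebesgue. x \<in> X \<longrightarrow> w x = 0" if X: "X \<in> \<D>" for X
  proof -
    obtain c d where cd: "X = cbox c d" "cbox c d \<subseteq> S" using D X by blast
    have wi: "set_integrable lebesgue (cbox c d) w"
      using w cd by (auto simp: locally_integrable_on_def)
    then have wb: "set_integrable lebesgue (box c d) w"
      by (rule set_integrable_subset) (auto simp: box_subset_cbox)
    \<comment> \<open>The criterion asks about all boxes, also those leaving \<open>S\<close>. After
      cutting \<open>w\<close> down to \<open>box c d\<close> only intersections of boxes matter;
      these are boxes again, with closure inside \<open>cbox c d\<close>.\<close>
    have "AE x in lebesgue. indicator (box c d) x *\<^sub>R w x = 0"
    proof (rule AE_eq_0_if_box_integrals_eq_0)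
      show "integrable lebesgue (\<lambda>x. indicator (box c d) x *\<^sub>R w x)"
        using wb by (simp add: set_integrable_def)
      fix a b
      obtain a' b' where ab': "box a b \<inter> box c d = box a' b'" "cbox a b \<inter> cbox c d = cbox a' b'"
        using box_Int_box[of a b c d] Int_interval[of a b c d] by blast
      then have "cbox a' b' \<subseteq> S" using cd by blast
      from box0[OF this] show "(LINT x:box a b|lebesgue. indicator (box c d) x *\<^sub>R w x) = 0"
        by (simp add: set_lebesgue_integral_def ab'(1)[symmetric] indicator_inter_arith)
    qed
    moreover have "AE x in lebesgue. x \<notin> cbox c d - box c d"
      by (rule AE_not_in, rule null_sets_completionI, rule null_sets_cbox_Diff_box)
    ultimately show ?thesis
      by eventually_elim (auto simp: cd indicator_def)
  qed
  then have "AE x in lebesgue. \<forall>X\<in>\<D>. x \<in> X \<longrightarrow> w x = 0"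
    unfolding AE_ball_countable[OF D(1)] by blast
  then show ?thesis by eventually_elim (use D(4) in blast)
qed

lemma test_functions_integrable:
  assumes w: "w locally_integrable_on S" and S: "S \<in> sets lebesgue" and \<psi>: "\<psi> \<in> test_functions S" and ds: "set ds \<subseteq> Basis"
  shows "set_integrable lebesgue S (\<lambda>x. iter_partial ds \<psi> x *\<^sub>R w x)"
proof -
  define K where "K = closure {x. \<psi> x \<noteq> 0}"
  note t = test_functionsD[OF \<psi>, folded K_def]
  have c: "continuous_on A (iter_partial ds \<psi>)" for A
    by (rule smooth_iter_partial_continuous[OF t(1) ds])
  obtain B where B: "\<And>x. x \<in> K \<Longrightarrow> norm (iter_partial ds \<psi> x) \<le> B"
    using compact_imp_bounded[OF compact_continuous_image[OF c t(2)]] by (auto simp: bounded_iff)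
  have z: "iter_partial ds \<psi> x = 0" if "x \<notin> K" for x
    using iter_partial_eq_0_outside that by (auto simp: K_def)
  have wi: "integrable lebesgue (\<lambda>x. indicator K x *\<^sub>R w x)"
    using w t by (auto simp: locally_integrable_on_def set_integrable_def)
  have m: "iter_partial ds \<psi> \<in> borel_measurable lebesgue"
    using c by (rule continuous_imp_borel_measurable_lebesgue)
  have "integrable lebesgue (\<lambda>x. iter_partial ds \<psi> x *\<^sub>R (indicator K x *\<^sub>R w x))"
  proof (rule Bochner_Integration.integrable_bound)
    show "integrable lebesgue (\<lambda>x. B *\<^sub>R (indicator K x *\<^sub>R w x))" using wi by (rule integrable_scaleR_right)
    show "(\<lambda>x. iter_partial ds \<psi> x *\<^sub>R (indicator K x *\<^sub>R w x)) \<in> borel_measurable lebesgue"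
      by (rule borel_measurable_scaleR[OF m borel_measurable_integrable[OF wi]])
    show "AE x in lebesgue. norm (iter_partial ds \<psi> x *\<^sub>R (indicator K x *\<^sub>R w x)) \<le> norm (B *\<^sub>R (indicator K x *\<^sub>R w x))"
    proof (rule AE_I2)
      fix x
      show "norm (iter_partial ds \<psi> x *\<^sub>R (indicator K x *\<^sub>R w x)) \<le> norm (B *\<^sub>R (indicator K x *\<^sub>R w x))"
        using B[of x] by (cases "x \<in> K") (auto intro!: mult_right_mono)
    qed
  qed
  moreover have "iter_partial ds \<psi> x *\<^sub>R (indicator K x *\<^sub>R w x) = indicator S x *\<^sub>R iter_partial ds \<psi> x *\<^sub>R w x" for x
    using z[of x] t(3) by (auto simp: indicator_def)
  ultimately show ?thesis by (simp only: set_integrable_def)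
qed

lemma has_weak_derivD:
  assumes "has_weak_deriv S ds u v" "\<phi> \<in> test_functions S"
  shows "(LINT x:S|lebesgue. iter_partial ds \<phi> x *\<^sub>R u x) =
    (-1) ^ length ds *\<^sub>R (LINT x:S|lebesgue. \<phi> x *\<^sub>R v x)"
  using assms by (simp add: has_weak_deriv_def)

text \<open>This is what makes the choice in \<open>weak_deriv\<close> usable: the chosen
  representative agrees almost everywhere with any weak derivative that can be written down.\<close>

lemma has_weak_deriv_unique:
  fixes u :: "'a::euclidean_space \<Rightarrow> 'b::euclidean_space"
  assumes "open S" "has_weak_deriv S ds u v" "has_weak_deriv S ds u v'"
  shows "AE x in lebesgue. x \<in> S \<longrightarrow> v x = v' x"
proof -
  have l: "v locally_integrable_on S" "v' locally_integrable_on S"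
    using assms by (auto simp: has_weak_deriv_def)
  have "AE x in lebesgue. x \<in> S \<longrightarrow> v x - v' x = 0"
  proof (rule AE_eq_0_if_test_integrals_eq_0[OF assms(1)])
    show "(\<lambda>x. v x - v' x) locally_integrable_on S"
      using l by (auto simp: locally_integrable_on_def intro!: set_integral_diff(1))
    fix \<psi> assume \<psi>: "\<psi> \<in> test_functions S"
    have S: "S \<in> sets lebesgue" using assms(1) by simp
    have e: "(-1) ^ length ds *\<^sub>R (LINT x:S|lebesgue. \<psi> x *\<^sub>R v x) = (-1) ^ length ds *\<^sub>R (LINT x:S|lebesgue. \<psi> x *\<^sub>R v' x)"
      by (simp only: has_weak_derivD[OF assms(2) \<psi>, symmetric] has_weak_derivD[OF assms(3) \<psi>, symmetric])
    then have "(LINT x:S|lebesgue. \<psi> x *\<^sub>R v x) = (LINT x:S|lebesgue. \<psi> x *\<^sub>R v' x)"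
      by (rule scaleR_left_imp_eq[rotated]) simp
    then show "(LINT x:S|lebesgue. \<psi> x *\<^sub>R (v x - v' x)) = 0"
      using test_functions_integrable[OF l(1) S \<psi>, of "[]"] test_functions_integrable[OF l(2) S \<psi>, of "[]"]
      by (simp add: scaleR_diff_right set_integral_diff)
  qed
  then show ?thesis by simp
qed

section \<open>Square-integrable limits of weak derivatives\<close>

text \<open>The integrability conditions carry content: a Bochner integral of a non-integrable
  function is 0, so the last conjunct alone would not express convergence.\<close>

definition L2_converges :: "'a measure \<Rightarrow> (nat \<Rightarrow> 'a \<Rightarrow> complex) \<Rightarrow> ('a \<Rightarrow> complex) \<Rightarrow> bool" where
  "L2_converges M F f \<longleftrightarrow>
     (\<forall>n. F n \<in> borel_measurable M) \<and> f \<in> borel_measurable M \<and>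
     integrable M (\<lambda>x. (cmod (f x))\<^sup>2) \<and> (\<forall>n. integrable M (\<lambda>x. (cmod (F n x - f x))\<^sup>2)) \<and>
     (\<lambda>n. \<integral>x. (cmod (F n x - f x))\<^sup>2 \<partial>M) \<longlonglongrightarrow> 0"

text \<open>The coefficient \<open>C \<epsilon>\<close> may blow up as \<open>\<epsilon>\<close>
  shrinks, since \<open>E n\<close> tends to 0 for each fixed \<open>\<epsilon>\<close>. Combined
  with Young's inequality this takes the place of Cauchy-Schwarz in the limits of integrals
  below.\<close>

lemma LIMSEQ_if_le_eps:
  fixes l :: "'b::real_normed_vector"
  assumes E: "E \<longlonglongrightarrow> (0::real)"
    and le: "\<And>\<epsilon> n. \<epsilon> > 0 \<Longrightarrow> norm (s n - l) \<le> C \<epsilon> * E n + \<epsilon> * D"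
  shows "s \<longlonglongrightarrow> l"
proof (rule LIMSEQ_I)
  fix r :: real assume r: "r > 0"
  define \<epsilon> where "\<epsilon> = r / (2 * (\<bar>D\<bar> + 1))"
  have \<epsilon>: "\<epsilon> > 0" using r by (simp add: \<epsilon>_def)
  have "(\<lambda>n. C \<epsilon> * E n) \<longlonglongrightarrow> C \<epsilon> * 0" by (intro tendsto_intros E)
  then have "\<forall>\<^sub>F n in sequentially. C \<epsilon> * E n < r / 2" using r by (intro order_tendstoD(2)) auto
  then obtain N where N: "\<And>n. n \<ge> N \<Longrightarrow> C \<epsilon> * E n < r / 2" by (auto simp: eventually_sequentially)
  have "\<epsilon> * D \<le> r / 2"
  proof -
    have "\<epsilon> * D \<le> \<epsilon> * (\<bar>D\<bar> + 1)" using \<epsilon> by (intro mult_left_mono) auto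
    also have "\<dots> = r / 2"
    proof -
      have "\<bar>D\<bar> + 1 \<noteq> 0" by linarith
      then show ?thesis by (simp add: \<epsilon>_def divide_simps)
    qed
    finally show ?thesis .
  qed
  then show "\<exists>N. \<forall>n\<ge>N. norm (s n - l) < r" using N le[OF \<epsilon>]
    by (intro exI[of _ N] allI impI) (smt (verit) field_sum_of_halves)
qed

lemma L2_converges_add:
  assumes "L2_converges M F f" "L2_converges M G g"
  shows "L2_converges M (\<lambda>n x. F n x + G n x) (\<lambda>x. f x + g x)"
proof -
  have [measurable]: "F n \<in> borel_measurable M" "f \<in> borel_measurable M"
    "G n \<in> borel_measurable M" "g \<in> borel_measurable M" for n
    using assms by (auto simp: L2_converges_def)
  have b: "(cmod (a + b))\<^sup>2 \<le> 2 * (cmod a)\<^sup>2 + 2 * (cmod b)\<^sup>2" for a b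
  proof -
    have "(cmod (a + b))\<^sup>2 \<le> (cmod a + cmod b)\<^sup>2" by (intro power_mono norm_triangle_ineq) auto
    also have "\<dots> \<le> 2 * (cmod a)\<^sup>2 + 2 * (cmod b)\<^sup>2"
      using sum_squares_bound[of "cmod a" "cmod b"] by (simp add: power2_sum)
    finally show ?thesis .
  qed
  have 1: "integrable M (\<lambda>x. (cmod (f x + g x))\<^sup>2)"
    by (rule Bochner_Integration.integrable_bound[of _ "\<lambda>x. 2 * (cmod (f x))\<^sup>2 + 2 * (cmod (g x))\<^sup>2"])
      (use assms b in \<open>auto simp: L2_converges_def\<close>)
  have e: "F n x + G n x - (f x + g x) = (F n x - f x) + (G n x - g x)" for n x by simp
  have d: "integrable M (\<lambda>x. 2 * (cmod (F n x - f x))\<^sup>2 + 2 * (cmod (G n x - g x))\<^sup>2)" for n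
    using assms by (auto simp: L2_converges_def)
  have 2: "integrable M (\<lambda>x. (cmod (F n x + G n x - (f x + g x)))\<^sup>2)" for n
    unfolding e by (rule Bochner_Integration.integrable_bound[OF d[of n]]) (use b in auto)
  have 3: "(\<lambda>n. \<integral>x. (cmod (F n x + G n x - (f x + g x)))\<^sup>2 \<partial>M) \<longlonglongrightarrow> 0"
  proof (rule tendsto_sandwich[OF always_eventually always_eventually tendsto_const])
    show "\<forall>n. 0 \<le> (\<integral>x. (cmod (F n x + G n x - (f x + g x)))\<^sup>2 \<partial>M)" by simp
    show "\<forall>n. (\<integral>x. (cmod (F n x + G n x - (f x + g x)))\<^sup>2 \<partial>M) \<le>
        2 * (\<integral>x. (cmod (F n x - f x))\<^sup>2 \<partial>M) + 2 * (\<integral>x. (cmod (G n x - g x))\<^sup>2 \<partial>M)"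
    proof
      fix n
      have "(\<integral>x. (cmod (F n x + G n x - (f x + g x)))\<^sup>2 \<partial>M) \<le>
          (\<integral>x. 2 * (cmod (F n x - f x))\<^sup>2 + 2 * (cmod (G n x - g x))\<^sup>2 \<partial>M)"
        by (rule integral_mono[OF 2 d]) (unfold e, rule b)
      also have "\<dots> = 2 * (\<integral>x. (cmod (F n x - f x))\<^sup>2 \<partial>M) + 2 * (\<integral>x. (cmod (G n x - g x))\<^sup>2 \<partial>M)"
        using assms by (subst Bochner_Integration.integral_add) (auto simp: L2_converges_def)
      finally show "(\<integral>x. (cmod (F n x + G n x - (f x + g x)))\<^sup>2 \<partial>M) \<le>
        2 * (\<integral>x. (cmod (F n x - f x))\<^sup>2 \<partial>M) + 2 * (\<integral>x. (cmod (G n x - g x))\<^sup>2 \<partial>M)" .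
    qed
    have "(\<lambda>n. 2 * (\<integral>x. (cmod (F n x - f x))\<^sup>2 \<partial>M) + 2 * (\<integral>x. (cmod (G n x - g x))\<^sup>2 \<partial>M)) \<longlonglongrightarrow> 2 * 0 + 2 * 0"
      using assms by (intro tendsto_intros) (auto simp: L2_converges_def)
    then show "(\<lambda>n. 2 * (\<integral>x. (cmod (F n x - f x))\<^sup>2 \<partial>M) + 2 * (\<integral>x. (cmod (G n x - g x))\<^sup>2 \<partial>M)) \<longlonglongrightarrow> 0"
      by simp
  qed
  show ?thesis unfolding L2_converges_def using 1 2 3 by simp
qed

lemma L2_converges_mult:
  assumes L: "L2_converges M F f" and h[measurable]: "h \<in> borel_measurable M"
    and B: "\<And>x. x \<in> space M \<Longrightarrow> cmod (h x) \<le> B"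
  shows "L2_converges M (\<lambda>n x. h x * F n x) (\<lambda>x. h x * f x)"
proof -
  have [measurable]: "F n \<in> borel_measurable M" "f \<in> borel_measurable M" for n
    using L by (auto simp: L2_converges_def)
  have b: "(cmod (h x * z))\<^sup>2 \<le> B\<^sup>2 * (cmod z)\<^sup>2" if "x \<in> space M" for x z
    using B[OF that] by (auto simp: norm_mult power_mult_distrib intro!: mult_right_mono power_mono)
  have 1: "integrable M (\<lambda>x. (cmod (h x * f x))\<^sup>2)"
    by (rule Bochner_Integration.integrable_bound[of _ "\<lambda>x. B\<^sup>2 * (cmod (f x))\<^sup>2"])
      (use L b in \<open>auto simp: L2_converges_def\<close>)
  have d: "integrable M (\<lambda>x. B\<^sup>2 * (cmod (F n x - f x))\<^sup>2)" for n
    using L by (auto simp: L2_converges_def)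
  have e: "h x * F n x - h x * f x = h x * (F n x - f x)" for n x by (simp add: algebra_simps)
  have 2: "integrable M (\<lambda>x. (cmod (h x * F n x - h x * f x))\<^sup>2)" for n
    unfolding e by (rule Bochner_Integration.integrable_bound[OF d[of n]]) (use b in auto)
  have 3: "(\<lambda>n. \<integral>x. (cmod (h x * F n x - h x * f x))\<^sup>2 \<partial>M) \<longlonglongrightarrow> 0"
  proof (rule tendsto_sandwich[OF always_eventually always_eventually tendsto_const])
    show "\<forall>n. 0 \<le> (\<integral>x. (cmod (h x * F n x - h x * f x))\<^sup>2 \<partial>M)" by simp
    show "\<forall>n. (\<integral>x. (cmod (h x * F n x - h x * f x))\<^sup>2 \<partial>M) \<le> B\<^sup>2 * (\<integral>x. (cmod (F n x - f x))\<^sup>2 \<partial>M)"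
    proof
      fix n
      have "(\<integral>x. (cmod (h x * F n x - h x * f x))\<^sup>2 \<partial>M) \<le> (\<integral>x. B\<^sup>2 * (cmod (F n x - f x))\<^sup>2 \<partial>M)"
        by (rule integral_mono[OF 2 d]) (unfold e, rule b)
      then show "(\<integral>x. (cmod (h x * F n x - h x * f x))\<^sup>2 \<partial>M) \<le> B\<^sup>2 * (\<integral>x. (cmod (F n x - f x))\<^sup>2 \<partial>M)"
        by simp
    qed
    have "(\<lambda>n. B\<^sup>2 * (\<integral>x. (cmod (F n x - f x))\<^sup>2 \<partial>M)) \<longlonglongrightarrow> B\<^sup>2 * 0"
      using L by (intro tendsto_intros) (auto simp: L2_converges_def)
    then show "(\<lambda>n. B\<^sup>2 * (\<integral>x. (cmod (F n x - f x))\<^sup>2 \<partial>M)) \<longlonglongrightarrow> 0" by simp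
  qed
  show ?thesis unfolding L2_converges_def using 1 2 3 by simp
qed

lemma L2_converges_square_integral:
  assumes L: "L2_converges M F f"
  shows "integrable M (\<lambda>x. (cmod (F n x))\<^sup>2)"
    and "(\<lambda>n. \<integral>x. (cmod (F n x))\<^sup>2 \<partial>M) \<longlonglongrightarrow> (\<integral>x. (cmod (f x))\<^sup>2 \<partial>M)"
proof -
  have [measurable]: "F n \<in> borel_measurable M" "f \<in> borel_measurable M" for n
    using L by (auto simp: L2_converges_def)
  have fi: "integrable M (\<lambda>x. (cmod (f x))\<^sup>2)" and di: "integrable M (\<lambda>x. (cmod (F n x - f x))\<^sup>2)" for n
    using L by (auto simp: L2_converges_def)
  \<comment> \<open>Reverse triangle inequality, then Young's inequality with weight
    \<open>\<epsilon>\<close> for the cross term. The choice \<open>\<epsilon> = 1\<close> also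
    yields the integrability of the approximants.\<close>
  have b: "\<bar>(cmod a)\<^sup>2 - (cmod b)\<^sup>2\<bar> \<le> (1 + 1 / \<epsilon>) * (cmod (a - b))\<^sup>2 + \<epsilon> * (cmod b)\<^sup>2"
    if \<epsilon>: "\<epsilon> > 0" for \<epsilon> and a b :: complex
  proof -
    define d where "d = cmod (a - b)"
    have d: "d \<ge> 0" "\<bar>cmod a - cmod b\<bar> \<le> d" using norm_triangle_ineq3[of a b] by (auto simp: d_def)
    have "\<bar>(cmod a)\<^sup>2 - (cmod b)\<^sup>2\<bar> = \<bar>cmod a - cmod b\<bar> * (cmod a + cmod b)"
      by (simp add: power2_eq_square square_diff_square_factored abs_mult)
    also have "\<dots> \<le> d * (d + 2 * cmod b)" using d by (intro mult_mono) auto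
    also have "\<dots> = d\<^sup>2 + 2 * (d * cmod b)" by (simp add: algebra_simps power2_eq_square)
    also have "2 * (d * cmod b) \<le> d\<^sup>2 / \<epsilon> + \<epsilon> * (cmod b)\<^sup>2"
    proof -
      have "0 \<le> (d - \<epsilon> * cmod b)\<^sup>2 / \<epsilon>" using \<epsilon> by simp
      also have "\<dots> = d\<^sup>2 / \<epsilon> + \<epsilon> * (cmod b)\<^sup>2 - 2 * (d * cmod b)"
        using \<epsilon> by (simp add: power2_eq_square field_simps)
      finally show ?thesis by simp
    qed
    finally show ?thesis by (simp add: d_def algebra_simps)
  qed
  have Fi: "integrable M (\<lambda>x. (cmod (F n x))\<^sup>2)" for n
  proof (rule Bochner_Integration.integrable_bound)
    show "integrable M (\<lambda>x. 2 * (cmod (F n x - f x))\<^sup>2 + 2 * (cmod (f x))\<^sup>2)" using fi di by simp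
    show "AE x in M. norm ((cmod (F n x))\<^sup>2) \<le> norm (2 * (cmod (F n x - f x))\<^sup>2 + 2 * (cmod (f x))\<^sup>2)"
    proof (rule AE_I2)
      fix x
      show "norm ((cmod (F n x))\<^sup>2) \<le> norm (2 * (cmod (F n x - f x))\<^sup>2 + 2 * (cmod (f x))\<^sup>2)"
        using b[of 1 "F n x" "f x"] by simp
    qed
  qed measurable
  show "integrable M (\<lambda>x. (cmod (F n x))\<^sup>2)" by (rule Fi)
  show "(\<lambda>n. \<integral>x. (cmod (F n x))\<^sup>2 \<partial>M) \<longlonglongrightarrow> (\<integral>x. (cmod (f x))\<^sup>2 \<partial>M)"
  proof (rule LIMSEQ_if_le_eps)
    show "(\<lambda>n. \<integral>x. (cmod (F n x - f x))\<^sup>2 \<partial>M) \<longlonglongrightarrow> 0" using L by (auto simp: L2_converges_def)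
    fix \<epsilon> :: real and n assume \<epsilon>: "\<epsilon> > 0"
    have "norm ((\<integral>x. (cmod (F n x))\<^sup>2 \<partial>M) - (\<integral>x. (cmod (f x))\<^sup>2 \<partial>M)) =
        norm (\<integral>x. (cmod (F n x))\<^sup>2 - (cmod (f x))\<^sup>2 \<partial>M)" using Fi fi by simp
    also have "\<dots> \<le> (\<integral>x. norm ((cmod (F n x))\<^sup>2 - (cmod (f x))\<^sup>2) \<partial>M)" by (rule integral_norm_bound)
    also have "\<dots> \<le> (\<integral>x. (1 + 1 / \<epsilon>) * (cmod (F n x - f x))\<^sup>2 + \<epsilon> * (cmod (f x))\<^sup>2 \<partial>M)"
    proof (rule integral_mono)
      show "integrable M (\<lambda>x. norm ((cmod (F n x))\<^sup>2 - (cmod (f x))\<^sup>2))"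
        by (intro integrable_norm Bochner_Integration.integrable_diff Fi fi)
      show "integrable M (\<lambda>x. (1 + 1 / \<epsilon>) * (cmod (F n x - f x))\<^sup>2 + \<epsilon> * (cmod (f x))\<^sup>2)"
        by (intro Bochner_Integration.integrable_add integrable_mult_right di fi)
      show "norm ((cmod (F n x))\<^sup>2 - (cmod (f x))\<^sup>2) \<le> (1 + 1 / \<epsilon>) * (cmod (F n x - f x))\<^sup>2 + \<epsilon> * (cmod (f x))\<^sup>2" for x
        using b[OF \<epsilon>] by simp
    qed
    also have "\<dots> = (1 + 1 / \<epsilon>) * (\<integral>x. (cmod (F n x - f x))\<^sup>2 \<partial>M) + \<epsilon> * (\<integral>x. (cmod (f x))\<^sup>2 \<partial>M)"
      using fi di by (subst Bochner_Integration.integral_add) simp_all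
    finally show "norm ((\<integral>x. (cmod (F n x))\<^sup>2 \<partial>M) - (\<integral>x. (cmod (f x))\<^sup>2 \<partial>M)) \<le>
      (1 + 1 / \<epsilon>) * (\<integral>x. (cmod (F n x - f x))\<^sup>2 \<partial>M) + \<epsilon> * (\<integral>x. (cmod (f x))\<^sup>2 \<partial>M)" .
  qed
qed

text \<open>The elementary bound \<open>t \<le> t\<^sup>2 / \<epsilon> + \<epsilon>\<close> controls
  the first power by the square; finiteness of the measure makes the second term integrate to
  \<open>\<epsilon>\<close> times the total mass.\<close>

lemma (in finite_measure) L2_converges_integral:
  assumes L: "L2_converges M F f"
  shows "integrable M f" "integrable M (F n)" "(\<lambda>n. integral\<^sup>L M (F n)) \<longlonglongrightarrow> integral\<^sup>L M f"
proof -
  have [measurable]: "F n \<in> borel_measurable M" "f \<in> borel_measurable M" for n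
    using L by (auto simp: L2_converges_def)
  have fi: "integrable M (\<lambda>x. (cmod (f x))\<^sup>2)" and di: "integrable M (\<lambda>x. (cmod (F n x - f x))\<^sup>2)" for n
    using L by (auto simp: L2_converges_def)
  have b: "t \<le> (1 / \<epsilon>) * t\<^sup>2 + \<epsilon>" if "t \<ge> 0" "\<epsilon> > 0" for t \<epsilon> :: real
  proof -
    have "0 \<le> (t - \<epsilon>)\<^sup>2 / \<epsilon> + t" using that by simp
    also have "\<dots> = (1 / \<epsilon>) * t\<^sup>2 + \<epsilon> - t" using that by (simp add: power2_eq_square field_simps)
    finally show ?thesis by simp
  qed
  have i: "integrable M g" if [measurable]: "g \<in> borel_measurable M" and g: "integrable M (\<lambda>x. (cmod (g x))\<^sup>2)" for g
  proof (rule Bochner_Integration.integrable_bound)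
    show "integrable M (\<lambda>x. (cmod (g x))\<^sup>2 + 1)" using g by simp
    show "AE x in M. norm (g x) \<le> norm ((cmod (g x))\<^sup>2 + 1)" using b[of _ 1] by (intro AE_I2) simp
  qed fact
  show f: "integrable M f" using fi by (intro i) auto
  have F: "integrable M (F n)" for n using L2_converges_square_integral(1)[OF L] by (intro i) auto
  then show "integrable M (F n)" .
  show "(\<lambda>n. integral\<^sup>L M (F n)) \<longlonglongrightarrow> integral\<^sup>L M f"
  proof (rule LIMSEQ_if_le_eps)
    show "(\<lambda>n. \<integral>x. (cmod (F n x - f x))\<^sup>2 \<partial>M) \<longlonglongrightarrow> 0" using L by (auto simp: L2_converges_def)
    fix \<epsilon> :: real and n assume \<epsilon>: "\<epsilon> > 0"
    have "norm (integral\<^sup>L M (F n) - integral\<^sup>L M f) = norm (\<integral>x. F n x - f x \<partial>M)" using F f by simp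
    also have "\<dots> \<le> (\<integral>x. norm (F n x - f x) \<partial>M)" by (rule integral_norm_bound)
    also have "\<dots> \<le> (\<integral>x. (1 / \<epsilon>) * (cmod (F n x - f x))\<^sup>2 + \<epsilon> \<partial>M)"
    proof (rule integral_mono)
      show "integrable M (\<lambda>x. norm (F n x - f x))"
        by (intro integrable_norm Bochner_Integration.integrable_diff F f)
      show "integrable M (\<lambda>x. (1 / \<epsilon>) * (cmod (F n x - f x))\<^sup>2 + \<epsilon>)"
        by (intro Bochner_Integration.integrable_add integrable_mult_right di) simp
    qed (use b \<epsilon> in auto)
    also have "\<dots> = (1 / \<epsilon>) * (\<integral>x. (cmod (F n x - f x))\<^sup>2 \<partial>M) + \<epsilon> * measure M (space M)"
      using di by (subst Bochner_Integration.integral_add) simp_all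
    finally show "norm (integral\<^sup>L M (F n) - integral\<^sup>L M f) \<le>
      (1 / \<epsilon>) * (\<integral>x. (cmod (F n x - f x))\<^sup>2 \<partial>M) + \<epsilon> * measure M (space M)" .
  qed
qed

lemma set_lebesgue_integral_lebesgue_on:
  fixes f :: "'a::euclidean_space \<Rightarrow> 'b::{banach, second_countable_topology}"
  assumes "S \<in> sets lebesgue"
  shows "(LINT x:S|lebesgue. f x) = integral\<^sup>L (lebesgue_on S) f"
  using assms by (simp add: set_lebesgue_integral_def integral_restrict_space)

text \<open>Weak differentiation is a closed operator. A test function and its derivatives are
  bounded multipliers, and on a set of finite measure L2 convergence gives convergence of integrals,
  so both sides of the defining identity pass to the limit.\<close>

lemma has_weak_deriv_L2_limit:
  fixes f g :: "'a::euclidean_space \<Rightarrow> complex"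
  assumes S: "S \<in> lmeasurable" and e: "e \<in> Basis"
    and f: "L2_converges (lebesgue_on S) F f" and g: "L2_converges (lebesgue_on S) G g"
    and FG: "\<And>n. has_weak_deriv S [e] (F n) (G n)"
  shows "has_weak_deriv S [e] f g"
proof -
  have S': "S \<in> sets lebesgue" using S by (auto simp: fmeasurable_def)
  interpret finite_measure "lebesgue_on S" using S by (rule finite_measure_lebesgue_on)
  have l: "h locally_integrable_on S" if "L2_converges (lebesgue_on S) H h" for h :: "'a \<Rightarrow> complex" and H
  proof -
    have "set_integrable lebesgue S h"
      using L2_converges_integral(1)[OF that] S' by (simp add: set_integrable_def integrable_restrict_space)
    then show ?thesis unfolding locally_integrable_on_def
      by (auto intro: set_integrable_subset simp: borel_compact lmeasurable_compact fmeasurableD)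
  qed
  have lim: "(\<lambda>n. LINT x:S|lebesgue. iter_partial ds \<phi> x *\<^sub>R H n x) \<longlonglongrightarrow> (LINT x:S|lebesgue. iter_partial ds \<phi> x *\<^sub>R h x)"
    if H: "L2_converges (lebesgue_on S) H h" and \<phi>: "\<phi> \<in> test_functions S" and ds: "set ds \<subseteq> Basis" for \<phi> H h ds
  proof -
    define K where "K = closure {x. \<phi> x \<noteq> 0}"
    note t = test_functionsD[OF \<phi>, folded K_def]
    have c: "continuous_on A (iter_partial ds \<phi>)" for A
      by (rule smooth_iter_partial_continuous[OF t(1) ds])
    obtain B where B: "\<And>x. x \<in> K \<Longrightarrow> norm (iter_partial ds \<phi> x) \<le> B"
      using compact_imp_bounded[OF compact_continuous_image[OF c t(2)]] by (auto simp: bounded_iff)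
    have z: "iter_partial ds \<phi> x = 0" if "x \<notin> K" for x
      using iter_partial_eq_0_outside that by (auto simp: K_def)
    have "iter_partial ds \<phi> \<in> borel_measurable lebesgue"
      using c by (rule continuous_imp_borel_measurable_lebesgue)
    then have m: "iter_partial ds \<phi> \<in> borel_measurable (lebesgue_on S)"
      by (rule measurable_restrict_space1)
    have "L2_converges (lebesgue_on S) (\<lambda>n x. of_real (iter_partial ds \<phi> x) * H n x) (\<lambda>x. of_real (iter_partial ds \<phi> x) * h x)"
    proof (rule L2_converges_mult[OF H])
      show "(\<lambda>x. complex_of_real (iter_partial ds \<phi> x)) \<in> borel_measurable (lebesgue_on S)"
        using m by measurable
      show "cmod (complex_of_real (iter_partial ds \<phi> x)) \<le> \<bar>B\<bar>" for x
        using B[of x] z[of x] by (cases "x \<in> K") auto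
    qed
    from L2_converges_integral(3)[OF this]
    show ?thesis by (simp add: set_lebesgue_integral_lebesgue_on[OF S'] scaleR_conv_of_real)
  qed
  have "(LINT x:S|lebesgue. iter_partial [e] \<phi> x *\<^sub>R f x) = (-1) ^ length [e] *\<^sub>R (LINT x:S|lebesgue. \<phi> x *\<^sub>R g x)"
    if \<phi>: "\<phi> \<in> test_functions S" for \<phi>
  proof (rule LIMSEQ_unique)
    show "(\<lambda>n. LINT x:S|lebesgue. iter_partial [e] \<phi> x *\<^sub>R F n x) \<longlonglongrightarrow> (LINT x:S|lebesgue. iter_partial [e] \<phi> x *\<^sub>R f x)"
      by (rule lim[OF f \<phi>]) (use e in simp)
    show "(\<lambda>n. LINT x:S|lebesgue. iter_partial [e] \<phi> x *\<^sub>R F n x) \<longlonglongrightarrow> (-1) ^ length [e] *\<^sub>R (LINT x:S|lebesgue. \<phi> x *\<^sub>R g x)"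
      unfolding has_weak_derivD[OF FG \<phi>]
      by (intro tendsto_intros lim[OF g \<phi>, of "[]", simplified])
  qed
  then show ?thesis unfolding has_weak_deriv_def using l[OF f] l[OF g] by blast
qed

section \<open>Weak derivatives of test functions and approximation in the Sobolev norm\<close>

lemma test_functions_partial_deriv:
  assumes \<phi>: "\<phi> \<in> test_functions S" and e: "e \<in> Basis"
  shows "partial_deriv e \<phi> \<in> test_functions S"
proof -
  let ?K = "closure {x. \<phi> x \<noteq> 0}" and ?L = "closure {x. partial_deriv e \<phi> x \<noteq> 0}"
  note t = test_functionsD[OF \<phi>]
  have "?L \<subseteq> ?K"
    using iter_partial_eq_0_outside[of _ \<phi> "[e]"]
    by (intro closure_minimal) (auto simp: iter_partial_Cons)
  moreover from this have "compact ?L"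
    using compact_Int_closed[OF t(2), of ?L] by (simp add: Int_absorb1)
  ultimately show ?thesis using t smooth_partial_deriv[OF t(1) e] by (auto simp: test_functions_def)
qed

lemma test_functions_iter_partial:
  "\<phi> \<in> test_functions S \<Longrightarrow> set ds \<subseteq> Basis \<Longrightarrow> iter_partial ds \<phi> \<in> test_functions S"
  by (induction ds) (auto simp: iter_partial_Cons intro: test_functions_partial_deriv)

text \<open>Integrating by parts strips the outermost derivative first, whence the reversal.\<close>

lemma has_weak_deriv_test_function:
  assumes S: "open S"
  shows "\<phi> \<in> test_functions S \<Longrightarrow> set ds \<subseteq> Basis \<Longrightarrow> has_weak_deriv S ds \<phi> (iter_partial (rev ds) \<phi>)"
proof (induction ds arbitrary: \<phi>)
  case Nil
  then have "continuous_on S \<phi>" using smooth_iter_partial_continuous[OF test_functionsD(1), of \<phi> S "[]" S] by simp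
  then show ?case by (simp add: has_weak_deriv_def continuous_on_imp_locally_integrable_on)
next
  case (Cons e ds)
  have e: "e \<in> Basis" and ds: "set ds \<subseteq> Basis" using Cons.prems by auto
  note \<phi> = Cons.prems(1)
  note IH = Cons.IH[OF test_functions_partial_deriv[OF \<phi> e] ds]
  have r: "iter_partial (rev ds) (partial_deriv e \<phi>) = iter_partial (rev (e # ds)) \<phi>"
    by (simp add: iter_partial_def)
  have c: "has_weak_deriv S [e] \<phi> (\<lambda>x. frechet_derivative \<phi> (at x) e)"
  proof (rule has_weak_deriv_classical[OF S e])
    show "(\<phi> has_derivative frechet_derivative \<phi> (at x)) (at x)" for x
      using smooth_iter_partial_differentiable[OF test_functionsD(1)[OF \<phi>], of "[]"]
      by (simp add: frechet_derivative_works)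
    show "continuous_on S (\<lambda>x. frechet_derivative \<phi> (at x) e)"
      using smooth_iter_partial_continuous[OF test_functionsD(1)[OF \<phi>], of "[e]" S] e
      by (simp add: iter_partial_Cons partial_deriv_def[abs_def])
  qed
  have "(LINT x:S|lebesgue. iter_partial (e # ds) \<psi> x *\<^sub>R \<phi> x) =
      (-1) ^ length (e # ds) *\<^sub>R (LINT x:S|lebesgue. \<psi> x *\<^sub>R iter_partial (rev (e # ds)) \<phi> x)"
    if \<psi>: "\<psi> \<in> test_functions S" for \<psi>
    using has_weak_derivD[OF c test_functions_iter_partial[OF \<psi> ds]] has_weak_derivD[OF IH \<psi>]
    unfolding r by (simp add: iter_partial_Cons partial_deriv_def[abs_def])
  then show ?case
    using c IH unfolding r has_weak_deriv_def by blast
qed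

lemma has_weak_deriv_diff:
  fixes u u' :: "'a::euclidean_space \<Rightarrow> 'b::euclidean_space"
  assumes S: "S \<in> sets lebesgue" and ds: "set ds \<subseteq> Basis"
    and u: "has_weak_deriv S ds u v" and u': "has_weak_deriv S ds u' v'"
  shows "has_weak_deriv S ds (\<lambda>x. u x - u' x) (\<lambda>x. v x - v' x)"
proof -
  have l: "u locally_integrable_on S" "u' locally_integrable_on S" "v locally_integrable_on S" "v' locally_integrable_on S"
    using u u' by (auto simp: has_weak_deriv_def)
  have d: "(\<lambda>x. f x - g x) locally_integrable_on S" if "f locally_integrable_on S" "g locally_integrable_on S" for f g :: "'a \<Rightarrow> 'b"
    using that by (auto simp: locally_integrable_on_def intro!: set_integral_diff(1))
  have "(LINT x:S|lebesgue. iter_partial ds \<phi> x *\<^sub>R (u x - u' x)) = (-1) ^ length ds *\<^sub>R (LINT x:S|lebesgue. \<phi> x *\<^sub>R (v x - v' x))"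
    if \<phi>: "\<phi> \<in> test_functions S" for \<phi>
  proof -
    note I = test_functions_integrable[OF _ S \<phi>]
    have "(LINT x:S|lebesgue. iter_partial ds \<phi> x *\<^sub>R (u x - u' x)) =
      (LINT x:S|lebesgue. iter_partial ds \<phi> x *\<^sub>R u x) - (LINT x:S|lebesgue. iter_partial ds \<phi> x *\<^sub>R u' x)"
      unfolding scaleR_diff_right by (intro set_integral_diff I l ds)
    moreover have "(LINT x:S|lebesgue. \<phi> x *\<^sub>R (v x - v' x)) =
      (LINT x:S|lebesgue. \<phi> x *\<^sub>R v x) - (LINT x:S|lebesgue. \<phi> x *\<^sub>R v' x)"
      unfolding scaleR_diff_right by (intro set_integral_diff I[of _ "[]", simplified] l)
    ultimately show ?thesis
      using has_weak_derivD[OF u \<phi>] has_weak_derivD[OF u' \<phi>] by (simp add: scaleR_diff_right)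
  qed
  then show ?thesis unfolding has_weak_deriv_def using l d by blast
qed

lemma has_weak_deriv_weak_deriv:
  "has_weak_deriv S ds u v \<Longrightarrow> has_weak_deriv S ds u (weak_deriv S ds u)"
  unfolding weak_deriv_def by (rule someI[where P = "has_weak_deriv S ds u"])

lemma weak_deriv_AE_eq:
  fixes u :: "'a::euclidean_space \<Rightarrow> 'b::euclidean_space"
  assumes "open S" "has_weak_deriv S ds u v"
  shows "AE x in lebesgue. x \<in> S \<longrightarrow> weak_deriv S ds u x = v x"
  using has_weak_deriv_unique[OF assms(1) has_weak_deriv_weak_deriv[OF assms(2)] assms(2)] .

lemma AE_lebesgue_on_iff:
  "S \<in> sets lebesgue \<Longrightarrow> (AE x in lebesgue_on S. P x) \<longleftrightarrow> (AE x in lebesgue. x \<in> S \<longrightarrow> P x)"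
  by (subst AE_restrict_space_iff) auto

lemma finite_multi_indices: "finite (multi_indices k :: 'a::euclidean_space list set)"
  unfolding multi_indices_def by (rule finite_lists_length_le) simp

lemma square_integrable_on_iff_lebesgue_on:
  fixes f :: "'a::euclidean_space \<Rightarrow> real"
  assumes "S \<in> sets lebesgue"
  shows "f square_integrable_on S \<longleftrightarrow>
    f \<in> borel_measurable (lebesgue_on S) \<and> integrable (lebesgue_on S) (\<lambda>x. (f x)\<^sup>2)"
  using assms
  by (simp add: square_integrable_on_def set_borel_measurable_def set_integrable_def
      integrable_restrict_space borel_measurable_restrict_space_iff)

text \<open>The squared Sobolev norm is a finite sum of nonnegative terms, so smallness of the norm
  bounds each derivative of \<open>u - \<phi> n\<close> separately. The lists are reversed on the
  side of \<open>\<phi>\<close> as in \<open>has_weak_deriv_test_function\<close>.\<close>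

lemma sobolev_0_approx:
  fixes u :: "'a::euclidean_space \<Rightarrow> real"
  assumes S: "open S" and u: "u \<in> sobolev_0 k S"
  obtains \<phi> :: "nat \<Rightarrow> 'a \<Rightarrow> real" where "\<And>n. \<phi> n \<in> test_functions S"
    "\<And>ds. ds \<in> multi_indices k \<Longrightarrow>
      L2_converges (lebesgue_on S) (\<lambda>n x. of_real (iter_partial (rev ds) (\<phi> n) x)) (\<lambda>x. of_real (weak_deriv S ds u x))"
    "AE x in lebesgue. x \<in> S \<longrightarrow> weak_deriv S [] u x = u x"
proof -
  let ?M = "lebesgue_on S"
  have S': "S \<in> sets lebesgue" using S by simp
  have su: "u \<in> sobolev k S" using u by (simp add: sobolev_0_def)
  have D: "has_weak_deriv S ds u (weak_deriv S ds u)"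
    and Dm: "weak_deriv S ds u \<in> borel_measurable ?M"
    and Di: "integrable ?M (\<lambda>x. (weak_deriv S ds u x)\<^sup>2)" if ds: "ds \<in> multi_indices k" for ds
  proof -
    obtain v where v: "has_weak_deriv S ds u v" "v square_integrable_on S"
      using su ds by (auto simp: sobolev_def)
    show "has_weak_deriv S ds u (weak_deriv S ds u)" by (rule has_weak_deriv_weak_deriv[OF v(1)])
    have vm: "v \<in> borel_measurable ?M" and vi: "integrable ?M (\<lambda>x. (v x)\<^sup>2)"
      using v(2) square_integrable_on_iff_lebesgue_on[OF S'] by auto
    have ae: "AE x in lebesgue. x \<in> S \<longrightarrow> weak_deriv S ds u x = v x"
      by (rule weak_deriv_AE_eq[OF S v(1)])
    \<comment> \<open>The chosen representative inherits measurability from \<open>v\<close>,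
      because Lebesgue measure is complete.\<close>
    have "(\<lambda>x. indicator S x *\<^sub>R v x) \<in> borel_measurable lebesgue"
      using vm S' by (simp add: borel_measurable_restrict_space_iff)
    moreover have "AE x in lebesgue. indicator S x *\<^sub>R v x = indicator S x *\<^sub>R weak_deriv S ds u x"
      using ae by eventually_elim (auto simp: indicator_def)
    ultimately have "(\<lambda>x. indicator S x *\<^sub>R weak_deriv S ds u x) \<in> borel_measurable lebesgue"
      by (rule borel_measurable_AE)
    then show m: "weak_deriv S ds u \<in> borel_measurable ?M"
      using S' by (simp add: borel_measurable_restrict_space_iff)
    show "integrable ?M (\<lambda>x. (weak_deriv S ds u x)\<^sup>2)"
      by (rule integrable_cong_AE_imp[OF vi])
        (use m ae in \<open>auto simp: AE_lebesgue_on_iff[OF S'] elim: eventually_mono\<close>)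
  qed
  have "\<exists>\<phi>\<in>test_functions S. sobolev_norm k S (\<lambda>x. u x - \<phi> x) < 1 / real (Suc n)" for n
    using u by (auto simp: sobolev_0_def)
  then obtain \<phi> where \<phi>: "\<And>n. \<phi> n \<in> test_functions S"
    "\<And>n. sobolev_norm k S (\<lambda>x. u x - \<phi> n x) < 1 / real (Suc n)" by metis
  have L: "L2_converges ?M (\<lambda>n x. of_real (iter_partial (rev ds) (\<phi> n) x)) (\<lambda>x. of_real (weak_deriv S ds u x))"
    if ds: "ds \<in> multi_indices k" for ds
  proof -
    have dsB: "set ds \<subseteq> Basis" using ds by (simp add: multi_indices_def)
    have pm: "iter_partial (rev ds) (\<phi> n) \<in> borel_measurable ?M" for n
    proof -
      have "continuous_on UNIV (iter_partial (rev ds) (\<phi> n))"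
        using dsB by (intro smooth_iter_partial_continuous test_functionsD(1)[OF \<phi>(1)]) simp
      then show ?thesis
        by (intro measurable_restrict_space1 continuous_imp_borel_measurable_lebesgue)
    qed
    have w: "has_weak_deriv S es (\<lambda>x. u x - \<phi> n x) (\<lambda>x. weak_deriv S es u x - iter_partial (rev es) (\<phi> n) x)"
      if "es \<in> multi_indices k" for es n
      using that by (intro has_weak_deriv_diff S' D has_weak_deriv_test_function S \<phi>) (auto simp: multi_indices_def)
    have pi: "integrable ?M (\<lambda>x. (iter_partial (rev ds) (\<phi> n) x)\<^sup>2)" for n
    proof -
      have t: "iter_partial (rev ds) (\<phi> n) \<in> test_functions S"
        using dsB by (intro test_functions_iter_partial \<phi>) simp
      have c: "continuous_on A (iter_partial (rev ds) (\<phi> n))" for A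
        using dsB by (intro smooth_iter_partial_continuous test_functionsD(1)[OF \<phi>(1)]) simp
      have l: "iter_partial (rev ds) (\<phi> n) locally_integrable_on S"
        by (rule continuous_on_imp_locally_integrable_on[OF c])
      have "set_integrable lebesgue S (\<lambda>x. iter_partial (rev ds) (\<phi> n) x *\<^sub>R iter_partial (rev ds) (\<phi> n) x)"
        using test_functions_integrable[OF l S' t, of "[]"] by simp
      then show ?thesis using S' by (simp add: set_integrable_def integrable_restrict_space power2_eq_square)
    qed
    let ?d = "\<lambda>n x. weak_deriv S ds u x - iter_partial (rev ds) (\<phi> n) x"
    have di: "integrable ?M (\<lambda>x. (?d n x)\<^sup>2)" for n
    proof (rule Bochner_Integration.integrable_bound)
      show "integrable ?M (\<lambda>x. 2 * (weak_deriv S ds u x)\<^sup>2 + 2 * (iter_partial (rev ds) (\<phi> n) x)\<^sup>2)"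
        using Di[OF ds] pi by simp
      show "(\<lambda>x. (?d n x)\<^sup>2) \<in> borel_measurable ?M" using Dm[OF ds] pm by simp
      have "(a - b)\<^sup>2 \<le> 2 * a\<^sup>2 + 2 * b\<^sup>2" for a b :: real
        using zero_le_power2[of "a + b"] by (simp add: power2_sum power2_diff)
      then show "AE x in ?M. norm ((?d n x)\<^sup>2) \<le> norm (2 * (weak_deriv S ds u x)\<^sup>2 + 2 * (iter_partial (rev ds) (\<phi> n) x)\<^sup>2)"
        by (intro AE_I2) auto
    qed
    have le: "(\<integral>x. (?d n x)\<^sup>2 \<partial>?M) \<le> (1 / real (Suc n))\<^sup>2" for n
    proof -
      let ?I = "\<lambda>es. LINT x:S|lebesgue. (weak_deriv S es (\<lambda>x. u x - \<phi> n x) x)\<^sup>2"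
      have I0: "?I es \<ge> 0" for es by (simp add: set_lebesgue_integral_lebesgue_on[OF S'])
      have "(\<integral>x. (?d n x)\<^sup>2 \<partial>?M) = ?I ds"
      proof -
        \<comment> \<open>The weak derivative of the difference is a fresh choice; uniqueness
          identifies it with the difference of the two derivatives.\<close>
        have "AE x in ?M. weak_deriv S ds (\<lambda>x. u x - \<phi> n x) x = ?d n x"
          using weak_deriv_AE_eq[OF S w[OF ds, of n]] by (simp add: AE_lebesgue_on_iff[OF S'])
        then have ae: "AE x in ?M. (weak_deriv S ds (\<lambda>x. u x - \<phi> n x) x)\<^sup>2 = (?d n x)\<^sup>2"
          by eventually_elim simp
        have "(\<lambda>x. indicator S x *\<^sub>R ?d n x) \<in> borel_measurable lebesgue"
          using Dm[OF ds] pm[of n] S' by (subst borel_measurable_restrict_space_iff[symmetric]) auto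
        moreover have "AE x in lebesgue. indicator S x *\<^sub>R ?d n x = indicator S x *\<^sub>R weak_deriv S ds (\<lambda>x. u x - \<phi> n x) x"
          using weak_deriv_AE_eq[OF S w[OF ds, of n]] by eventually_elim (auto simp: indicator_def)
        ultimately have "(\<lambda>x. indicator S x *\<^sub>R weak_deriv S ds (\<lambda>x. u x - \<phi> n x) x) \<in> borel_measurable lebesgue"
          by (rule borel_measurable_AE)
        then have m: "weak_deriv S ds (\<lambda>x. u x - \<phi> n x) \<in> borel_measurable ?M"
          using S' by (simp add: borel_measurable_restrict_space_iff)
        show ?thesis unfolding set_lebesgue_integral_lebesgue_on[OF S']
          by (rule integral_cong_AE[symmetric, OF _ _ ae]) (use m di[of n] in auto)
      qed
      also have "\<dots> \<le> (\<Sum>es\<in>multi_indices k. ?I es)"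
        by (rule member_le_sum) (use ds I0 finite_multi_indices in auto)
      also have "\<dots> = (sobolev_norm k S (\<lambda>x. u x - \<phi> n x))\<^sup>2"
        unfolding sobolev_norm_def by (simp add: sum_nonneg I0)
      also have "\<dots> \<le> (1 / real (Suc n))\<^sup>2"
        using \<phi>(2)[of n] by (intro power_mono) (auto simp: sobolev_norm_def sum_nonneg I0)
      finally show ?thesis .
    qed
    have "(\<lambda>n. \<integral>x. (?d n x)\<^sup>2 \<partial>?M) \<longlonglongrightarrow> 0"
    proof (rule tendsto_sandwich[OF always_eventually always_eventually tendsto_const])
      show "(\<lambda>n. (1 / real (Suc n))\<^sup>2) \<longlonglongrightarrow> 0"
        using tendsto_power[OF LIMSEQ_Suc[OF lim_1_over_n[where 'a = real]], of 2] by (simp only: power_zero_numeral)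
    qed (use le in auto)
    moreover have "(cmod (of_real a - of_real b))\<^sup>2 = (b - a)\<^sup>2" for a b :: real
      by (metis norm_of_real of_real_diff power2_abs power2_commute)
    ultimately show ?thesis
      unfolding L2_converges_def using Dm[OF ds] pm Di[OF ds] di by simp
  qed
  \<comment> \<open>Even for the empty list \<open>weak_deriv\<close> returns a chosen function,
    which is \<open>u\<close> only up to a null set.\<close>
  have "AE x in lebesgue. x \<in> S \<longrightarrow> weak_deriv S [] u x = u x"
  proof (rule weak_deriv_AE_eq[OF S])
    have "has_weak_deriv S [] u (weak_deriv S [] u)" by (rule D) (simp add: multi_indices_def)
    then show "has_weak_deriv S [] u u" by (simp add: has_weak_deriv_def)
  qed
  then show thesis using that \<phi>(1) L by blast
qed

section \<open>Logarithmic polar derivatives\<close>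

lemma smooth_has_derivative:
  "smooth f \<Longrightarrow> (f has_derivative frechet_derivative f (at x)) (at x)"
  using smooth_iter_partial_differentiable[of f "[]"] by (simp add: frechet_derivative_works)

section \<open>Symmetry of mixed partial derivatives\<close>

lemma smooth_DERIV_line:
  fixes f :: "'a::euclidean_space \<Rightarrow> real"
  assumes "smooth f"
  shows "((\<lambda>t. f (x + t *\<^sub>R e)) has_real_derivative partial_deriv e f (x + t *\<^sub>R e)) (at t)"
proof -
  let ?D = "frechet_derivative f (at (x + t *\<^sub>R e))"
  have "((\<lambda>t. x + t *\<^sub>R e) has_derivative (\<lambda>h. h *\<^sub>R e)) (at t)"
    by (auto intro!: derivative_eq_intros)
  from diff_chain_at[OF this smooth_has_derivative[OF assms]]
  have "((\<lambda>t. f (x + t *\<^sub>R e)) has_derivative (\<lambda>h. ?D (h *\<^sub>R e))) (at t)"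
    by (simp add: o_def)
  moreover have "?D (h *\<^sub>R e) = partial_deriv e f (x + t *\<^sub>R e) * h" for h
    using smooth_has_derivative[OF assms]
    by (simp add: partial_deriv_def has_derivative_def bounded_linear.linear linear_scale)
  ultimately show ?thesis by (simp add: has_field_derivative_def)
qed

text \<open>The mean value theorem is applied first along \<open>e\<close>, then along
  \<open>e'\<close>. The left-hand side is symmetric in the two directions, so exchanging them
  expresses the same number by the other mixed derivative.\<close>

lemma second_difference_mvt:
  fixes f :: "'a::euclidean_space \<Rightarrow> real"
  assumes f: "smooth f" and e: "e \<in> Basis" and h: "h > 0"
  obtains s t where "0 < s" "s < h" "0 < t" "t < h"
    "f (x + h *\<^sub>R e + h *\<^sub>R e') - f (x + h *\<^sub>R e) - f (x + h *\<^sub>R e') + f x =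
      h * h * partial_deriv e' (partial_deriv e f) (x + s *\<^sub>R e + t *\<^sub>R e')"
proof -
  define g where "g s = f ((x + h *\<^sub>R e') + s *\<^sub>R e) - f (x + s *\<^sub>R e)" for s
  have "(g has_real_derivative partial_deriv e f ((x + h *\<^sub>R e') + s *\<^sub>R e) - partial_deriv e f (x + s *\<^sub>R e)) (at s)" for s
    unfolding g_def by (intro DERIV_diff smooth_DERIV_line f)
  from MVT2[OF h this] obtain s where s: "0 < s" "s < h"
    "g h - g 0 = h * (partial_deriv e f ((x + h *\<^sub>R e') + s *\<^sub>R e) - partial_deriv e f (x + s *\<^sub>R e))"
    by auto
  have "((\<lambda>t. partial_deriv e f ((x + s *\<^sub>R e) + t *\<^sub>R e')) has_real_derivative
      partial_deriv e' (partial_deriv e f) ((x + s *\<^sub>R e) + t *\<^sub>R e')) (at t)" for t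
    by (intro smooth_DERIV_line smooth_partial_deriv f e)
  from MVT2[OF h this] obtain t where t: "0 < t" "t < h"
    "partial_deriv e f ((x + s *\<^sub>R e) + h *\<^sub>R e') - partial_deriv e f ((x + s *\<^sub>R e) + 0 *\<^sub>R e') =
      h * partial_deriv e' (partial_deriv e f) ((x + s *\<^sub>R e) + t *\<^sub>R e')"
    by auto
  have "f (x + h *\<^sub>R e + h *\<^sub>R e') - f (x + h *\<^sub>R e) - f (x + h *\<^sub>R e') + f x = g h - g 0"
    by (simp add: g_def algebra_simps)
  also have "\<dots> = h * h * partial_deriv e' (partial_deriv e f) (x + s *\<^sub>R e + t *\<^sub>R e')"
    using s(3) t(3) by (simp add: algebra_simps)
  finally show thesis using that s t by blast
qed

text \<open>At every scale \<open>h n\<close> the two mixed derivatives take a common value at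
  points within order \<open>h n\<close> of \<open>x\<close>; continuity at \<open>x\<close>
  finishes the argument.\<close>

lemma partial_deriv_commute:
  fixes f :: "'a::euclidean_space \<Rightarrow> real"
  assumes f: "smooth f" and e: "e \<in> Basis" and e': "e' \<in> Basis"
  shows "partial_deriv e (partial_deriv e' f) x = partial_deriv e' (partial_deriv e f) x"
proof -
  define h where "h n = 1 / real (Suc n)" for n
  have h: "h n > 0" for n by (simp add: h_def)
  have h0: "h \<longlonglongrightarrow> 0" unfolding h_def by (rule LIMSEQ_Suc[OF lim_1_over_n])
  have c: "isCont (partial_deriv a (partial_deriv b f)) x" if "a \<in> Basis" "b \<in> Basis" for a b
    using smooth_iter_partial_continuous[OF f, of "[a, b]" UNIV] that
    by (simp add: iter_partial_Cons continuous_on_eq_continuous_at)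
  have "\<exists>s t s' t'. 0 < s \<and> s < h n \<and> 0 < t \<and> t < h n \<and> 0 < s' \<and> s' < h n \<and> 0 < t' \<and> t' < h n \<and>
     partial_deriv e' (partial_deriv e f) (x + s *\<^sub>R e + t *\<^sub>R e') =
     partial_deriv e (partial_deriv e' f) (x + s' *\<^sub>R e' + t' *\<^sub>R e)" for n
  proof -
    obtain s t where 1: "0 < s" "s < h n" "0 < t" "t < h n"
      "f (x + h n *\<^sub>R e + h n *\<^sub>R e') - f (x + h n *\<^sub>R e) - f (x + h n *\<^sub>R e') + f x =
      h n * h n * partial_deriv e' (partial_deriv e f) (x + s *\<^sub>R e + t *\<^sub>R e')"
      using second_difference_mvt[OF f e h] by metis
    obtain s' t' where 2: "0 < s'" "s' < h n" "0 < t'" "t' < h n"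
      "f (x + h n *\<^sub>R e' + h n *\<^sub>R e) - f (x + h n *\<^sub>R e') - f (x + h n *\<^sub>R e) + f x =
      h n * h n * partial_deriv e (partial_deriv e' f) (x + s' *\<^sub>R e' + t' *\<^sub>R e)"
      using second_difference_mvt[OF f e' h] by metis
    have x: "x + h n *\<^sub>R e' + h n *\<^sub>R e = x + h n *\<^sub>R e + h n *\<^sub>R e'" by simp
    from 1(5) 2(5)[unfolded x] have "h n * h n * partial_deriv e' (partial_deriv e f) (x + s *\<^sub>R e + t *\<^sub>R e') =
        h n * h n * partial_deriv e (partial_deriv e' f) (x + s' *\<^sub>R e' + t' *\<^sub>R e)" by linarith
    then have "partial_deriv e' (partial_deriv e f) (x + s *\<^sub>R e + t *\<^sub>R e') =
        partial_deriv e (partial_deriv e' f) (x + s' *\<^sub>R e' + t' *\<^sub>R e)" using h[of n] by simp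
    with 1 2 show ?thesis by blast
  qed
  then obtain s t s' t' where st: "\<And>n. 0 < s n" "\<And>n. s n < h n" "\<And>n. 0 < t n" "\<And>n. t n < h n"
    "\<And>n. 0 < s' n" "\<And>n. s' n < h n" "\<And>n. 0 < t' n" "\<And>n. t' n < h n"
    and eq: "\<And>n. partial_deriv e' (partial_deriv e f) (x + s n *\<^sub>R e + t n *\<^sub>R e') =
     partial_deriv e (partial_deriv e' f) (x + s' n *\<^sub>R e' + t' n *\<^sub>R e)"
    by metis
  have lim: "r \<longlonglongrightarrow> 0" if "\<And>n. 0 < r n" "\<And>n. r n < h n" for r
    by (rule tendsto_sandwich[OF always_eventually always_eventually tendsto_const h0])
      (use that in \<open>auto intro: less_imp_le\<close>)
  have p: "(\<lambda>n. x + r n *\<^sub>R a + q n *\<^sub>R b) \<longlonglongrightarrow> x" if "r \<longlonglongrightarrow> 0" "q \<longlonglongrightarrow> 0" for r q a b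
  proof -
    have "(\<lambda>n. x + r n *\<^sub>R a + q n *\<^sub>R b) \<longlonglongrightarrow> x + 0 *\<^sub>R a + 0 *\<^sub>R b" by (intro tendsto_intros that)
    then show ?thesis by simp
  qed
  have "(\<lambda>n. partial_deriv e' (partial_deriv e f) (x + s n *\<^sub>R e + t n *\<^sub>R e')) \<longlonglongrightarrow> partial_deriv e' (partial_deriv e f) x"
    by (rule isCont_tendsto_compose[OF c[OF e' e] p]) (rule lim; rule st)+
  moreover have "(\<lambda>n. partial_deriv e' (partial_deriv e f) (x + s n *\<^sub>R e + t n *\<^sub>R e')) \<longlonglongrightarrow> partial_deriv e (partial_deriv e' f) x"
    unfolding eq by (rule isCont_tendsto_compose[OF c[OF e e'] p]) (rule lim; rule st)+
  ultimately show ?thesis using LIMSEQ_unique by blast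
qed

section \<open>Closure of smoothness under sums and products\<close>

text \<open>In \<open>iter_partial\<close> a new derivative is added on the outside; here the
  innermost one is taken off first. The product rule can then be applied once and followed by
  induction on the order.\<close>

primrec partials_exist :: "nat \<Rightarrow> ('a::euclidean_space \<Rightarrow> real) \<Rightarrow> bool" where
  "partials_exist 0 f \<longleftrightarrow> True"
| "partials_exist (Suc n) f \<longleftrightarrow>
     (\<forall>x. f differentiable (at x)) \<and> (\<forall>e\<in>Basis. partials_exist n (partial_deriv e f))"

lemma smooth_iff_partials_exist: "smooth f \<longleftrightarrow> (\<forall>n. partials_exist n f)"
proof
  show "\<forall>n. partials_exist n f" if "smooth f"
  proof
    show "partials_exist n f" for n using that
    proof (induction n arbitrary: f)
      case (Suc n)
      then show ?case using smooth_iter_partial_differentiable[of f "[]"] smooth_partial_deriv by auto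
    qed simp
  qed
  show "smooth f" if f: "\<forall>n. partials_exist n f"
  proof -
    have "set ds \<subseteq> Basis \<Longrightarrow> partials_exist n (iter_partial ds f)" for n ds
    proof (induction ds arbitrary: n)
      case (Cons e ds)
      then have "partials_exist (Suc n) (iter_partial ds f)" by simp
      then show ?case using Cons.prems by (simp add: iter_partial_Cons)
    qed (use f in simp)
    from this[of _ "Suc 0"] show ?thesis by (auto simp: smooth_def differentiable_on_def)
  qed
qed

lemma partials_exist_SucD: "partials_exist (Suc n) f \<Longrightarrow> partials_exist n f"
  by (induction n arbitrary: f) auto

lemma partial_deriv_add:
  assumes "f differentiable (at x)" "g differentiable (at x)"
  shows "partial_deriv e (\<lambda>x. f x + g x) x = partial_deriv e f x + partial_deriv e g x"
  using assms unfolding partial_deriv_def frechet_derivative_works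
  by (subst frechet_derivative_at[symmetric, OF has_derivative_add]) auto

lemma partial_deriv_diff:
  assumes "f differentiable (at x)" "g differentiable (at x)"
  shows "partial_deriv e (\<lambda>x. f x - g x) x = partial_deriv e f x - partial_deriv e g x"
  using assms unfolding partial_deriv_def frechet_derivative_works
  by (subst frechet_derivative_at[symmetric, OF has_derivative_diff]) auto

lemma partial_deriv_mult:
  fixes f g :: "'a::euclidean_space \<Rightarrow> real"
  assumes "f differentiable (at x)" "g differentiable (at x)"
  shows "partial_deriv e (\<lambda>x. f x * g x) x = f x * partial_deriv e g x + partial_deriv e f x * g x"
  using assms unfolding partial_deriv_def frechet_derivative_works
  by (subst frechet_derivative_at[symmetric, OF has_derivative_mult]) auto

lemma partials_exist_add:
  "partials_exist n f \<Longrightarrow> partials_exist n g \<Longrightarrow> partials_exist n (\<lambda>x. f x + g x)"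
proof (induction n arbitrary: f g)
  case (Suc n)
  then have "partial_deriv e (\<lambda>x. f x + g x) = (\<lambda>x. partial_deriv e f x + partial_deriv e g x)" for e
    by (auto intro!: ext partial_deriv_add)
  then show ?case using Suc by auto
qed simp

lemma partials_exist_mult:
  "partials_exist n f \<Longrightarrow> partials_exist n g \<Longrightarrow> partials_exist n (\<lambda>x. f x * g x)"
proof (induction n arbitrary: f g)
  case (Suc n)
  note fg = partials_exist_SucD[OF Suc.prems(1)] partials_exist_SucD[OF Suc.prems(2)]
  have "partial_deriv e (\<lambda>x. f x * g x) = (\<lambda>x. f x * partial_deriv e g x + partial_deriv e f x * g x)" for e
    using Suc.prems by (auto intro!: ext partial_deriv_mult)
  then show ?case using Suc fg by (auto intro!: partials_exist_add)
qed simp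

lemma smooth_add: "smooth f \<Longrightarrow> smooth g \<Longrightarrow> smooth (\<lambda>x. f x + g x :: real)"
  by (simp add: smooth_iff_partials_exist partials_exist_add)

lemma smooth_mult: "smooth f \<Longrightarrow> smooth g \<Longrightarrow> smooth (\<lambda>x. f x * g x :: real)"
  by (simp add: smooth_iff_partials_exist partials_exist_mult)

lemma partial_deriv_const: "partial_deriv e (\<lambda>x. c) = (\<lambda>x. 0)"
  by (rule ext) (simp add: partial_deriv_eqI[OF has_derivative_const])

lemma smooth_const: "smooth (\<lambda>x::'a::euclidean_space. c :: real)"
proof -
  have "partials_exist n (\<lambda>x::'a. c :: real)" for n and c :: real
    by (induction n arbitrary: c) (auto simp: partial_deriv_const)
  then show ?thesis by (simp add: smooth_iff_partials_exist)
qed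

lemma smooth_diff: "smooth f \<Longrightarrow> smooth g \<Longrightarrow> smooth (\<lambda>x. f x - g x :: real)"
  using smooth_add[OF _ smooth_mult[OF smooth_const[of "-1"]]] by simp

lemma smooth_bounded_linear:
  assumes "bounded_linear (f :: 'a::euclidean_space \<Rightarrow> real)"
  shows "smooth f"
proof -
  have d: "(f has_derivative f) (at x)" for x using assms by (rule bounded_linear_imp_has_derivative)
  then have p: "partial_deriv e f = (\<lambda>x. f e)" for e by (auto intro!: ext partial_deriv_eqI)
  have "partials_exist n f" for n
    using d smooth_const[unfolded smooth_iff_partials_exist] by (cases n) (auto simp: p differentiable_def)
  then show ?thesis by (simp add: smooth_iff_partials_exist)
qed

text \<open>In logarithmic polar coordinates \<open>z = exp (t + \<i> \<theta>)\<close> the following are the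
  derivatives with respect to \<open>t\<close> and \<open>\<theta>\<close>.\<close>

definition radial_deriv :: "(complex \<Rightarrow> real) \<Rightarrow> complex \<Rightarrow> real" where
  "radial_deriv f z = Re z * partial_deriv 1 f z + Im z * partial_deriv \<i> f z"

definition angular_deriv :: "(complex \<Rightarrow> real) \<Rightarrow> complex \<Rightarrow> real" where
  "angular_deriv f z = Re z * partial_deriv \<i> f z - Im z * partial_deriv 1 f z"

lemmas smooth_intros = smooth_add smooth_diff smooth_mult smooth_const
  smooth_bounded_linear[OF bounded_linear_Re] smooth_bounded_linear[OF bounded_linear_Im]

lemma complex_Basis [simp]: "1 \<in> (Basis :: complex set)" "\<i> \<in> (Basis :: complex set)"
  by (simp_all add: Basis_complex_def)

lemma smooth_radial_deriv: "smooth f \<Longrightarrow> smooth (radial_deriv f)"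
  unfolding radial_deriv_def[abs_def] by (intro smooth_intros smooth_partial_deriv) auto

lemma smooth_angular_deriv: "smooth f \<Longrightarrow> smooth (angular_deriv f)"
  unfolding angular_deriv_def[abs_def] by (intro smooth_intros smooth_partial_deriv) auto

lemma smooth_differentiable: "smooth f \<Longrightarrow> f differentiable (at x)"
  using smooth_iter_partial_differentiable[of f "[]"] by simp

lemma polar_deriv_add:
  assumes "smooth f" "smooth g"
  shows "radial_deriv (\<lambda>z. f z + g z) z = radial_deriv f z + radial_deriv g z"
    "angular_deriv (\<lambda>z. f z + g z) z = angular_deriv f z + angular_deriv g z"
  using assms
  by (simp_all add: radial_deriv_def angular_deriv_def partial_deriv_add smooth_differentiable algebra_simps)

lemma polar_deriv_diff:
  assumes "smooth f" "smooth g"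
  shows "radial_deriv (\<lambda>z. f z - g z) z = radial_deriv f z - radial_deriv g z"
    "angular_deriv (\<lambda>z. f z - g z) z = angular_deriv f z - angular_deriv g z"
  using assms
  by (simp_all add: radial_deriv_def angular_deriv_def partial_deriv_diff smooth_differentiable algebra_simps)

lemma polar_deriv_mult:
  assumes "smooth f" "smooth g"
  shows "radial_deriv (\<lambda>z. f z * g z) z = f z * radial_deriv g z + radial_deriv f z * g z"
    "angular_deriv (\<lambda>z. f z * g z) z = f z * angular_deriv g z + angular_deriv f z * g z"
  using assms
  by (simp_all add: radial_deriv_def angular_deriv_def partial_deriv_mult smooth_differentiable algebra_simps)

lemma polar_deriv_const:
  "radial_deriv (\<lambda>z. c) z = 0" "angular_deriv (\<lambda>z. c) z = 0"
  by (simp_all add: radial_deriv_def angular_deriv_def partial_deriv_const)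

lemma partial_deriv_Re_Im:
  "partial_deriv 1 Re z = 1" "partial_deriv \<i> Re z = 0" "partial_deriv 1 Im z = 0" "partial_deriv \<i> Im z = 1"
  using partial_deriv_eqI[OF bounded_linear_imp_has_derivative[OF bounded_linear_Re]]
    partial_deriv_eqI[OF bounded_linear_imp_has_derivative[OF bounded_linear_Im]] by simp_all

lemma polar_deriv_Re_Im:
  "radial_deriv Re z = Re z" "radial_deriv Im z = Im z" "angular_deriv Re z = - Im z" "angular_deriv Im z = Re z"
  by (simp_all add: radial_deriv_def angular_deriv_def partial_deriv_Re_Im)

text \<open>The first-order terms arise when the fields differentiate their own coefficients
  \<open>Re\<close> and \<open>Im\<close>. The last identity says that dilations and rotations
  commute, and like the others it rests on the symmetry of mixed partials.\<close>

lemma angular_radial_deriv_expand: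
  assumes "smooth f"
  shows "radial_deriv (radial_deriv f) z =
      Re z * partial_deriv 1 f z + Im z * partial_deriv \<i> f z +
      (Re z)\<^sup>2 * partial_deriv 1 (partial_deriv 1 f) z + 2 * Re z * Im z * partial_deriv 1 (partial_deriv \<i> f) z +
      (Im z)\<^sup>2 * partial_deriv \<i> (partial_deriv \<i> f) z"
    "angular_deriv (angular_deriv f) z =
      - (Re z * partial_deriv 1 f z + Im z * partial_deriv \<i> f z) +
      (Im z)\<^sup>2 * partial_deriv 1 (partial_deriv 1 f) z - 2 * Re z * Im z * partial_deriv 1 (partial_deriv \<i> f) z +
      (Re z)\<^sup>2 * partial_deriv \<i> (partial_deriv \<i> f) z"
    "angular_deriv (radial_deriv f) z =
      Re z * partial_deriv \<i> f z - Im z * partial_deriv 1 f z +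
      Re z * Im z * (partial_deriv \<i> (partial_deriv \<i> f) z - partial_deriv 1 (partial_deriv 1 f) z) +
      ((Re z)\<^sup>2 - (Im z)\<^sup>2) * partial_deriv 1 (partial_deriv \<i> f) z"
    "radial_deriv (angular_deriv f) z = angular_deriv (radial_deriv f) z"
proof -
  note s = smooth_bounded_linear[OF bounded_linear_Re] smooth_bounded_linear[OF bounded_linear_Im]
    smooth_partial_deriv[OF assms, of 1, simplified] smooth_partial_deriv[OF assms, of \<i>, simplified]
  note c = partial_deriv_commute[OF assms, of \<i> 1, simplified]
  note e = polar_deriv_add polar_deriv_diff polar_deriv_mult polar_deriv_const polar_deriv_Re_Im smooth_intros s
  have r: "radial_deriv (radial_deriv f) z = Re z * partial_deriv 1 f z + Im z * partial_deriv \<i> f z +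
      Re z * radial_deriv (partial_deriv 1 f) z + Im z * radial_deriv (partial_deriv \<i> f) z"
    unfolding radial_deriv_def[of f, abs_def] by (simp add: e algebra_simps)
  have a: "angular_deriv (radial_deriv f) z = Re z * partial_deriv \<i> f z - Im z * partial_deriv 1 f z +
      Re z * angular_deriv (partial_deriv 1 f) z + Im z * angular_deriv (partial_deriv \<i> f) z"
    unfolding radial_deriv_def[of f, abs_def] by (simp add: e algebra_simps)
  have r': "radial_deriv (angular_deriv f) z = Re z * partial_deriv \<i> f z - Im z * partial_deriv 1 f z +
      Re z * radial_deriv (partial_deriv \<i> f) z - Im z * radial_deriv (partial_deriv 1 f) z"
    unfolding angular_deriv_def[of f, abs_def] by (simp add: e algebra_simps)
  have a': "angular_deriv (angular_deriv f) z = - (Re z * partial_deriv 1 f z + Im z * partial_deriv \<i> f z) +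
      Re z * angular_deriv (partial_deriv \<i> f) z - Im z * angular_deriv (partial_deriv 1 f) z"
    unfolding angular_deriv_def[of f, abs_def] by (simp add: e algebra_simps)
  show "radial_deriv (radial_deriv f) z =
      Re z * partial_deriv 1 f z + Im z * partial_deriv \<i> f z +
      (Re z)\<^sup>2 * partial_deriv 1 (partial_deriv 1 f) z + 2 * Re z * Im z * partial_deriv 1 (partial_deriv \<i> f) z +
      (Im z)\<^sup>2 * partial_deriv \<i> (partial_deriv \<i> f) z"
    unfolding r by (simp add: radial_deriv_def c algebra_simps power2_eq_square)
  show "angular_deriv (angular_deriv f) z =
      - (Re z * partial_deriv 1 f z + Im z * partial_deriv \<i> f z) +
      (Im z)\<^sup>2 * partial_deriv 1 (partial_deriv 1 f) z - 2 * Re z * Im z * partial_deriv 1 (partial_deriv \<i> f) z +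
      (Re z)\<^sup>2 * partial_deriv \<i> (partial_deriv \<i> f) z"
    unfolding a' by (simp add: angular_deriv_def c algebra_simps power2_eq_square)
  show "angular_deriv (radial_deriv f) z =
      Re z * partial_deriv \<i> f z - Im z * partial_deriv 1 f z +
      Re z * Im z * (partial_deriv \<i> (partial_deriv \<i> f) z - partial_deriv 1 (partial_deriv 1 f) z) +
      ((Re z)\<^sup>2 - (Im z)\<^sup>2) * partial_deriv 1 (partial_deriv \<i> f) z"
    unfolding a by (simp add: angular_deriv_def c algebra_simps power2_eq_square)
  show "radial_deriv (angular_deriv f) z = angular_deriv (radial_deriv f) z"
    unfolding r' a by (simp add: angular_deriv_def radial_deriv_def c algebra_simps power2_eq_square)
qed

lemma test_functions_smooth_support:
  assumes \<phi>: "\<phi> \<in> test_functions S" and f: "smooth f" and supp: "\<And>x. x \<notin> closure {x. \<phi> x \<noteq> 0} \<Longrightarrow> f x = 0"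
  shows "f \<in> test_functions S"
proof -
  let ?K = "closure {x. \<phi> x \<noteq> 0}" and ?L = "closure {x. f x \<noteq> 0}"
  note t = test_functionsD[OF \<phi>]
  have "?L \<subseteq> ?K" using supp by (intro closure_minimal) auto
  moreover from this have "compact ?L"
    using compact_Int_closed[OF t(2), of ?L] by (simp add: Int_absorb1)
  ultimately show ?thesis using t f by (auto simp: test_functions_def)
qed

section \<open>Weighted integration by parts away from the origin\<close>

lemma has_derivative_norm_powr:
  fixes z :: complex
  assumes "z \<noteq> 0"
  shows "((\<lambda>z. cmod z powr q) has_derivative (\<lambda>h. q * cmod z powr (q - 2) * (Re z * Re h + Im z * Im h))) (at z)"
proof -
  have n: "(cmod has_derivative (\<lambda>h. (Re z * Re h + Im z * Im h) / cmod z)) (at z)"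
    using has_derivative_norm[OF assms] by (simp add: inner_complex_def sgn_div_norm field_simps add_divide_distrib)
  have "((\<lambda>r. r powr q) has_real_derivative q * cmod z powr (q - 1)) (at (cmod z))"
    using assms by (intro has_real_derivative_powr) auto
  then have "((\<lambda>r. r powr q) has_derivative (\<lambda>h. q * cmod z powr (q - 1) * h)) (at (cmod z))"
    by (simp add: has_field_derivative_def)
  from diff_chain_at[OF n this]
  have "((\<lambda>z. cmod z powr q) has_derivative (\<lambda>h. q * cmod z powr (q - 1) * ((Re z * Re h + Im z * Im h) / cmod z))) (at z)"
    by (simp add: o_def)
  moreover have "cmod z powr (q - 1) = cmod z powr (q - 2) * cmod z"
    using assms powr_add[of "cmod z" "q - 2" 1] by simp
  ultimately show ?thesis using assms by (simp add: mult.assoc)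
qed

lemma norm_powr_eq_sq:
  fixes z :: complex
  assumes "z \<noteq> 0"
  shows "cmod z powr q = cmod z powr (q - 2) * ((Re z)\<^sup>2 + (Im z)\<^sup>2)"
proof -
  have "cmod z powr q = cmod z powr (q - 2) * cmod z powr 2"
    using powr_add[of "cmod z" "q - 2" 2] by simp
  then show ?thesis using assms by (simp add: cmod_power2)
qed

lemma continuous_on_norm_powr:
  "0 \<notin> S \<Longrightarrow> continuous_on S (\<lambda>z. cmod z powr q)"
  by (auto intro!: continuous_intros)

lemma test_integrable_weight:
  assumes S: "open S" "0 \<notin> S" and f: "f \<in> test_functions S"
  shows "set_integrable lebesgue S (\<lambda>z. cmod z powr q * f z)"
  using test_functions_integrable[OF continuous_on_imp_locally_integrable_on[OF continuous_on_norm_powr[OF S(2), of q]] _ f, of "[]"] S(1)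
  by (simp add: mult.commute)

text \<open>The two integrands are the divergences of \<open>f\<close> times the fields
  \<open>|z| powr (p - 2) * z\<close> and \<open>|z| powr (p - 2) * \<i> z\<close>. The first field
  has divergence \<open>p * |z| powr (p - 2)\<close> in the plane, the second is divergence free. In
  polar terms these are the integrals of \<open>\<partial>\<^sub>t (exp (p t) f)\<close> and
  \<open>\<partial>\<^sub>\<theta> (exp (p t) f)\<close>.\<close>

lemma integral_polar_deriv_eq_0:
  assumes S: "open S" "0 \<notin> S" and f: "f \<in> test_functions S"
  shows "(LINT z:S|lebesgue. cmod z powr (p - 2) * (radial_deriv f z + p * f z)) = 0"
    and "(LINT z:S|lebesgue. cmod z powr (p - 2) * angular_deriv f z) = 0"
proof -
  have S': "S \<in> sets lebesgue" using S by simp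
  have z0: "z \<noteq> 0" if "z \<in> S" for z using S that by auto
  \<comment> \<open>Here \<open>f\<close> plays the test function, and a linear coordinate times the
    weight is the function differentiated weakly; it is continuously differentiable on
    \<open>S\<close>, which avoids the origin.\<close>
  have lin: "linear g \<Longrightarrow> has_weak_deriv S [e] (\<lambda>z. g z * cmod z powr (p - 2))
      (\<lambda>z. g z * ((p - 2) * cmod z powr (p - 4) * (Re z * Re e + Im z * Im e)) + g e * cmod z powr (p - 2))"
    if e: "e \<in> Basis" for g :: "complex \<Rightarrow> real" and e
  proof (rule has_weak_deriv_classical[OF S(1) e])
    assume g: "linear g"
    then have bl: "bounded_linear g" by (simp add: linear_conv_bounded_linear)
    show "((\<lambda>z. g z * cmod z powr (p - 2)) has_derivative
      (\<lambda>h. g z * ((p - 2) * cmod z powr (p - 4) * (Re z * Re h + Im z * Im h)) + g h * cmod z powr (p - 2))) (at z)"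
      if "z \<in> S" for z
      using has_derivative_mult[OF bounded_linear_imp_has_derivative[OF bl] has_derivative_norm_powr[OF z0[OF that], of "p - 2"]]
      by (simp add: add.commute)
    show "continuous_on S (\<lambda>z. g z * ((p - 2) * cmod z powr (p - 4) * (Re z * Re e + Im z * Im e)) + g e * cmod z powr (p - 2))"
      by (intro continuous_intros continuous_on_norm_powr[OF S(2)] bounded_linear.continuous_on[OF bl])
  qed
  have lRI: "linear Re" "linear Im" by (simp_all add: bounded_linear.linear bounded_linear_Re bounded_linear_Im)
  have I: "set_integrable lebesgue S (\<lambda>z. iter_partial ds f z *\<^sub>R w z)" if "set ds \<subseteq> Basis" "continuous_on S w"
    for ds and w :: "complex \<Rightarrow> real"
    by (rule test_functions_integrable[OF continuous_on_imp_locally_integrable_on[OF that(2)] S' f that(1)])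
  have c: "continuous_on S (\<lambda>z. Re z * cmod z powr (p - 2))" "continuous_on S (\<lambda>z. Im z * cmod z powr (p - 2))"
    by (intro continuous_intros continuous_on_norm_powr[OF S(2)])+
  have D: "(LINT z:S|lebesgue. iter_partial [e] f z *\<^sub>R (g z * cmod z powr (p - 2))) =
      - (LINT z:S|lebesgue. f z *\<^sub>R (g z * ((p - 2) * cmod z powr (p - 4) * (Re z * Re e + Im z * Im e)) + g e * cmod z powr (p - 2)))"
    if "e \<in> Basis" "linear g" for e and g :: "complex \<Rightarrow> real"
    using has_weak_derivD[OF lin[OF that] f] by simp
  have I': "set_integrable lebesgue S (\<lambda>z. f z *\<^sub>R (g z * ((p - 2) * cmod z powr (p - 4) * (Re z * Re e + Im z * Im e)) + g e * cmod z powr (p - 2)))"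
    if "linear g" for e and g :: "complex \<Rightarrow> real"
  proof (rule I[of "[]", unfolded iter_partial_Nil])
    have "continuous_on S g"
      using that by (intro linear_continuous_on) (simp add: linear_conv_bounded_linear)
    then show "continuous_on S (\<lambda>z. g z * ((p - 2) * cmod z powr (p - 4) * (Re z * Re e + Im z * Im e)) + g e * cmod z powr (p - 2))"
      by (intro continuous_intros continuous_on_norm_powr[OF S(2)])
  qed simp
  let ?I = "\<lambda>e g. (LINT z:S|lebesgue. iter_partial [e] f z *\<^sub>R (g z * cmod z powr (p - 2)))"
  let ?J = "\<lambda>e g. (LINT z:S|lebesgue. f z *\<^sub>R (g z * ((p - 2) * cmod z powr (p - 4) * (Re z * Re e + Im z * Im e)) + g e * cmod z powr (p - 2)))"
  have If: "set_integrable lebesgue S (\<lambda>z. p * (f z * cmod z powr (p - 2)))"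
    using I[of "[]" "\<lambda>z. cmod z powr (p - 2)"] continuous_on_norm_powr[OF S(2)] by simp
  have Ic: "set_integrable lebesgue S (\<lambda>z. iter_partial [e] f z *\<^sub>R (Re z * cmod z powr (p - 2)))"
    "set_integrable lebesgue S (\<lambda>z. iter_partial [e] f z *\<^sub>R (Im z * cmod z powr (p - 2)))" if "e \<in> Basis" for e
    using that by (intro I c; simp)+
  have "(LINT z:S|lebesgue. cmod z powr (p - 2) * (radial_deriv f z + p * f z)) =
      (LINT z:S|lebesgue. iter_partial [1] f z *\<^sub>R (Re z * cmod z powr (p - 2)) + iter_partial [\<i>] f z *\<^sub>R (Im z * cmod z powr (p - 2)) +
         p * (f z * cmod z powr (p - 2)))"
    by (intro set_lebesgue_integral_cong) (auto simp: radial_deriv_def iter_partial_Cons algebra_simps S)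
  also have "\<dots> = ?I 1 Re + ?I \<i> Im + (LINT z:S|lebesgue. p * (f z * cmod z powr (p - 2)))"
    by (simp only: set_integral_add Ic If complex_Basis)
  also have "?I 1 Re + ?I \<i> Im = - (?J 1 Re + ?J \<i> Im)"
    by (simp only: D[OF complex_Basis(1) lRI(1)] D[OF complex_Basis(2) lRI(2)] minus_add_distrib)
  also have "?J 1 Re + ?J \<i> Im = (LINT z:S|lebesgue. f z *\<^sub>R (Re z * ((p - 2) * cmod z powr (p - 4) * (Re z * Re 1 + Im z * Im 1)) + Re 1 * cmod z powr (p - 2))
     + f z *\<^sub>R (Im z * ((p - 2) * cmod z powr (p - 4) * (Re z * Re \<i> + Im z * Im \<i>)) + Im \<i> * cmod z powr (p - 2)))"
    by (intro set_integral_add(2)[symmetric] I' lRI)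
  also have "\<dots> = (LINT z:S|lebesgue. p * (f z * cmod z powr (p - 2)))"
  proof (intro set_lebesgue_integral_cong)
    show "\<forall>z. z \<in> S \<longrightarrow> f z *\<^sub>R (Re z * ((p - 2) * cmod z powr (p - 4) * (Re z * Re 1 + Im z * Im 1)) + Re 1 * cmod z powr (p - 2))
     + f z *\<^sub>R (Im z * ((p - 2) * cmod z powr (p - 4) * (Re z * Re \<i> + Im z * Im \<i>)) + Im \<i> * cmod z powr (p - 2))
      = p * (f z * cmod z powr (p - 2))"
    proof (intro allI impI)
      fix z assume "z \<in> S"
      note e = norm_powr_eq_sq[OF z0[OF this], of "p - 2", simplified]
      show "f z *\<^sub>R (Re z * ((p - 2) * cmod z powr (p - 4) * (Re z * Re 1 + Im z * Im 1)) + Re 1 * cmod z powr (p - 2))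
     + f z *\<^sub>R (Im z * ((p - 2) * cmod z powr (p - 4) * (Re z * Re \<i> + Im z * Im \<i>)) + Im \<i> * cmod z powr (p - 2))
      = p * (f z * cmod z powr (p - 2))"
        unfolding e by (simp add: algebra_simps power2_eq_square)
    qed
  qed (rule S')
  finally show "(LINT z:S|lebesgue. cmod z powr (p - 2) * (radial_deriv f z + p * f z)) = 0" by simp
  have "(LINT z:S|lebesgue. cmod z powr (p - 2) * angular_deriv f z) =
      (LINT z:S|lebesgue. iter_partial [\<i>] f z *\<^sub>R (Re z * cmod z powr (p - 2)) - iter_partial [1] f z *\<^sub>R (Im z * cmod z powr (p - 2)))"
    by (intro set_lebesgue_integral_cong) (auto simp: angular_deriv_def iter_partial_Cons algebra_simps S)
  also have "\<dots> = ?I \<i> Re - ?I 1 Im"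
    by (simp only: set_integral_diff Ic complex_Basis)
  also have "\<dots> = ?J 1 Im - ?J \<i> Re"
    by (simp only: D[OF complex_Basis(1) lRI(2)] D[OF complex_Basis(2) lRI(1)] diff_minus_eq_add minus_diff_eq)
  also have "?J 1 Im = ?J \<i> Re"
    by (intro set_lebesgue_integral_cong) (auto simp: S algebra_simps)
  finally show "(LINT z:S|lebesgue. cmod z powr (p - 2) * angular_deriv f z) = 0" by simp
qed

section \<open>The inequalities for test functions\<close>

text \<open>Since \<open>d + \<gamma> = k\<close> and
  \<open>d - \<gamma> = k - 2 * \<gamma>\<close>, the product \<open>Q\<close> is
  \<open>d\<^sup>2 - \<gamma>\<^sup>2\<close>. The two bounds without \<open>s\<close> follow by
  discarding \<open>\<gamma>\<^sup>2\<close> and using \<open>d \<ge> 1\<close>, a consequence of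
  \<open>d > k / 2\<close>; the last one needs a case distinction.\<close>

lemma weight_constants:
  fixes k \<gamma> :: real
  assumes k: "k \<ge> 2" and \<gamma>: "\<gamma> < k / 2"
  defines "Q \<equiv> k * (k - 2 * \<gamma>)" and "d \<equiv> k - \<gamma>" and "s \<equiv> \<gamma> - 1"
  shows "Q > 0" "2 * Q \<le> 2 * d\<^sup>2 + 2" "2 * Q \<le> 6 * d\<^sup>2 - 2" "2 * Q * s\<^sup>2 \<le> (d\<^sup>2 - 1)\<^sup>2"
proof -
  show Q: "Q > 0" using k \<gamma> by (simp add: Q_def)
  have Qd: "Q = d\<^sup>2 - \<gamma>\<^sup>2" by (simp add: Q_def d_def power2_eq_square algebra_simps)
  have d: "d\<^sup>2 \<ge> 1" using k \<gamma> by (simp add: d_def)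
  show "2 * Q \<le> 2 * d\<^sup>2 + 2" 
  proof -
    have "2 * Q = 2 * d\<^sup>2 - 2 * \<gamma>\<^sup>2" by (simp add: Qd)
    moreover have "0 \<le> \<gamma>\<^sup>2" by simp
    ultimately show ?thesis by linarith
  qed
  show "2 * Q \<le> 6 * d\<^sup>2 - 2" 
  proof -
    have "2 * Q = 2 * d\<^sup>2 - 2 * \<gamma>\<^sup>2" by (simp add: Qd)
    moreover have "0 \<le> \<gamma>\<^sup>2" by simp
    ultimately show ?thesis using d by linarith
  qed
  have c: "d\<^sup>2 - 1 = Q + s\<^sup>2 + 2 * s" by (simp add: Qd s_def power2_eq_square algebra_simps)
  \<comment> \<open>Substituting \<open>c\<close> cancels \<open>2 * Q * s\<^sup>2\<close> and
    leaves a square plus a term that can be negative only for \<open>- 4 < s < 0\<close>.\<close>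
  have e: "(d\<^sup>2 - 1)\<^sup>2 - 2 * Q * s\<^sup>2 = (Q + 2 * s)\<^sup>2 + s\<^sup>2 * (s * (s + 4))"
    unfolding c by (simp add: power2_eq_square algebra_simps)
  have "(Q + 2 * s)\<^sup>2 + s\<^sup>2 * (s * (s + 4)) \<ge> 0"
  proof (cases "s * (s + 4) \<ge> 0")
    case True
    then show ?thesis by simp
  next
    case False
    then have s: "s < 0" by (smt (verit) mult_nonneg_nonneg)
    \<comment> \<open>The hypothesis \<open>k \<ge> 2\<close> enters twice, for the first factor and
      through \<open>k - 2 * \<gamma> = k - 2 - 2 * s \<ge> - 2 * s\<close>. The resulting lower
      bound on \<open>Q + 2 * s\<close> is just enough to complete the square
      \<open>(s * (s + 2))\<^sup>2\<close>.\<close>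
    have "2 * (- 2 * s) \<le> k * (k - 2 * \<gamma>)" using k s by (intro mult_mono) (auto simp: s_def)
    then have "- 2 * s \<le> Q + 2 * s" by (simp add: Q_def)
    then have "(- 2 * s)\<^sup>2 \<le> (Q + 2 * s)\<^sup>2" using s by (intro power_mono) auto
    moreover have "(- 2 * s)\<^sup>2 + s\<^sup>2 * (s * (s + 4)) = (s * (s + 2))\<^sup>2"
      by (simp add: power2_eq_square algebra_simps)
    ultimately show ?thesis using zero_le_power2[of "s * (s + 2)"] by linarith
  qed
  then show "2 * Q * s\<^sup>2 \<le> (d\<^sup>2 - 1)\<^sup>2" using e by linarith
qed

lemma polar_deriv_eq_0_outside:
  assumes "closed K" "\<And>x. x \<notin> K \<Longrightarrow> f x = 0" "x \<notin> K"
  shows "radial_deriv f x = 0" "angular_deriv f x = 0"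
proof -
  have "closure {x. f x \<noteq> 0} \<subseteq> K" using assms(1,2) by (intro closure_minimal) auto
  then have "partial_deriv e f x = 0" for e
    using iter_partial_eq_0_outside[of x f "[e]"] assms(3) by (auto simp: iter_partial_Cons)
  then show "radial_deriv f x = 0" "angular_deriv f x = 0"
    by (simp_all add: radial_deriv_def angular_deriv_def)
qed

text \<open>With \<open>v = |z| powr s * \<phi>\<close> and \<open>d = k - 1 - s\<close>, the functions \<open>p\<close>, \<open>q\<close> below are the
  logarithmic polar derivatives \<open>v\<^sub>t\<close>, \<open>v\<^sub>\<theta>\<close>, up to the factor \<open>|z| powr s\<close>. The two fluxes \<open>A\<close>, \<open>B\<close> come
  from integrating by parts all the indefinite terms of \<open>\<alpha>\<^sup>2 + 4 \<beta>\<^sup>2\<close>.\<close>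

lemma test_function_energy:
  fixes k \<gamma> :: real
  assumes S: "open S" "0 \<notin> S" and \<phi>: "\<phi> \<in> test_functions S" and k: "k \<ge> 2" and \<gamma>: "\<gamma> < k / 2"
  defines "\<alpha> \<equiv> \<lambda>z. radial_deriv (radial_deriv \<phi>) z - angular_deriv (angular_deriv \<phi>) z +
      2 * (k - 1) * radial_deriv \<phi> z + k * (k - 2) * \<phi> z"
    and "\<beta> \<equiv> \<lambda>z. angular_deriv (radial_deriv \<phi>) z + (k - 1) * angular_deriv \<phi> z"
  shows "2 * (k * (k - 2 * \<gamma>)) * (\<gamma> - 1)\<^sup>2 * (LINT z:S|lebesgue. cmod z powr (2 * \<gamma> - 4) * (\<phi> z)\<^sup>2) \<le>
      (LINT z:S|lebesgue. cmod z powr (2 * \<gamma> - 4) * ((\<alpha> z)\<^sup>2 + 4 * (\<beta> z)\<^sup>2))"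
    and "2 * (k * (k - 2 * \<gamma>)) *
        (LINT z:S|lebesgue. cmod z powr (2 * \<gamma> - 4) * ((radial_deriv \<phi> z)\<^sup>2 + (angular_deriv \<phi> z)\<^sup>2)) \<le>
      (LINT z:S|lebesgue. cmod z powr (2 * \<gamma> - 4) * ((\<alpha> z)\<^sup>2 + 4 * (\<beta> z)\<^sup>2))"
proof -
  define s where "s = \<gamma> - 1"
  define d where "d = k - \<gamma>"
  define c where "c = d\<^sup>2 - 1"
  define Q where "Q = k * (k - 2 * \<gamma>)"
  note con = weight_constants[OF k \<gamma>, folded s_def d_def Q_def, folded c_def]
  have S': "S \<in> sets lebesgue" using S by simp
  define K where "K = closure {x. \<phi> x \<noteq> 0}"
  have K: "closed K" by (simp add: K_def)
  note sm = test_functionsD(1)[OF \<phi>]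
  have \<phi>0: "\<phi> x = 0" if "x \<notin> K" for x
    using that closure_subset[of "{x. \<phi> x \<noteq> 0}"] by (auto simp: K_def)
  define t where "t = radial_deriv \<phi>"
  define q where "q = angular_deriv \<phi>"
  define tt where "tt = radial_deriv t"
  define w where "w = angular_deriv t"
  define h where "h = angular_deriv q"
  define y where "y = angular_deriv w"
  define p where "p = (\<lambda>z. t z + s * \<phi> z)"
  define r where "r = (\<lambda>z. w z + s * q z)"
  have smt: "smooth t" "smooth q" "smooth tt" "smooth w" "smooth h" "smooth y"
    unfolding t_def q_def tt_def w_def h_def y_def
    by (intro smooth_radial_deriv smooth_angular_deriv sm)+
  have smp: "smooth p" "smooth r"
    unfolding p_def r_def by (intro smooth_intros smt sm)+
  have z: "t x = 0" "q x = 0" "tt x = 0" "w x = 0" "h x = 0" "y x = 0" if x: "x \<notin> K" for x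
  proof -
    have t0: "t x = 0" and q0: "q x = 0" if "x \<notin> K" for x
      unfolding t_def q_def using that by (intro polar_deriv_eq_0_outside[OF K \<phi>0]; simp)+
    have w0: "w x = 0" if "x \<notin> K" for x
      unfolding w_def using that by (intro polar_deriv_eq_0_outside[OF K t0]; simp)
    show "t x = 0" "q x = 0" "w x = 0" using x t0 q0 w0 by auto
    show "tt x = 0" unfolding tt_def using x by (intro polar_deriv_eq_0_outside[OF K t0]; simp)
    show "h x = 0" unfolding h_def using x by (intro polar_deriv_eq_0_outside[OF K q0]; simp)
    show "y x = 0" unfolding y_def using x by (intro polar_deriv_eq_0_outside[OF K w0]; simp)
  qed
  have zp: "p x = 0" "r x = 0" if "x \<notin> K" for x using z[OF that] \<phi>0[OF that] by (simp_all add: p_def r_def)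
  have test: "f \<in> test_functions S" if "smooth f" "\<And>x. x \<notin> K \<Longrightarrow> f x = 0" for f
    using test_functions_smooth_support[OF \<phi> that(1)] that(2) by (simp add: K_def)
  have comm: "radial_deriv q = w"
    unfolding q_def w_def t_def by (rule ext) (rule angular_radial_deriv_expand(4)[OF sm])
  have rad_h: "radial_deriv h = y"
    unfolding h_def y_def
    by (rule ext) (simp add: angular_radial_deriv_expand(4)[OF smt(2)] comm)
  note e = polar_deriv_add polar_deriv_diff polar_deriv_mult polar_deriv_const smooth_intros sm smt smp
  have dp: "radial_deriv p x = tt x + s * t x" "angular_deriv p x = r x" "angular_deriv r x = y x + s * h x" for x
    unfolding p_def r_def
    by (simp_all add: e) (simp_all add: t_def[symmetric] q_def[symmetric] tt_def[symmetric] w_def[symmetric] h_def[symmetric] y_def[symmetric])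
  \<comment> \<open>Up to powers of \<open>|z|\<close>, \<open>\<alpha>\<close> is
    \<open>v\<^sub>t\<^sub>t - v\<^sub>\<theta>\<^sub>\<theta> + 2 d v\<^sub>t + c v\<close> and
    \<open>\<beta>\<close> is \<open>v\<^sub>t\<^sub>\<theta> + d v\<^sub>\<theta>\<close>. The
    leading parts give \<open>(v\<^sub>t\<^sub>t + v\<^sub>\<theta>\<^sub>\<theta>)\<^sup>2\<close>
    minus four times the Hessian determinant, which is the divergence \<open>\<partial>\<^sub>t
    (v\<^sub>t v\<^sub>\<theta>\<^sub>\<theta>) - \<partial>\<^sub>\<theta> (v\<^sub>t
    v\<^sub>t\<^sub>\<theta>)\<close>. Moving one derivative in
    \<open>- 4 d v\<^sub>t v\<^sub>\<theta>\<^sub>\<theta>\<close> raises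
    \<open>8 d v\<^sub>\<theta> v\<^sub>t\<^sub>\<theta>\<close> to \<open>12 d\<close>, hence the
    \<open>6 * d\<close>.\<close>
  define A where "A = (\<lambda>z. (-4) * (p z * h z) + (2 * d) * (p z * p z) + (6 * d) * (q z * q z) +
      (2 * c) * (\<phi> z * p z) + (2 * d * c) * (\<phi> z * \<phi> z))"
  define B where "B = (\<lambda>z. 4 * (p z * r z) + (-4 * d) * (p z * q z) + (-2 * c) * (\<phi> z * q z))"
  \<comment> \<open>The flux for the gradient form: inserting \<open>t = p - s \<phi>\<close> into
    \<open>t\<^sup>2\<close> leaves the cross term \<open>- 2 s \<phi> p\<close>, which equals
    \<open>- s\<^sup>2 \<phi>\<^sup>2\<close> up to boundary terms after division by the weight, and
    so fits the target form.\<close>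
  define C where "C = (\<lambda>z. s * (\<phi> z * \<phi> z))"
  have tA: "A \<in> test_functions S" "B \<in> test_functions S" "C \<in> test_functions S"
    unfolding A_def B_def C_def by (intro test smooth_intros sm smt smp; simp add: z zp \<phi>0)+
  have dA: "radial_deriv A x = -4 * (p x * y x + (tt x + s * t x) * h x) + 4 * d * (p x * (tt x + s * t x)) +
      12 * d * (q x * w x) + 2 * c * (\<phi> x * (tt x + s * t x) + t x * p x) + 4 * d * c * (\<phi> x * t x)" for x
    unfolding A_def by (simp add: e dp comm rad_h t_def[symmetric])
  have dB: "angular_deriv B x = 4 * (p x * (y x + s * h x) + r x * r x) - 4 * d * (p x * h x + r x * q x) -
      2 * c * (\<phi> x * h x + q x * q x)" for x
    unfolding B_def by (simp add: e dp h_def[symmetric] q_def[symmetric])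
  have dC: "radial_deriv C x = 2 * s * (\<phi> x * t x)" for x
    unfolding C_def by (simp add: e t_def[symmetric])
  \<comment> \<open>The first square is
    \<open>v\<^sub>t\<^sub>t + v\<^sub>\<theta>\<^sub>\<theta>\<close>, because
    \<open>\<partial>\<^sub>t\<close> acts on \<open>v\<^sub>t\<close> as
    \<open>radial_deriv + s\<close> on \<open>p\<close>. The next coefficients are
    \<open>4 d\<^sup>2 - 2 c\<close> and \<open>4 d\<^sup>2 + 2 c\<close>, the shift by
    \<open>2 c\<close> coming from
    \<open>2 c v (v\<^sub>t\<^sub>t - v\<^sub>\<theta>\<^sub>\<theta>)\<close>.\<close>
  define N where "N = (\<lambda>z. (tt z + s * t z + s * p z + h z)\<^sup>2 + (2 * d\<^sup>2 + 2) * (p z)\<^sup>2 + (6 * d\<^sup>2 - 2) * (q z)\<^sup>2 + c\<^sup>2 * (\<phi> z)\<^sup>2)"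
  have kd: "k = d + s + 1" by (simp add: d_def s_def)
  \<comment> \<open>A polynomial identity in the derivatives of \<open>\<phi>\<close>. The term
    \<open>2 * s * A\<close> comes from the radial weight, whereas rotations leave the weight fixed
    and \<open>B\<close> needs no such term. The third-order terms \<open>y\<close> of the two
    fluxes cancel.\<close>
  have identity: "(\<alpha> x)\<^sup>2 + 4 * (\<beta> x)\<^sup>2 = N x + (radial_deriv A x + 2 * s * A x) + angular_deriv B x" for x
    unfolding \<alpha>_def \<beta>_def t_def[symmetric] q_def[symmetric]
    unfolding tt_def[symmetric] w_def[symmetric] h_def[symmetric] dA dB
    unfolding N_def A_def kd p_def r_def c_def
    by algebra
  have identity': "(t x)\<^sup>2 + (q x)\<^sup>2 = (p x)\<^sup>2 + (q x)\<^sup>2 + s\<^sup>2 * (\<phi> x)\<^sup>2 - (radial_deriv C x + 2 * s * C x)" for x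
    unfolding dC unfolding C_def p_def by (simp add: power2_eq_square algebra_simps)
  define I where "I f = (LINT z:S|lebesgue. cmod z powr (2 * s - 2) * f z)" for f :: "complex \<Rightarrow> real"
  have si: "set_integrable lebesgue S (\<lambda>z. cmod z powr (2 * s - 2) * f z)" if "f \<in> test_functions S" for f
    by (rule test_integrable_weight[OF S that])
  have I_add: "I (\<lambda>z. f z + g z) = I f + I g" if "f \<in> test_functions S" "g \<in> test_functions S" for f g
    unfolding I_def distrib_left by (rule set_integral_add(2)) (intro si that)+
  have I_diff: "I (\<lambda>z. f z - g z) = I f - I g" if "f \<in> test_functions S" "g \<in> test_functions S" for f g
    unfolding I_def right_diff_distrib by (rule set_integral_diff(2)) (intro si that)+
  have I_mono: "I f \<le> I g" if "f \<in> test_functions S" "g \<in> test_functions S" "\<And>x. f x \<le> g x" for f g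
    unfolding I_def by (rule set_integral_mono) (use si that in \<open>auto intro!: mult_left_mono\<close>)
  have I_cmult: "I (\<lambda>z. a * f z) = a * I f" for a f
    unfolding I_def by (simp add: mult.left_commute)
  have IE: "I (\<lambda>x. radial_deriv f x + 2 * s * f x) = 0" and IT: "I (angular_deriv f) = 0"
    if "f \<in> test_functions S" for f
    unfolding I_def using integral_polar_deriv_eq_0[OF S that, of "2 * s"] by simp_all
  have tst: "(\<lambda>x. radial_deriv f x + 2 * s * f x) \<in> test_functions S" "angular_deriv f \<in> test_functions S"
    if "f \<in> test_functions S" for f
  proof -
    note sf = test_functionsD(1)[OF that]
    have f0: "f x = 0" if "x \<notin> closure {x. f x \<noteq> 0}" for x
      using that closure_subset[of "{x. f x \<noteq> 0}"] by blast
    have d0: "radial_deriv f x = 0" "angular_deriv f x = 0" if "x \<notin> closure {x. f x \<noteq> 0}" for x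
      by (rule polar_deriv_eq_0_outside[OF closed_closure f0 that]; assumption)+
    show "(\<lambda>x. radial_deriv f x + 2 * s * f x) \<in> test_functions S"
    proof (rule test_functions_smooth_support[OF that])
      show "smooth (\<lambda>x. radial_deriv f x + 2 * s * f x)"
        by (intro smooth_intros smooth_radial_deriv sf)
      show "radial_deriv f x + 2 * s * f x = 0" if "x \<notin> closure {x. f x \<noteq> 0}" for x
      proof -
        have "radial_deriv f x = 0" by (rule d0(1)[OF that])
        then show ?thesis using f0[OF that] by simp
      qed
    qed
    show "angular_deriv f \<in> test_functions S"
      by (rule test_functions_smooth_support[OF that smooth_angular_deriv[OF sf]]) (rule d0(2))
  qed
  have tN: "N \<in> test_functions S"
    unfolding N_def power2_eq_square by (intro test smooth_intros sm smt smp; simp add: z zp \<phi>0)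
  have "I (\<lambda>x. (\<alpha> x)\<^sup>2 + 4 * (\<beta> x)\<^sup>2) = I (\<lambda>x. (N x + (radial_deriv A x + 2 * s * A x)) + angular_deriv B x)"
    by (simp only: identity)
  also have "\<dots> = I (\<lambda>x. N x + (radial_deriv A x + 2 * s * A x)) + I (angular_deriv B)"
  proof (rule I_add)
    have "smooth (\<lambda>x. N x + (radial_deriv A x + 2 * s * A x))"
      by (intro smooth_add test_functionsD(1)[OF tN] test_functionsD(1)[OF tst(1)[OF tA(1)]])
    moreover have "N x + (radial_deriv A x + 2 * s * A x) = 0" if "x \<notin> K" for x
      unfolding dA unfolding N_def A_def using that by (simp add: z zp \<phi>0)
    ultimately show "(\<lambda>x. N x + (radial_deriv A x + 2 * s * A x)) \<in> test_functions S" by (rule test)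
  qed (rule tst(2)[OF tA(2)])
  also have "\<dots> = I N" using IE[OF tA(1)] IT[OF tA(2)] by (simp add: I_add[OF tN tst(1)[OF tA(1)]])
  finally have main: "I (\<lambda>x. (\<alpha> x)\<^sup>2 + 4 * (\<beta> x)\<^sup>2) = I N" .
  have t1: "(\<lambda>x. (\<phi> x)\<^sup>2) \<in> test_functions S" "(\<lambda>x. (p x)\<^sup>2 + (q x)\<^sup>2 + s\<^sup>2 * (\<phi> x)\<^sup>2) \<in> test_functions S"
    "(\<lambda>x. (2 * Q * s\<^sup>2) * (\<phi> x)\<^sup>2) \<in> test_functions S" "(\<lambda>x. (2 * Q) * ((p x)\<^sup>2 + (q x)\<^sup>2 + s\<^sup>2 * (\<phi> x)\<^sup>2)) \<in> test_functions S"
    unfolding power2_eq_square by (intro test smooth_intros sm smt smp; simp add: z zp \<phi>0)+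
  have "I (\<lambda>x. (2 * Q * s\<^sup>2) * (\<phi> x)\<^sup>2) \<le> I N"
  proof (rule I_mono[OF t1(3) tN])
    fix x
    have "(2 * Q * s\<^sup>2) * (\<phi> x)\<^sup>2 \<le> c\<^sup>2 * (\<phi> x)\<^sup>2" using con(4) by (rule mult_right_mono) simp
    moreover have "0 \<le> (2 * d\<^sup>2 + 2) * (p x)\<^sup>2" by simp
    moreover have "0 \<le> (6 * d\<^sup>2 - 2) * (q x)\<^sup>2" using con(1,3) by (intro mult_nonneg_nonneg) auto
    ultimately show "(2 * Q * s\<^sup>2) * (\<phi> x)\<^sup>2 \<le> N x"
      using zero_le_power2[of "tt x + s * t x + s * p x + h x"] unfolding N_def by linarith
  qed
  then have r1: "2 * Q * s\<^sup>2 * I (\<lambda>x. (\<phi> x)\<^sup>2) \<le> I (\<lambda>x. (\<alpha> x)\<^sup>2 + 4 * (\<beta> x)\<^sup>2)"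
    by (simp add: main I_cmult)
  have "I (\<lambda>x. (t x)\<^sup>2 + (q x)\<^sup>2) = I (\<lambda>x. (p x)\<^sup>2 + (q x)\<^sup>2 + s\<^sup>2 * (\<phi> x)\<^sup>2) - I (\<lambda>x. radial_deriv C x + 2 * s * C x)"
    unfolding identity' by (rule I_diff[OF t1(2) tst(1)[OF tA(3)]])
  then have grad: "I (\<lambda>x. (t x)\<^sup>2 + (q x)\<^sup>2) = I (\<lambda>x. (p x)\<^sup>2 + (q x)\<^sup>2 + s\<^sup>2 * (\<phi> x)\<^sup>2)"
    using IE[OF tA(3)] by simp
  have "I (\<lambda>x. (2 * Q) * ((p x)\<^sup>2 + (q x)\<^sup>2 + s\<^sup>2 * (\<phi> x)\<^sup>2)) \<le> I N"
  proof (rule I_mono[OF t1(4) tN])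
    fix x
    have "(2 * Q * s\<^sup>2) * (\<phi> x)\<^sup>2 \<le> c\<^sup>2 * (\<phi> x)\<^sup>2" using con(4) by (rule mult_right_mono) simp
    moreover have "2 * Q * (p x)\<^sup>2 \<le> (2 * d\<^sup>2 + 2) * (p x)\<^sup>2" using con(2) by (rule mult_right_mono) simp
    moreover have "2 * Q * (q x)\<^sup>2 \<le> (6 * d\<^sup>2 - 2) * (q x)\<^sup>2" using con(3) by (rule mult_right_mono) simp
    moreover have "(2 * Q) * ((p x)\<^sup>2 + (q x)\<^sup>2 + s\<^sup>2 * (\<phi> x)\<^sup>2) = 2 * Q * (p x)\<^sup>2 + 2 * Q * (q x)\<^sup>2 + (2 * Q * s\<^sup>2) * (\<phi> x)\<^sup>2"
      by (simp add: algebra_simps)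
    ultimately show "(2 * Q) * ((p x)\<^sup>2 + (q x)\<^sup>2 + s\<^sup>2 * (\<phi> x)\<^sup>2) \<le> N x"
      using zero_le_power2[of "tt x + s * t x + s * p x + h x"] unfolding N_def by linarith
  qed
  then have r2: "2 * Q * I (\<lambda>x. (t x)\<^sup>2 + (q x)\<^sup>2) \<le> I (\<lambda>x. (\<alpha> x)\<^sup>2 + 4 * (\<beta> x)\<^sup>2)"
    unfolding grad main I_cmult .
  have g: "2 * s - 2 = 2 * \<gamma> - 4" by (simp add: s_def)
  show "2 * (k * (k - 2 * \<gamma>)) * (\<gamma> - 1)\<^sup>2 * (LINT z:S|lebesgue. cmod z powr (2 * \<gamma> - 4) * (\<phi> z)\<^sup>2) \<le>
      (LINT z:S|lebesgue. cmod z powr (2 * \<gamma> - 4) * ((\<alpha> z)\<^sup>2 + 4 * (\<beta> z)\<^sup>2))"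
    using r1[unfolded I_def g] unfolding Q_def s_def .
  show "2 * (k * (k - 2 * \<gamma>)) *
        (LINT z:S|lebesgue. cmod z powr (2 * \<gamma> - 4) * ((radial_deriv \<phi> z)\<^sup>2 + (angular_deriv \<phi> z)\<^sup>2)) \<le>
      (LINT z:S|lebesgue. cmod z powr (2 * \<gamma> - 4) * ((\<alpha> z)\<^sup>2 + 4 * (\<beta> z)\<^sup>2))"
    using r2[unfolded I_def g] unfolding Q_def t_def q_def .
qed

text \<open>\<open>J ds\<close> stands for the value of the
  derivative \<open>\<partial>\<^sup>d\<^sup>s\<close> at \<open>z\<close>, and \<open>k = m - 1\<close>.\<close>

definition L_jet :: "real \<Rightarrow> (complex list \<Rightarrow> real) \<Rightarrow> complex \<Rightarrow> complex" where
  "L_jet k J z =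
     (of_real (J [1, 1] - J [\<i>, \<i>]) - \<i> * of_real (J [1, \<i>] + J [\<i>, 1])) / 4 +
     of_real k / z * ((of_real (J [1]) - \<i> * of_real (J [\<i>])) / 2) +
     of_real (k * (k - 2)) / (4 * z\<^sup>2) * of_real (J [])"

text \<open>The energy estimate rewritten in Cartesian terms:
  \<open>16 |z|\<^sup>4 |L|\<^sup>2\<close> is \<open>\<alpha>\<^sup>2 + 4 \<beta>\<^sup>2\<close>,
  and the squares of the radial and angular derivatives add up to
  \<open>|z|\<^sup>2 |\<nabla>\<phi>|\<^sup>2\<close>.\<close>

lemma test_function_inequality:
  fixes k \<gamma> :: real
  assumes S: "open S" "0 \<notin> S" and \<phi>: "\<phi> \<in> test_functions S" and k: "k \<ge> 2" and \<gamma>: "\<gamma> < k / 2"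
  shows "2 * (k * (k - 2 * \<gamma>)) * (\<gamma> - 1)\<^sup>2 * (LINT z:S|lebesgue. cmod z powr (2 * \<gamma> - 4) * (\<phi> z)\<^sup>2) \<le>
      16 * (LINT z:S|lebesgue. cmod z powr (2 * \<gamma>) * (cmod (L_jet k (\<lambda>ds. iter_partial (rev ds) \<phi> z) z))\<^sup>2)"
    and "2 * (k * (k - 2 * \<gamma>)) *
        (LINT z:S|lebesgue. cmod z powr (2 * \<gamma> - 2) * ((partial_deriv 1 \<phi> z)\<^sup>2 + (partial_deriv \<i> \<phi> z)\<^sup>2)) \<le>
      16 * (LINT z:S|lebesgue. cmod z powr (2 * \<gamma>) * (cmod (L_jet k (\<lambda>ds. iter_partial (rev ds) \<phi> z) z))\<^sup>2)"
proof -
  let ?J = "\<lambda>z ds. iter_partial (rev ds) \<phi> z"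
  define \<alpha> where "\<alpha> z = radial_deriv (radial_deriv \<phi>) z - angular_deriv (angular_deriv \<phi>) z +
      2 * (k - 1) * radial_deriv \<phi> z + k * (k - 2) * \<phi> z" for z
  define \<beta> where "\<beta> z = angular_deriv (radial_deriv \<phi>) z + (k - 1) * angular_deriv \<phi> z" for z
  have S': "S \<in> sets lebesgue" using S by simp
  note sm = test_functionsD(1)[OF \<phi>]
  have ab: "cmod z powr (2 * \<gamma> - 4) * ((\<alpha> z)\<^sup>2 + 4 * (\<beta> z)\<^sup>2) = 16 * (cmod z powr (2 * \<gamma>) * (cmod (L_jet k (?J z) z))\<^sup>2)"
    if "z \<in> S" for z
  proof -
    have z: "z \<noteq> 0" using that S by auto
    \<comment> \<open>Here \<open>\<alpha>\<close> and \<open>\<beta>\<close> originate: they are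
      the real part and, up to the factor -2, the imaginary part of
      \<open>(P + k) (P + k - 2) \<phi>\<close> with
      \<open>P = radial_deriv - \<i> angular_deriv\<close>.\<close>
    have J: "4 * z\<^sup>2 * L_jet k (?J z) z = Complex (\<alpha> z) (- 2 * \<beta> z)"
    proof -
      have "4 * z\<^sup>2 * L_jet k (?J z) z =
          z\<^sup>2 * (of_real (?J z [1, 1] - ?J z [\<i>, \<i>]) - \<i> * of_real (?J z [1, \<i>] + ?J z [\<i>, 1])) +
          2 * of_real k * z * (of_real (?J z [1]) - \<i> * of_real (?J z [\<i>])) + of_real (k * (k - 2)) * of_real (?J z [])"
        using z by (simp add: L_jet_def field_simps power2_eq_square)
      also have "\<dots> = Complex (\<alpha> z) (- 2 * \<beta> z)"
        unfolding \<alpha>_def \<beta>_def angular_radial_deriv_expand[OF sm]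
        using partial_deriv_commute[OF sm, of \<i> 1 z]
        by (simp add: complex_eq_iff radial_deriv_def angular_deriv_def iter_partial_Cons power2_eq_square algebra_simps)
      finally show ?thesis .
    qed
    have "16 * (cmod z ^ 4 * (cmod (L_jet k (?J z) z))\<^sup>2) = (cmod (4 * z\<^sup>2 * L_jet k (?J z) z))\<^sup>2"
      by (simp add: norm_mult norm_power power_mult_distrib power2_eq_square power4_eq_xxxx)
    also have "\<dots> = (\<alpha> z)\<^sup>2 + 4 * (\<beta> z)\<^sup>2" unfolding J by (simp add: cmod_power2)
    finally have 1: "(\<alpha> z)\<^sup>2 + 4 * (\<beta> z)\<^sup>2 = 16 * (cmod z ^ 4 * (cmod (L_jet k (?J z) z))\<^sup>2)" ..
    have "cmod z powr (2 * \<gamma>) = cmod z powr (2 * \<gamma> - 4) * cmod z powr 4"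
      using powr_add[of "cmod z" "2 * \<gamma> - 4" 4] by simp
    then have "cmod z powr (2 * \<gamma>) = cmod z powr (2 * \<gamma> - 4) * cmod z ^ 4"
      using z by (simp add: powr_numeral)
    then show ?thesis unfolding 1 by simp
  qed
  have gr: "cmod z powr (2 * \<gamma> - 4) * ((radial_deriv \<phi> z)\<^sup>2 + (angular_deriv \<phi> z)\<^sup>2) =
      cmod z powr (2 * \<gamma> - 2) * ((partial_deriv 1 \<phi> z)\<^sup>2 + (partial_deriv \<i> \<phi> z)\<^sup>2)" if "z \<in> S" for z
  proof -
    have z: "z \<noteq> 0" using that S by auto
    have e: "cmod z powr (2 * \<gamma> - 2) = cmod z powr (2 * \<gamma> - 4) * ((Re z)\<^sup>2 + (Im z)\<^sup>2)"
      using norm_powr_eq_sq[OF z, of "2 * \<gamma> - 2"] by simp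
    show ?thesis unfolding e radial_deriv_def angular_deriv_def by (simp add: power2_eq_square algebra_simps)
  qed
  note en = test_function_energy[OF S \<phi> k \<gamma>, folded \<alpha>_def[abs_def] \<beta>_def[abs_def]]
  have R: "(LINT z:S|lebesgue. cmod z powr (2 * \<gamma> - 4) * ((\<alpha> z)\<^sup>2 + 4 * (\<beta> z)\<^sup>2)) =
      16 * (LINT z:S|lebesgue. cmod z powr (2 * \<gamma>) * (cmod (L_jet k (?J z) z))\<^sup>2)"
    using ab S' by (subst set_lebesgue_integral_cong[of S lebesgue _ "\<lambda>z. 16 * (cmod z powr (2 * \<gamma>) * (cmod (L_jet k (?J z) z))\<^sup>2)"]) auto
  show "2 * (k * (k - 2 * \<gamma>)) * (\<gamma> - 1)\<^sup>2 * (LINT z:S|lebesgue. cmod z powr (2 * \<gamma> - 4) * (\<phi> z)\<^sup>2) \<le>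
      16 * (LINT z:S|lebesgue. cmod z powr (2 * \<gamma>) * (cmod (L_jet k (?J z) z))\<^sup>2)"
    using en(1) unfolding \<alpha>_def[symmetric] \<beta>_def[symmetric] R .
  have G: "(LINT z:S|lebesgue. cmod z powr (2 * \<gamma> - 4) * ((radial_deriv \<phi> z)\<^sup>2 + (angular_deriv \<phi> z)\<^sup>2)) =
      (LINT z:S|lebesgue. cmod z powr (2 * \<gamma> - 2) * ((partial_deriv 1 \<phi> z)\<^sup>2 + (partial_deriv \<i> \<phi> z)\<^sup>2))"
    using gr S' by (intro set_lebesgue_integral_cong) auto
  show "2 * (k * (k - 2 * \<gamma>)) *
        (LINT z:S|lebesgue. cmod z powr (2 * \<gamma> - 2) * ((partial_deriv 1 \<phi> z)\<^sup>2 + (partial_deriv \<i> \<phi> z)\<^sup>2)) \<le>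
      16 * (LINT z:S|lebesgue. cmod z powr (2 * \<gamma>) * (cmod (L_jet k (?J z) z))\<^sup>2)"
    using en(2) unfolding \<alpha>_def[symmetric] \<beta>_def[symmetric] R G .
qed

section \<open>Passage to the limit\<close>

text \<open>In \<open>L_op\<close> the outer \<open>weak_dz\<close> is applied to a chosen inner
  derivative known only almost everywhere; this lemma lets an explicit expression be substituted for
  it.\<close>

lemma has_weak_deriv_cong_AE:
  fixes u u' :: "'a::euclidean_space \<Rightarrow> 'b::euclidean_space"
  assumes S: "S \<in> sets lebesgue" and ds: "set ds \<subseteq> Basis"
    and u': "has_weak_deriv S ds u' v" and ae: "AE x in lebesgue. x \<in> S \<longrightarrow> u x = u' x"
  shows "has_weak_deriv S ds u v"
proof -
  have l': "u' locally_integrable_on S" using u' by (simp add: has_weak_deriv_def)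
  have cong: "integrable lebesgue f" "integral\<^sup>L lebesgue f = integral\<^sup>L lebesgue g"
    if g: "integrable lebesgue g" and fg: "AE x in lebesgue. g x = f x" for f g :: "'a \<Rightarrow> 'b"
  proof -
    have f: "f \<in> borel_measurable lebesgue"
      by (rule borel_measurable_AE[OF borel_measurable_integrable[OF g] fg])
    show "integrable lebesgue f" using fg by (intro integrable_cong_AE_imp[OF g f]) (auto elim: eventually_mono)
    show "integral\<^sup>L lebesgue f = integral\<^sup>L lebesgue g"
      by (rule integral_cong_AE[OF borel_measurable_integrable[OF g] f fg, symmetric])
  qed
  have "u locally_integrable_on S"
    unfolding locally_integrable_on_def
  proof (intro allI impI)
    fix K assume K: "compact K \<and> K \<subseteq> S"
    have "AE x in lebesgue. indicator K x *\<^sub>R u' x = indicator K x *\<^sub>R u x"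
      using ae by eventually_elim (use K in \<open>auto simp: indicator_def\<close>)
    moreover have "integrable lebesgue (\<lambda>x. indicator K x *\<^sub>R u' x)"
      using l' K by (simp add: locally_integrable_on_def set_integrable_def)
    ultimately show "u absolutely_integrable_on K"
      unfolding set_integrable_def by (rule cong(1)[rotated])
  qed
  moreover have "(LINT x:S|lebesgue. iter_partial ds \<phi> x *\<^sub>R u x) = (LINT x:S|lebesgue. iter_partial ds \<phi> x *\<^sub>R u' x)"
    if \<phi>: "\<phi> \<in> test_functions S" for \<phi>
  proof -
    have "AE x in lebesgue. indicator S x *\<^sub>R iter_partial ds \<phi> x *\<^sub>R u' x = indicator S x *\<^sub>R iter_partial ds \<phi> x *\<^sub>R u x"
      using ae by eventually_elim (auto simp: indicator_def)
    with test_functions_integrable[OF l' S \<phi> ds, unfolded set_integrable_def] show ?thesis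
      unfolding set_lebesgue_integral_def by (rule cong(2))
  qed
  ultimately show ?thesis using u' by (simp add: has_weak_deriv_def)
qed

lemma has_weak_deriv_add:
  fixes u u' :: "'a::euclidean_space \<Rightarrow> 'b::euclidean_space"
  assumes S: "S \<in> sets lebesgue" and ds: "set ds \<subseteq> Basis"
    and u: "has_weak_deriv S ds u v" and u': "has_weak_deriv S ds u' v'"
  shows "has_weak_deriv S ds (\<lambda>x. u x + u' x) (\<lambda>x. v x + v' x)"
proof -
  have "has_weak_deriv S ds (\<lambda>x. 0 :: 'b) (\<lambda>x. 0)"
    by (simp add: has_weak_deriv_def continuous_on_imp_locally_integrable_on)
  from has_weak_deriv_diff[OF S ds u has_weak_deriv_diff[OF S ds this u']] show ?thesis by simp
qed

lemma weak_dz_AE_eq: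
  assumes S: "open S" and F: "AE z in lebesgue. z \<in> S \<longrightarrow> F z = F' z"
    and G: "has_weak_deriv S [1] F' G" and H: "has_weak_deriv S [\<i>] F' H"
  shows "AE z in lebesgue. z \<in> S \<longrightarrow> weak_dz S F z = (G z - \<i> * H z) / 2"
proof -
  have S': "S \<in> sets lebesgue" using S by simp
  have "AE z in lebesgue. z \<in> S \<longrightarrow> weak_deriv S [1] F z = G z"
    by (rule weak_deriv_AE_eq[OF S has_weak_deriv_cong_AE[OF S' _ G F]]) simp
  moreover have "AE z in lebesgue. z \<in> S \<longrightarrow> weak_deriv S [\<i>] F z = H z"
    by (rule weak_deriv_AE_eq[OF S has_weak_deriv_cong_AE[OF S' _ H F]]) simp
  ultimately show ?thesis by eventually_elim (simp add: weak_dz_def)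
qed

text \<open>Bridge between the nonnegative integrals of the final statement and the Bochner
  integrals used for limits; it also replaces the integrand by one equal to it almost
  everywhere.\<close>

lemma set_nn_integral_eq_integral_AE:
  fixes f g :: "'a::euclidean_space \<Rightarrow> real"
  assumes S: "S \<in> sets lebesgue" and f: "integrable (lebesgue_on S) f" and pos: "\<And>x. x \<in> S \<Longrightarrow> 0 \<le> f x"
    and ae: "AE x in lebesgue. x \<in> S \<longrightarrow> g x = f x"
  shows "(\<integral>\<^sup>+x\<in>S. ennreal (g x) \<partial>lebesgue) = ennreal (integral\<^sup>L (lebesgue_on S) f)"
proof -
  have "(\<integral>\<^sup>+x\<in>S. ennreal (g x) \<partial>lebesgue) = (\<integral>\<^sup>+x. ennreal (indicator S x *\<^sub>R f x) \<partial>lebesgue)"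
    by (rule nn_integral_cong_AE) (use ae in \<open>eventually_elim, auto simp: indicator_def\<close>)
  also have "\<dots> = ennreal (\<integral>x. indicator S x *\<^sub>R f x \<partial>lebesgue)"
    using f S pos by (intro nn_integral_eq_integral) (auto simp: integrable_restrict_space indicator_def)
  also have "(\<integral>x. indicator S x *\<^sub>R f x \<partial>lebesgue) = integral\<^sup>L (lebesgue_on S) f"
    using S by (simp add: integral_restrict_space)
  finally show ?thesis .
qed

lemma L2_converges_mult_continuous:
  fixes h :: "'a::euclidean_space \<Rightarrow> complex"
  assumes L: "L2_converges (lebesgue_on S) F f" and S: "S \<in> sets lebesgue"
    and K: "compact K" "S \<subseteq> K" and h: "continuous_on K h"
  shows "L2_converges (lebesgue_on S) (\<lambda>n x. h x * F n x) (\<lambda>x. h x * f x)"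
proof -
  obtain B where "\<And>x. x \<in> K \<Longrightarrow> cmod (h x) \<le> B"
    using compact_imp_bounded[OF compact_continuous_image[OF h K(1)]] by (auto simp: bounded_iff)
  moreover have "h \<in> borel_measurable (lebesgue_on S)"
    using continuous_on_subset[OF h K(2)] S by (rule continuous_imp_measurable_on_sets_lebesgue)
  ultimately show ?thesis using K by (intro L2_converges_mult[OF L]) auto
qed

section \<open>The limit argument on the annulus\<close>

locale sobolev_0_annulus =
  fixes a b :: real and \<Omega> :: "complex set" and u :: "complex \<Rightarrow> real" and \<phi> :: "nat \<Rightarrow> complex \<Rightarrow> real"
  assumes a: "0 < a" and \<Omega>_def: "\<Omega> = ball 0 b - cball 0 a"
    and \<phi>: "\<And>n. \<phi> n \<in> test_functions \<Omega>"
    and lim: "\<And>ds. ds \<in> multi_indices 2 \<Longrightarrow>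
      L2_converges (lebesgue_on \<Omega>) (\<lambda>n x. of_real (iter_partial (rev ds) (\<phi> n) x)) (\<lambda>x. of_real (weak_deriv \<Omega> ds u x))"
    and D_Nil: "AE x in lebesgue. x \<in> \<Omega> \<longrightarrow> weak_deriv \<Omega> [] u x = u x"
begin

abbreviation D :: "complex list \<Rightarrow> complex \<Rightarrow> real" where "D ds z \<equiv> weak_deriv \<Omega> ds u z"

text \<open>The closed annulus is compact and avoids the origin, so every power of
  \<open>|z|\<close>, also a negative one, is bounded on it and hence on
  \<open>\<Omega>\<close>.\<close>

definition K :: "complex set" where "K = cball 0 b - ball 0 a"

lemma K: "compact K" "\<Omega> \<subseteq> K" "z \<in> K \<Longrightarrow> z \<noteq> 0"
  unfolding K_def \<Omega>_def using a by (auto intro: compact_diff)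

lemma \<Omega>: "open \<Omega>" "\<Omega> \<in> sets lebesgue" "\<Omega> \<in> lmeasurable" "z \<in> \<Omega> \<Longrightarrow> z \<noteq> 0" "0 \<notin> \<Omega>"
proof -
  show o: "open \<Omega>" unfolding \<Omega>_def by (intro open_Diff) auto
  then show "\<Omega> \<in> sets lebesgue" by simp
  have "bounded \<Omega>" unfolding \<Omega>_def by (rule bounded_subset[of "ball 0 b"]) auto
  then show "\<Omega> \<in> lmeasurable" using o by (intro lmeasurable_open)
  show "z \<in> \<Omega> \<Longrightarrow> z \<noteq> 0" "0 \<notin> \<Omega>" using a by (auto simp: \<Omega>_def)
qed

lemma multi_indices_2 [simp]:
  "[] \<in> (multi_indices 2 :: complex list set)"
  "e \<in> Basis \<Longrightarrow> [e] \<in> (multi_indices 2 :: complex list set)"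
  "e \<in> Basis \<Longrightarrow> e' \<in> Basis \<Longrightarrow> [e, e'] \<in> (multi_indices 2 :: complex list set)"
  by (auto simp: multi_indices_def)

lemmas L2_mult = L2_converges_mult_continuous[OF _ \<Omega>(2) K(1) K(2)]

text \<open>Product rule for a weak derivative and a continuously differentiable complex weight. It
  is classical for the approximating test functions, and closedness of weak differentiation carries
  it to the limit. The new direction is appended at the end because the reversed list then applies
  it last.\<close>

lemma has_weak_deriv_weighted:
  fixes g :: "complex \<Rightarrow> complex"
  assumes ds: "ds \<in> multi_indices 2" "ds @ [e] \<in> multi_indices 2"
    and g: "\<And>z. z \<in> K \<Longrightarrow> (g has_derivative g' z) (at z)" and g'c: "continuous_on K (\<lambda>z. g' z e)"
  shows "has_weak_deriv \<Omega> [e] (\<lambda>z. g z * of_real (D ds z)) (\<lambda>z. g' z e * of_real (D ds z) + g z * of_real (D (ds @ [e]) z))"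
proof -
  have e: "e \<in> Basis" and dsB: "set (rev ds) \<subseteq> Basis" using ds by (auto simp: multi_indices_def)
  have gc: "continuous_on K g"
    using g by (meson continuous_at_imp_continuous_on has_derivative_continuous)
  let ?\<phi> = "\<lambda>n. iter_partial (rev ds) (\<phi> n)"
  have sm: "smooth (?\<phi> n)" for n
    by (rule test_functionsD(1)[OF test_functions_iter_partial[OF \<phi> dsB]])
  show ?thesis
  proof (rule has_weak_deriv_L2_limit[OF \<Omega>(3) e])
    show "L2_converges (lebesgue_on \<Omega>) (\<lambda>n z. g z * of_real (?\<phi> n z)) (\<lambda>z. g z * of_real (D ds z))"
      by (rule L2_mult[OF lim[OF ds(1)] gc])
    show "L2_converges (lebesgue_on \<Omega>)
        (\<lambda>n z. g' z e * of_real (?\<phi> n z) + g z * of_real (iter_partial (rev (ds @ [e])) (\<phi> n) z))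
        (\<lambda>z. g' z e * of_real (D ds z) + g z * of_real (D (ds @ [e]) z))"
      by (intro L2_converges_add L2_mult[OF lim] ds gc g'c)
    fix n
    define F' where "F' z h = g z * of_real (frechet_derivative (?\<phi> n) (at z) h) + g' z h * of_real (?\<phi> n z)" for z h
    have F'e: "F' z e = g' z e * of_real (?\<phi> n z) + g z * of_real (iter_partial (rev (ds @ [e])) (\<phi> n) z)" for z
      by (simp add: F'_def iter_partial_Cons partial_deriv_def)
    have "has_weak_deriv \<Omega> [e] (\<lambda>z. g z * of_real (?\<phi> n z)) (\<lambda>z. F' z e)"
    proof (rule has_weak_deriv_classical[OF \<Omega>(1) e])
      fix z assume "z \<in> \<Omega>"
      then have z: "z \<in> K" using K by auto
      have "((\<lambda>z. complex_of_real (?\<phi> n z)) has_derivative (\<lambda>h. of_real (frechet_derivative (?\<phi> n) (at z) h))) (at z)"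
        by (rule has_derivative_of_real[OF smooth_has_derivative[OF sm]])
      from has_derivative_mult[OF g[OF z] this]
      show "((\<lambda>z. g z * of_real (?\<phi> n z)) has_derivative F' z) (at z)"
        unfolding F'_def .
    next
      have c: "continuous_on \<Omega> (iter_partial es (\<phi> n))" if "set es \<subseteq> Basis" for es
        by (rule smooth_iter_partial_continuous[OF test_functionsD(1)[OF \<phi>] that])
      show "continuous_on \<Omega> (\<lambda>z. F' z e)"
        unfolding F'e using dsB e
        by (intro continuous_intros c continuous_on_subset[OF gc K(2)] continuous_on_subset[OF g'c K(2)]) auto
    qed
    then show "has_weak_deriv \<Omega> [e] (\<lambda>z. g z * of_real (?\<phi> n z))
        (\<lambda>z. g' z e * of_real (?\<phi> n z) + g z * of_real (iter_partial (rev (ds @ [e])) (\<phi> n) z))"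
      unfolding F'e .
  qed
qed

text \<open>The right-hand side is a sum of coefficients times derivatives, so that a second
  differentiation can again go through the product rule term by term.\<close>

lemma weak_dz_AE:
  "AE z in lebesgue. z \<in> \<Omega> \<longrightarrow>
     weak_dz \<Omega> (\<lambda>w. complex_of_real (u w)) z = 1 / 2 * of_real (D [1] z) + (- \<i> / 2) * of_real (D [\<i>] z)"
proof -
  have w: "has_weak_deriv \<Omega> [e] (\<lambda>z. 1 * complex_of_real (D [] z)) (\<lambda>z. 0 * of_real (D [] z) + 1 * of_real (D ([] @ [e]) z))"
    if "e \<in> Basis" for e
    by (rule has_weak_deriv_weighted[where g = "\<lambda>_. 1" and g' = "\<lambda>_ _. 0"]) (use that in auto)
  have "AE z in lebesgue. z \<in> \<Omega> \<longrightarrow> complex_of_real (u z) = 1 * of_real (D [] z)"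
    using D_Nil by eventually_elim simp
  from weak_dz_AE_eq[OF \<Omega>(1) this w[OF complex_Basis(1)] w[OF complex_Basis(2)]]
  show ?thesis by eventually_elim (simp add: field_simps)
qed

text \<open>The mixed weak derivatives \<open>D [1, \<i>]\<close> and \<open>D [\<i>, 1]\<close> are
  separate choices, so both are kept; \<open>L_jet\<close> has the matching shape.\<close>

lemma weak_dz_dz_AE:
  "AE z in lebesgue. z \<in> \<Omega> \<longrightarrow>
     weak_dz \<Omega> (weak_dz \<Omega> (\<lambda>w. complex_of_real (u w))) z =
     (of_real (D [1, 1] z - D [\<i>, \<i>] z) - \<i> * of_real (D [1, \<i>] z + D [\<i>, 1] z)) / 4"
proof -
  have w: "has_weak_deriv \<Omega> [e] (\<lambda>z. c * complex_of_real (D [e'] z)) (\<lambda>z. 0 * of_real (D [e'] z) + c * of_real (D ([e'] @ [e]) z))"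
    if "e \<in> Basis" "e' \<in> Basis" for e e' c
    by (rule has_weak_deriv_weighted[where g = "\<lambda>_. c" and g' = "\<lambda>_ _. 0"]) (use that in auto)
  have w': "has_weak_deriv \<Omega> [e] (\<lambda>z. 1 / 2 * of_real (D [1] z) + (- \<i> / 2) * of_real (D [\<i>] z))
     (\<lambda>z. (0 * of_real (D [1] z) + 1 / 2 * of_real (D ([1] @ [e]) z)) + (0 * of_real (D [\<i>] z) + (- \<i> / 2) * of_real (D ([\<i>] @ [e]) z)))"
    if "e \<in> Basis" for e
    by (rule has_weak_deriv_add[OF \<Omega>(2) _ w w]) (use that in auto)
  have alg: "(((0 * x + 1 / 2 * p) + (0 * y + (- \<i> / 2) * q)) - \<i> * ((0 * x + 1 / 2 * r) + (0 * y + (- \<i> / 2) * s))) / 2 =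
      ((p - s) - \<i> * (r + q)) / 4" for x y p q r s :: complex
    by (simp add: field_simps)
  from weak_dz_AE_eq[OF \<Omega>(1) weak_dz_AE w'[OF complex_Basis(1)] w'[OF complex_Basis(2)]]
  show ?thesis unfolding alg by eventually_elim simp
qed

text \<open>Two applications of the product rule to \<open>|z| powr k * u\<close>. Since
  \<open>2 \<partial>\<^sub>z |z|\<^sup>k = k |z|\<^sup>k / z\<close>, every term keeps the factor
  \<open>|z| powr k\<close>, which the outer \<open>|z| powr (1 - m)\<close> cancels.\<close>

lemma L_op_AE:
  fixes m :: real
  shows "AE z in lebesgue. z \<in> \<Omega> \<longrightarrow> L_op m \<Omega> u z = L_jet (m - 1) (\<lambda>ds. D ds z) z"
proof -
  define k where "k = m - 1"
  define R where "R z = complex_of_real (cmod z powr k)" for z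
  define R' where "R' z h = complex_of_real (k * cmod z powr (k - 2) * (Re z * Re h + Im z * Im h))" for z h
  have R: "(R has_derivative R' z) (at z)" if "z \<in> K" for z
    unfolding R_def[abs_def] R'_def[abs_def]
    by (rule has_derivative_of_real[OF has_derivative_norm_powr[OF K(3)[OF that]]])
  have nz: "\<forall>z\<in>K. cmod z \<noteq> 0" "\<forall>z\<in>K. z \<noteq> 0" using K by auto
  have R'c: "continuous_on K (\<lambda>z. R' z e)" for e
    unfolding R'_def by (intro continuous_intros nz)
  have Rc: "continuous_on K R" unfolding R_def[abs_def] by (intro continuous_intros nz)
  \<comment> \<open>The gradient of \<open>|z| powr k\<close> contributes \<open>cnj z\<close>, and
    \<open>|z|\<^sup>2 = z * cnj z\<close> converts it into \<open>1 / z\<close>.\<close>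
  have R'z: "R' z 1 - \<i> * R' z \<i> = of_real k * R z / z" if "z \<noteq> 0" for z
  proof -
    have "R' z 1 - \<i> * R' z \<i> = of_real k * of_real (cmod z powr (k - 2)) * cnj z"
      by (simp add: R'_def complex_eq_iff algebra_simps)
    moreover have "R z = of_real (cmod z powr (k - 2)) * (z * cnj z)"
      unfolding R_def norm_powr_eq_sq[OF that, of k] by (simp add: complex_mult_cnj)
    ultimately show ?thesis using that by simp
  qed
  have w0: "has_weak_deriv \<Omega> [e] (\<lambda>z. R z * of_real (D [] z)) (\<lambda>z. R' z e * of_real (D [] z) + R z * of_real (D ([] @ [e]) z))"
    if "e \<in> Basis" for e
    by (rule has_weak_deriv_weighted[OF _ _ R R'c]) (use that in auto)
  have "AE z in lebesgue. z \<in> \<Omega> \<longrightarrow> complex_of_real (cmod z powr k * u z) = R z * of_real (D [] z)"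
    using D_Nil by eventually_elim (simp add: R_def)
  from weak_dz_AE_eq[OF \<Omega>(1) this w0[OF complex_Basis(1)] w0[OF complex_Basis(2)]]
  have first: "AE z in lebesgue. z \<in> \<Omega> \<longrightarrow> weak_dz \<Omega> (\<lambda>w. complex_of_real (cmod w powr k * u w)) z =
      (of_real k / 2 * (R z / z)) * of_real (D [] z) + ((1 / 2 * R z) * of_real (D [1] z) + (- \<i> / 2 * R z) * of_real (D [\<i>] z))"
  proof eventually_elim
    case (elim z)
    show ?case
    proof
      assume z: "z \<in> \<Omega>"
      then have z0: "z \<noteq> 0" using \<Omega> by auto
      have "weak_dz \<Omega> (\<lambda>w. complex_of_real (cmod w powr k * u w)) z =
        ((R' z 1 * of_real (D [] z) + R z * of_real (D ([] @ [1]) z)) - \<i> * (R' z \<i> * of_real (D [] z) + R z * of_real (D ([] @ [\<i>]) z))) / 2"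
        using elim z by blast
      also have "\<dots> = ((R' z 1 - \<i> * R' z \<i>) * of_real (D [] z) + R z * (of_real (D [1] z) - \<i> * of_real (D [\<i>] z))) / 2"
        by (simp add: algebra_simps)
      also have "\<dots> = (of_real k / 2 * (R z / z)) * of_real (D [] z) + ((1 / 2 * R z) * of_real (D [1] z) + (- \<i> / 2 * R z) * of_real (D [\<i>] z))"
        unfolding R'z[OF z0] using z0 by (simp add: field_simps)
      finally show "weak_dz \<Omega> (\<lambda>w. complex_of_real (cmod w powr k * u w)) z =
      (of_real k / 2 * (R z / z)) * of_real (D [] z) + ((1 / 2 * R z) * of_real (D [1] z) + (- \<i> / 2 * R z) * of_real (D [\<i>] z))" .
    qed
  qed
  define g' where "g' z h = of_real k / 2 * ((R' z h * z - R z * h) / (z * z))" for z h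
  have g': "((\<lambda>z. of_real k / 2 * (R z / z)) has_derivative g' z) (at z)" if "z \<in> K" for z
  proof -
    have "((\<lambda>z. R z / z) has_derivative (\<lambda>h. (R' z h * z - R z * h) / (z * z))) (at z)"
      by (rule has_derivative_divide'[OF R[OF that] has_derivative_ident K(3)[OF that]])
    then show ?thesis unfolding g'_def by (rule has_derivative_mult_right)
  qed
  have g'c: "continuous_on K (\<lambda>z. g' z e)" for e
    unfolding g'_def using nz by (intro continuous_intros R'c Rc) auto
  have w1: "has_weak_deriv \<Omega> [e] (\<lambda>z. (of_real k / 2 * (R z / z)) * of_real (D [] z))
      (\<lambda>z. g' z e * of_real (D [] z) + (of_real k / 2 * (R z / z)) * of_real (D ([] @ [e]) z))" if "e \<in> Basis" for e
    by (rule has_weak_deriv_weighted[OF _ _ g' g'c]) (use that in auto)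
  have w2: "has_weak_deriv \<Omega> [e] (\<lambda>z. (c * R z) * of_real (D [e'] z))
      (\<lambda>z. (c * R' z e) * of_real (D [e'] z) + (c * R z) * of_real (D ([e'] @ [e]) z))"
    if "e \<in> Basis" "e' \<in> Basis" for e e' c
    by (rule has_weak_deriv_weighted[where g' = "\<lambda>z h. c * R' z h"])
      (use that R in \<open>auto intro!: has_derivative_mult_right continuous_intros R'c\<close>)
  let ?J = "\<lambda>e z. (g' z e * of_real (D [] z) + (of_real k / 2 * (R z / z)) * of_real (D ([] @ [e]) z)) +
     (((1 / 2 * R' z e) * of_real (D [1] z) + (1 / 2 * R z) * of_real (D ([1] @ [e]) z)) +
      ((- \<i> / 2 * R' z e) * of_real (D [\<i>] z) + (- \<i> / 2 * R z) * of_real (D ([\<i>] @ [e]) z)))"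
  have w3: "has_weak_deriv \<Omega> [e] (\<lambda>z. (of_real k / 2 * (R z / z)) * of_real (D [] z) +
      ((1 / 2 * R z) * of_real (D [1] z) + (- \<i> / 2 * R z) * of_real (D [\<i>] z))) (?J e)" if "e \<in> Basis" for e
    by (rule has_weak_deriv_add[OF \<Omega>(2) _ w1 has_weak_deriv_add[OF \<Omega>(2) _ w2 w2]]) (use that in auto)
  have "(?J 1 z - \<i> * ?J \<i> z) / 2 = R z * L_jet k (\<lambda>ds. D ds z) z" if "z \<noteq> 0" for z
  proof -
    \<comment> \<open>Differentiating \<open>R / z\<close> by \<open>2 \<partial>\<^sub>z\<close>
      gives \<open>k R / z\<^sup>2\<close> from \<open>R\<close> and
      \<open>- 2 R / z\<^sup>2\<close> from \<open>1 / z\<close>; this is the origin of the factor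
      \<open>k - 2\<close>, that is \<open>m - 3\<close>.\<close>
    have 1: "g' z 1 - \<i> * g' z \<i> = of_real k / 2 * ((of_real k - 2) * R z / z\<^sup>2)"
    proof -
      have "g' z 1 - \<i> * g' z \<i> = of_real k / 2 * (((R' z 1 - \<i> * R' z \<i>) * z - 2 * R z) / (z * z))"
        using that by (simp add: g'_def field_simps)
      then show ?thesis unfolding R'z[OF that] using that by (simp add: field_simps power2_eq_square)
    qed
    have "?J 1 z - \<i> * ?J \<i> z = (g' z 1 - \<i> * g' z \<i>) * of_real (D [] z) +
        (R' z 1 - \<i> * R' z \<i>) * ((of_real (D [1] z) - \<i> * of_real (D [\<i>] z)) / 2) +
        of_real k / 2 * (R z / z) * (of_real (D [1] z) - \<i> * of_real (D [\<i>] z)) +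
        R z / 2 * (of_real (D [1, 1] z - D [\<i>, \<i>] z) - \<i> * of_real (D [1, \<i>] z + D [\<i>, 1] z))"
      using that by (simp add: field_simps)
    also have "\<dots> = 2 * (R z * L_jet k (\<lambda>ds. D ds z) z)"
      unfolding 1 R'z[OF that] L_jet_def using that by (simp add: field_simps power2_eq_square)
    finally show ?thesis by simp
  qed
  note J = this
  show ?thesis
    using weak_dz_AE_eq[OF \<Omega>(1) first w3[OF complex_Basis(1)] w3[OF complex_Basis(2)]]
  proof eventually_elim
    case (elim z)
    show ?case
    proof
      assume z: "z \<in> \<Omega>"
      then have z0: "z \<noteq> 0" using \<Omega> by auto
      have "cmod z powr (1 - m) * cmod z powr k = 1"
        using z0 powr_add[of "cmod z" "1 - m" k] by (simp add: k_def)
      then have c: "of_real (cmod z powr (1 - m)) * R z = 1"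
        unfolding R_def of_real_mult[symmetric] by simp
      have "weak_dz \<Omega> (weak_dz \<Omega> (\<lambda>w. complex_of_real (cmod w powr k * u w))) z = (?J 1 z - \<i> * ?J \<i> z) / 2"
        using elim z by blast
      also have "\<dots> = R z * L_jet k (\<lambda>ds. D ds z) z" by (rule J[OF z0])
      finally have "L_op m \<Omega> u z = (of_real (cmod z powr (1 - m)) * R z) * L_jet k (\<lambda>ds. D ds z) z"
        unfolding L_op_def k_def[symmetric] by (simp only: mult.assoc)
      then show "L_op m \<Omega> u z = L_jet (m - 1) (\<lambda>ds. D ds z) z"
        unfolding c k_def by simp
    qed
  qed
qed

lemma L2_converges_L_jet:
  "L2_converges (lebesgue_on \<Omega>) (\<lambda>n z. L_jet k (\<lambda>ds. iter_partial (rev ds) (\<phi> n) z) z) (\<lambda>z. L_jet k (\<lambda>ds. D ds z) z)"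
proof -
  \<comment> \<open>A sum of coefficients times derivatives, each coefficient continuous on the
    compact annulus. At \<open>z = 0\<close> the identity holds as well, by the convention for
    division by 0.\<close>
  have e: "L_jet k J z = 1 / 4 * of_real (J [1, 1]) + (- 1 / 4) * of_real (J [\<i>, \<i>]) + (- \<i> / 4) * of_real (J [1, \<i>]) +
     (- \<i> / 4) * of_real (J [\<i>, 1]) + (of_real k / (2 * z)) * of_real (J [1]) + (- \<i> * of_real k / (2 * z)) * of_real (J [\<i>]) +
     (of_real (k * (k - 2)) / (4 * z\<^sup>2)) * of_real (J [])" for J z
    unfolding L_jet_def by (cases "z = 0") (simp_all add: field_simps)
  have nz: "\<forall>z\<in>K. 2 * z \<noteq> 0" "\<forall>z\<in>K. 4 * z\<^sup>2 \<noteq> 0" using K by auto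
  show ?thesis
    unfolding e by (intro L2_converges_add L2_mult[OF lim] continuous_intros nz) auto
qed

text \<open>The weight \<open>|z| powr (2 * q)\<close> is the square of the bounded multiplier
  \<open>|z| powr q\<close>, so weighted convergence is ordinary L2 convergence of the multiplied
  functions.\<close>

lemma L2_converges_weighted:
  assumes "L2_converges (lebesgue_on \<Omega>) F f"
  shows "integrable (lebesgue_on \<Omega>) (\<lambda>z. cmod z powr (2 * q) * (cmod (f z))\<^sup>2)"
    and "(\<lambda>n. \<integral>z. cmod z powr (2 * q) * (cmod (F n z))\<^sup>2 \<partial>lebesgue_on \<Omega>) \<longlonglongrightarrow>
      (\<integral>z. cmod z powr (2 * q) * (cmod (f z))\<^sup>2 \<partial>lebesgue_on \<Omega>)"
    and "integrable (lebesgue_on \<Omega>) (\<lambda>z. cmod z powr (2 * q) * (cmod (F n z))\<^sup>2)"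
proof -
  have "\<forall>z\<in>K. cmod z \<noteq> 0" using K by auto
  then have L: "L2_converges (lebesgue_on \<Omega>) (\<lambda>n z. of_real (cmod z powr q) * F n z) (\<lambda>z. of_real (cmod z powr q) * f z)"
    by (intro L2_mult[OF assms] continuous_intros)
  have e: "(cmod (of_real (cmod z powr q) * w))\<^sup>2 = cmod z powr (2 * q) * (cmod w)\<^sup>2" for z w :: complex
    by (simp add: norm_mult power_mult_distrib power2_eq_square flip: powr_add)
  show "integrable (lebesgue_on \<Omega>) (\<lambda>z. cmod z powr (2 * q) * (cmod (f z))\<^sup>2)"
    using L unfolding L2_converges_def e by blast
  show "integrable (lebesgue_on \<Omega>) (\<lambda>z. cmod z powr (2 * q) * (cmod (F n z))\<^sup>2)"
    using L2_converges_square_integral(1)[OF L] unfolding e .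
  show "(\<lambda>n. \<integral>z. cmod z powr (2 * q) * (cmod (F n z))\<^sup>2 \<partial>lebesgue_on \<Omega>) \<longlonglongrightarrow>
      (\<integral>z. cmod z powr (2 * q) * (cmod (f z))\<^sup>2 \<partial>lebesgue_on \<Omega>)"
    using L2_converges_square_integral(2)[OF L] unfolding e .
qed

lemma limit_inequalities:
  fixes k \<gamma> :: real
  assumes k: "k \<ge> 2" and \<gamma>: "\<gamma> < k / 2"
  shows "2 * (k * (k - 2 * \<gamma>)) * (\<gamma> - 1)\<^sup>2 * (\<integral>z. cmod z powr (2 * (\<gamma> - 2)) * (D [] z)\<^sup>2 \<partial>lebesgue_on \<Omega>) \<le>
      16 * (\<integral>z. cmod z powr (2 * \<gamma>) * (cmod (L_jet k (\<lambda>ds. D ds z) z))\<^sup>2 \<partial>lebesgue_on \<Omega>)"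
    and "2 * (k * (k - 2 * \<gamma>)) * (\<integral>z. cmod z powr (2 * (\<gamma> - 1)) * ((D [1] z)\<^sup>2 + (D [\<i>] z)\<^sup>2) \<partial>lebesgue_on \<Omega>) \<le>
      16 * (\<integral>z. cmod z powr (2 * \<gamma>) * (cmod (L_jet k (\<lambda>ds. D ds z) z))\<^sup>2 \<partial>lebesgue_on \<Omega>)"
proof -
  note rhs = L2_converges_weighted(2)[OF L2_converges_L_jet[of k], of \<gamma>]
  note ineq = test_function_inequality[OF \<Omega>(1,5) \<phi> k \<gamma>, unfolded set_lebesgue_integral_lebesgue_on[OF \<Omega>(2)]]
  have g: "2 * \<gamma> - 4 = 2 * (\<gamma> - 2)" "2 * \<gamma> - 2 = 2 * (\<gamma> - 1)" by simp_all
  note l0 = L2_converges_weighted(2)[OF lim[of "[]"], of "\<gamma> - 2", simplified norm_of_real power2_abs]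
  show "2 * (k * (k - 2 * \<gamma>)) * (\<gamma> - 1)\<^sup>2 * (\<integral>z. cmod z powr (2 * (\<gamma> - 2)) * (D [] z)\<^sup>2 \<partial>lebesgue_on \<Omega>) \<le>
      16 * (\<integral>z. cmod z powr (2 * \<gamma>) * (cmod (L_jet k (\<lambda>ds. D ds z) z))\<^sup>2 \<partial>lebesgue_on \<Omega>)"
  proof (rule LIMSEQ_le[OF tendsto_mult_left[OF l0] tendsto_mult_left[OF rhs]])
    show "\<exists>N. \<forall>n\<ge>N. 2 * (k * (k - 2 * \<gamma>)) * (\<gamma> - 1)\<^sup>2 * (\<integral>z. cmod z powr (2 * (\<gamma> - 2)) * (iter_partial (rev []) (\<phi> n) z)\<^sup>2 \<partial>lebesgue_on \<Omega>) \<le>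
      16 * (\<integral>z. cmod z powr (2 * \<gamma>) * (cmod (L_jet k (\<lambda>ds. iter_partial (rev ds) (\<phi> n) z) z))\<^sup>2 \<partial>lebesgue_on \<Omega>)"
      using ineq(1) unfolding g by simp
  qed simp
  note w1 = L2_converges_weighted[OF lim[of "[1]"], of "\<gamma> - 1", simplified norm_of_real power2_abs]
  note w2 = L2_converges_weighted[OF lim[of "[\<i>]"], of "\<gamma> - 1", simplified norm_of_real power2_abs]
  have l1: "(\<lambda>n. \<integral>z. cmod z powr (2 * (\<gamma> - 1)) * ((partial_deriv 1 (\<phi> n) z)\<^sup>2 + (partial_deriv \<i> (\<phi> n) z)\<^sup>2) \<partial>lebesgue_on \<Omega>) \<longlonglongrightarrow>
     (\<integral>z. cmod z powr (2 * (\<gamma> - 1)) * ((D [1] z)\<^sup>2 + (D [\<i>] z)\<^sup>2) \<partial>lebesgue_on \<Omega>)"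
    using tendsto_add[OF w1(2) w2(2)] w1(1,3) w2(1,3)
    by (simp add: distrib_left iter_partial_Cons)
  show "2 * (k * (k - 2 * \<gamma>)) * (\<integral>z. cmod z powr (2 * (\<gamma> - 1)) * ((D [1] z)\<^sup>2 + (D [\<i>] z)\<^sup>2) \<partial>lebesgue_on \<Omega>) \<le>
      16 * (\<integral>z. cmod z powr (2 * \<gamma>) * (cmod (L_jet k (\<lambda>ds. D ds z) z))\<^sup>2 \<partial>lebesgue_on \<Omega>)"
    using ineq(2) unfolding g by (intro LIMSEQ_le[OF tendsto_mult_left[OF l1] tendsto_mult_left[OF rhs]]) blast
qed

text \<open>Division by \<open>2 * c\<close> produces the constant \<open>8 / c\<close>;
  \<open>c\<close> will be \<open>k (k - 2 \<gamma>)\<close>, with the extra factor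
  \<open>(\<gamma> - 1)\<^sup>2\<close> in the inequality for \<open>u\<close>.\<close>

lemma ennreal_inequality:
  fixes c A B :: real
  assumes le: "2 * c * A \<le> 16 * B" and c: "c > 0" and B: "B \<ge> 0"
  shows "ennreal A \<le> ennreal (8 / c) * ennreal B"
proof -
  have "A \<le> 8 / c * B" using le c by (simp add: field_simps)
  then show ?thesis using c B by (simp flip: ennreal_mult'' add: ennreal_leI)
qed

lemma nn_L_op:
  "(\<integral>\<^sup>+ z\<in>\<Omega>. ennreal ((cmod (L_op m \<Omega> u z))\<^sup>2 * cmod z powr (2 * \<gamma>)) \<partial>lebesgue) =
   ennreal (\<integral>z. cmod z powr (2 * \<gamma>) * (cmod (L_jet (m - 1) (\<lambda>ds. D ds z) z))\<^sup>2 \<partial>lebesgue_on \<Omega>)"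
proof (rule set_nn_integral_eq_integral_AE[OF \<Omega>(2) L2_converges_weighted(1)[OF L2_converges_L_jet]])
  show "AE z in lebesgue. z \<in> \<Omega> \<longrightarrow> (cmod (L_op m \<Omega> u z))\<^sup>2 * cmod z powr (2 * \<gamma>) =
      cmod z powr (2 * \<gamma>) * (cmod (L_jet (m - 1) (\<lambda>ds. D ds z) z))\<^sup>2"
    using L_op_AE[of m] by eventually_elim simp
qed simp

lemma nn_u:
  "(\<integral>\<^sup>+ z\<in>\<Omega>. ennreal ((u z)\<^sup>2 / cmod z ^ 4 * cmod z powr (2 * \<gamma>)) \<partial>lebesgue) =
   ennreal (\<integral>z. cmod z powr (2 * (\<gamma> - 2)) * (D [] z)\<^sup>2 \<partial>lebesgue_on \<Omega>)"
proof (rule set_nn_integral_eq_integral_AE[OF \<Omega>(2)])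
  show "integrable (lebesgue_on \<Omega>) (\<lambda>z. cmod z powr (2 * (\<gamma> - 2)) * (D [] z)\<^sup>2)"
    using L2_converges_weighted(1)[OF lim[of "[]"], of "\<gamma> - 2"] by simp
  show "AE z in lebesgue. z \<in> \<Omega> \<longrightarrow> (u z)\<^sup>2 / cmod z ^ 4 * cmod z powr (2 * \<gamma>) = cmod z powr (2 * (\<gamma> - 2)) * (D [] z)\<^sup>2"
    using D_Nil
  proof eventually_elim
    case (elim z)
    show ?case
    proof
      assume z: "z \<in> \<Omega>"
      then have "cmod z > 0" using \<Omega> by auto
      then have "cmod z powr (2 * (\<gamma> - 2)) = cmod z powr (2 * \<gamma>) / cmod z ^ 4"
        using powr_diff[of "cmod z" "2 * \<gamma>" 4] by (simp add: powr_numeral algebra_simps)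
      then show "(u z)\<^sup>2 / cmod z ^ 4 * cmod z powr (2 * \<gamma>) = cmod z powr (2 * (\<gamma> - 2)) * (D [] z)\<^sup>2"
        using elim z by simp
    qed
  qed
qed simp

lemma nn_grad:
  "(\<integral>\<^sup>+ z\<in>\<Omega>. ennreal ((norm (weak_grad \<Omega> u z))\<^sup>2 / (cmod z)\<^sup>2 * cmod z powr (2 * \<gamma>)) \<partial>lebesgue) =
   ennreal (\<integral>z. cmod z powr (2 * (\<gamma> - 1)) * ((D [1] z)\<^sup>2 + (D [\<i>] z)\<^sup>2) \<partial>lebesgue_on \<Omega>)"
proof (rule set_nn_integral_eq_integral_AE[OF \<Omega>(2)])
  show "integrable (lebesgue_on \<Omega>) (\<lambda>z. cmod z powr (2 * (\<gamma> - 1)) * ((D [1] z)\<^sup>2 + (D [\<i>] z)\<^sup>2))"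
    using L2_converges_weighted(1)[OF lim[of "[1]"], of "\<gamma> - 1"] L2_converges_weighted(1)[OF lim[of "[\<i>]"], of "\<gamma> - 1"]
    by (simp add: distrib_left)
  show "AE z in lebesgue. z \<in> \<Omega> \<longrightarrow> (norm (weak_grad \<Omega> u z))\<^sup>2 / (cmod z)\<^sup>2 * cmod z powr (2 * \<gamma>) =
      cmod z powr (2 * (\<gamma> - 1)) * ((D [1] z)\<^sup>2 + (D [\<i>] z)\<^sup>2)"
  proof (intro AE_I2 impI)
    fix z assume z: "z \<in> \<Omega>"
    then have "cmod z > 0" using \<Omega> by auto
    then have "cmod z powr (2 * (\<gamma> - 1)) = cmod z powr (2 * \<gamma>) / (cmod z)\<^sup>2"
      using powr_diff[of "cmod z" "2 * \<gamma>" 2] by (simp add: powr_numeral algebra_simps)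
    moreover have "(norm (weak_grad \<Omega> u z))\<^sup>2 = (D [1] z)\<^sup>2 + (D [\<i>] z)\<^sup>2"
      by (simp add: weak_grad_def Basis_complex_def cmod_power2)
    ultimately show "(norm (weak_grad \<Omega> u z))\<^sup>2 / (cmod z)\<^sup>2 * cmod z powr (2 * \<gamma>) =
      cmod z powr (2 * (\<gamma> - 1)) * ((D [1] z)\<^sup>2 + (D [\<i>] z)\<^sup>2)" by simp
  qed
qed simp

end

text \<open>Nonnegative integrals give both inequalities a meaning independent of integrability. The
  constants are positive under the stated restrictions, so \<open>ennreal\<close> truncates
  nothing.\<close>

theorem theorem2p2:
  fixes m a b :: real and \<Omega> :: "complex set" and u :: "complex \<Rightarrow> real"
  assumes "3 \<le> m"
    and "0 < a" and "a < b"
    and "\<Omega> = ball 0 b - cball 0 a"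
    and "u \<in> sobolev_0 2 \<Omega>"
  shows
    "(AE z in lebesgue. z \<in> \<Omega> \<longrightarrow>
        L_op m \<Omega> u z =
          weak_dz \<Omega> (weak_dz \<Omega> (\<lambda>w. complex_of_real (u w))) z
          + of_real (m - 1) / z * weak_dz \<Omega> (\<lambda>w. complex_of_real (u w)) z
          + of_real ((m - 1) * (m - 3)) / (4 * z\<^sup>2) * of_real (u z)) \<and>
     (\<forall>\<beta>::real. \<beta> < (m - 1) / 4 \<and> \<beta> \<noteq> 1 / 2 \<longrightarrow>
        (\<integral>\<^sup>+ z\<in>\<Omega>. ennreal ((u z)\<^sup>2 / cmod z ^ 4 * cmod z powr (4 * \<beta>)) \<partial>lebesgue)
        \<le> ennreal (8 / ((m - 1) * (m - 1 - 4 * \<beta>) * (1 - 2 * \<beta>)\<^sup>2)) *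
          (\<integral>\<^sup>+ z\<in>\<Omega>. ennreal ((cmod (L_op m \<Omega> u z))\<^sup>2 * cmod z powr (4 * \<beta>)) \<partial>lebesgue)) \<and>
     (\<forall>\<gamma>::real. \<gamma> < (m - 1) / 2 \<and> \<gamma> \<noteq> 1 \<longrightarrow>
        (\<integral>\<^sup>+ z\<in>\<Omega>. ennreal ((norm (weak_grad \<Omega> u z))\<^sup>2 / (cmod z)\<^sup>2 * cmod z powr (2 * \<gamma>)) \<partial>lebesgue)
        \<le> ennreal (8 / ((m - 1) * (m - 1 - 2 * \<gamma>))) *
          (\<integral>\<^sup>+ z\<in>\<Omega>. ennreal ((cmod (L_op m \<Omega> u z))\<^sup>2 * cmod z powr (2 * \<gamma>)) \<partial>lebesgue))"
proof -
  have op: "open \<Omega>" unfolding assms(4) by (intro open_Diff) auto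
  obtain \<phi> :: "nat \<Rightarrow> complex \<Rightarrow> real" where "sobolev_0_annulus a b \<Omega> u \<phi>"
    using sobolev_0_approx[OF op assms(5)] assms(2,4) unfolding sobolev_0_annulus_def by metis
  then interpret sobolev_0_annulus a b \<Omega> u \<phi> .
  have k: "m - 1 \<ge> 2" using assms(1) by simp
  have nn: "(\<integral>z. cmod z powr q * (cmod (L_jet (m - 1) (\<lambda>ds. D ds z) z))\<^sup>2 \<partial>lebesgue_on \<Omega>) \<ge> 0" for q
    by simp
  have "AE z in lebesgue. z \<in> \<Omega> \<longrightarrow>
        L_op m \<Omega> u z =
          weak_dz \<Omega> (weak_dz \<Omega> (\<lambda>w. complex_of_real (u w))) z
          + of_real (m - 1) / z * weak_dz \<Omega> (\<lambda>w. complex_of_real (u w)) z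
          + of_real ((m - 1) * (m - 3)) / (4 * z\<^sup>2) * of_real (u z)"
    using L_op_AE[of m] weak_dz_AE weak_dz_dz_AE D_Nil
    by eventually_elim (simp add: L_jet_def diff_divide_distrib)
  moreover have "(\<integral>\<^sup>+ z\<in>\<Omega>. ennreal ((u z)\<^sup>2 / cmod z ^ 4 * cmod z powr (4 * \<beta>)) \<partial>lebesgue)
        \<le> ennreal (8 / ((m - 1) * (m - 1 - 4 * \<beta>) * (1 - 2 * \<beta>)\<^sup>2)) *
          (\<integral>\<^sup>+ z\<in>\<Omega>. ennreal ((cmod (L_op m \<Omega> u z))\<^sup>2 * cmod z powr (4 * \<beta>)) \<partial>lebesgue)"
    if \<beta>: "\<beta> < (m - 1) / 4" "\<beta> \<noteq> 1 / 2" for \<beta>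
  proof -
    have e: "4 * \<beta> = 2 * (2 * \<beta>)" by simp
    have \<beta>': "2 * \<beta> < (m - 1) / 2" using \<beta> by simp
    \<comment> \<open>With \<open>\<gamma> = 2 * \<beta>\<close> the factor
      \<open>(\<gamma> - 1)\<^sup>2\<close> becomes \<open>(1 - 2 * \<beta>)\<^sup>2\<close>, and
      \<open>\<beta> \<noteq> 1 / 2\<close> keeps it positive, as the division requires.\<close>
    have c: "(m - 1) * (m - 1 - 2 * (2 * \<beta>)) * (1 - 2 * \<beta>)\<^sup>2 > 0" using \<beta> k by (intro mult_pos_pos) auto
    show ?thesis
      unfolding e nn_u nn_L_op
      by (rule ennreal_inequality[OF _ c nn])
        (use limit_inequalities(1)[OF k \<beta>'] in \<open>simp only: power2_commute[of 1] mult.assoc\<close>)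
  qed
  moreover have "(\<integral>\<^sup>+ z\<in>\<Omega>. ennreal ((norm (weak_grad \<Omega> u z))\<^sup>2 / (cmod z)\<^sup>2 * cmod z powr (2 * \<gamma>)) \<partial>lebesgue)
        \<le> ennreal (8 / ((m - 1) * (m - 1 - 2 * \<gamma>))) *
          (\<integral>\<^sup>+ z\<in>\<Omega>. ennreal ((cmod (L_op m \<Omega> u z))\<^sup>2 * cmod z powr (2 * \<gamma>)) \<partial>lebesgue)"
    if \<gamma>: "\<gamma> < (m - 1) / 2" for \<gamma>
  proof -
    have c: "(m - 1) * (m - 1 - 2 * \<gamma>) > 0" using \<gamma> k by (intro mult_pos_pos) auto
    show ?thesis
      unfolding nn_grad nn_L_op by (rule ennreal_inequality[OF limit_inequalities(2)[OF k \<gamma>] c nn])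
  qed
  ultimately show ?thesis by blast
qed

end
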